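(* For all $\epsilon>0$ and natural numbers $s$ and $k$, the following holds for all sufficiently large, well-spaced finite subsets $A$ of $\mathbb{R}$: \[ J_{s,k}(A) \leq X_A^{\epsilon}\left(|A|^s + |A|^{2s-k(k+1)/2}\right). \]
   Context: For a finite set $A\subseteq\mathbb{R}$ and natural numbers $s,k$, $J_{s,k}(A)$ denotes the number of solutions $(x_1,\dots,x_s,y_1,\dots,y_s)\in A^{2s}$ of the system $\sum_{i=1}^s x_i^j = \sum_{i=1}^s y_i^j$ for $1\le j\le k$. The diameter of $A$ is $X_A = |\sup A - \inf A|$. A finite set $A\subseteq \mathbb{R}$ is well-spaced if $|A\cap (j,j+1]|\le 1$ for all integers $j\in[\inf A - 1,\sup A]$. *)

theory Defs
  imports Complex_Main "HOL-Library.FuncSet"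
begin

text \<open>
  The \<open>s\<close>-tuples over \<open>A\<close> are the extensional functions on \<open>{1..s}\<close>, so that
  distinct elements of the set counted below are distinct solutions.
\<close>

definition mean_value :: "nat \<Rightarrow> nat \<Rightarrow> real set \<Rightarrow> nat" where
  "mean_value s k A =
     card {(x, y). x \<in> {1..s} \<rightarrow>\<^sub>E A \<and> y \<in> {1..s} \<rightarrow>\<^sub>E A \<and>
                   (\<forall>j\<in>{1..k}. (\<Sum>i=1..s. x i ^ j) = (\<Sum>i=1..s. y i ^ j))}"

definition set_diameter :: "real set \<Rightarrow> real" where
  "set_diameter A = \<bar>Sup A - Inf A\<bar>"

definition well_spaced :: "real set \<Rightarrow> bool" where
  "well_spaced A \<longleftrightarrow>
     finite A \<and>
     (\<forall>j::int. Inf A - 1 \<le> of_int j \<and> of_int j \<le> Sup A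
        \<longrightarrow> card (A \<inter> {of_int j <.. of_int j + 1}) \<le> 1)"

end

theory Submission
  imports Defs "HOL-Analysis.Analysis"
begin

text \<open>
  The estimate follows from discrete \<open>\<ell>\<^sup>2\<close>-decoupling for the moment curve at the critical
  exponent \<open>k (k + 1)\<close>, proved along the lines of Guo, Li, Yung and Zorin-Kranich (after Wooley's
  nested efficient congruencing). As the critical exponent is even, no harmonic analysis is needed:
  one works with functions \<open>f i\<close> on a finite weighted space whose correlations
  \<open>\<Sum>w. \<mu> w * f x\<^sub>1 w * \<dots> * cnj (f y\<^sub>1 w) * \<dots>\<close> are nonnegative and vanish unless the positions
  \<open>\<pi> x\<^sub>1, \<dots>, \<pi> y\<^sub>1, \<dots>\<close> solve the Vinogradov system of degree \<open>k\<close> up to an error \<open>\<delta>^k\<close>.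
  Nonnegativity makes moments monotone in the index set. Both properties survive multiplying \<open>\<mu>\<close> by
  an even power of \<open>\<bar>\<Sum>i\<in>C. f i\<bar>\<close>; if \<open>C\<close> occupies a short interval away from \<open>B\<close>, then with
  respect to the new weight the family over \<open>B\<close> solves locally a Vinogradov system of lower degree
  \<open>l\<close>, so that induction on \<open>k\<close> applies to it. Alternating this with Hoelder's inequality improves
  bilinear estimates, hence any positive exponent \<open>\<eta>\<close> of the decoupling constant.
\<close>

section \<open>Finite sums and cells\<close>

text \<open>Why every positive exponent \<eta> can be lowered: work with intervals of length
  \<delta>^b. In degree l = 0 the bilinear estimate is decoupling of one such interval down to scale
  \<delta>, and it saves \<eta> b in the exponent. Each round passes savings on to the other
  degrees, and after n rounds some degree l with 1 \<le> l < k saves at least \<eta> b n / k.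
  Cutting arbitrary separated sets into intervals of length \<delta>^b costs b (k (k + 1) + 2). Both
  quantities are linear in b, but only the saving grows with n, so a large n wins however small
  \<eta> is. A round can enlarge b by a factor up to k, so b has to start below k^-(n+1); this is
  harmless, since b cancels in the comparison.

  Restriction to an interval, affine rescaling and reweighting all change the family or its weight.
  For this reason decoupling is stated with one constant for all finite weighted families, a class
  that these operations preserve, and not for exponential sums over one set.\<close>

lemma sum_holder:
  fixes \<mu> g Y Z :: "'w \<Rightarrow> real"
  assumes fin: "finite \<Omega>" and ab: "a + b > 0"
    and mu: "\<And>w. w \<in> \<Omega> \<Longrightarrow> 0 \<le> \<mu> w" and g: "\<And>w. w \<in> \<Omega> \<Longrightarrow> 0 \<le> g w"
    and Y: "\<And>w. w \<in> \<Omega> \<Longrightarrow> 0 \<le> Y w" and Z: "\<And>w. w \<in> \<Omega> \<Longrightarrow> 0 \<le> Z w"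
    and le: "\<And>w. w \<in> \<Omega> \<Longrightarrow> g w ^ (a + b) \<le> Y w ^ a * Z w ^ b"
  shows "(\<Sum>w\<in>\<Omega>. \<mu> w * g w) ^ (a + b) \<le> (\<Sum>w\<in>\<Omega>. \<mu> w * Y w) ^ a * (\<Sum>w\<in>\<Omega>. \<mu> w * Z w) ^ b"
proof -
  consider "a = 0" | "b = 0" | "a > 0" "b > 0" by auto
  then show ?thesis
  proof cases
    case 1
    have "g w \<le> Z w" if "w \<in> \<Omega>" for w
      using le[OF that] Z[OF that] 1 ab by (simp add: power_mono_iff g that)
    then have "(\<Sum>w\<in>\<Omega>. \<mu> w * g w) \<le> (\<Sum>w\<in>\<Omega>. \<mu> w * Z w)"
      by (intro sum_mono mult_left_mono mu)
    then show ?thesis using 1 by (auto intro!: power_mono sum_nonneg mult_nonneg_nonneg mu g)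
  next
    case 2
    have "g w \<le> Y w" if "w \<in> \<Omega>" for w
      using le[OF that] Y[OF that] 2 ab by (simp add: power_mono_iff g that)
    then have "(\<Sum>w\<in>\<Omega>. \<mu> w * g w) \<le> (\<Sum>w\<in>\<Omega>. \<mu> w * Y w)"
      by (intro sum_mono mult_left_mono mu)
    then show ?thesis using 2 by (auto intro!: power_mono sum_nonneg mult_nonneg_nonneg mu g)
  next
    case 3
    define y z where "y = (\<Sum>w\<in>\<Omega>. \<mu> w * Y w)" and "z = (\<Sum>w\<in>\<Omega>. \<mu> w * Z w)"
    have y0: "y \<ge> 0" and z0: "z \<ge> 0" unfolding y_def z_def by (auto intro!: sum_nonneg mult_nonneg_nonneg mu Y Z)
    have zero: "g w = 0" if "w \<in> \<Omega>" "Y w = 0 \<or> Z w = 0" for w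
      using le[OF that(1)] that(2) 3 g[OF that(1)] by (auto simp: zero_power power_le_zero_eq)
    show ?thesis
    proof (cases "y = 0 \<or> z = 0")
      case True
      have "\<mu> w * g w = 0" if "w \<in> \<Omega>" for w
      proof -
        have "\<mu> w * Y w = 0 \<or> \<mu> w * Z w = 0"
          using True that sum_nonneg_eq_0_iff[OF fin, of "\<lambda>w. \<mu> w * Y w"]
            sum_nonneg_eq_0_iff[OF fin, of "\<lambda>w. \<mu> w * Z w"] mu Y Z unfolding y_def z_def by auto
        then show ?thesis using zero[OF that] by auto
      qed
      then have "(\<Sum>w\<in>\<Omega>. \<mu> w * g w) = 0" by (rule sum.neutral[OF ballI])
      then show ?thesis using y0 z0 ab unfolding y_def[symmetric] z_def[symmetric] by (simp add: zero_power)
    next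
      case False
      then have yp: "y > 0" and zp: "z > 0" using y0 z0 by auto
      define \<alpha> \<beta> where "\<alpha> = real a / real (a + b)" and "\<beta> = real b / real (a + b)"
      have al: "\<alpha> \<ge> 0" "\<beta> \<ge> 0" "\<alpha> + \<beta> = 1" unfolding \<alpha>_def \<beta>_def using 3
        by (auto simp: add_divide_distrib[symmetric])
      \<comment> \<open>Normalisation: \<open>Y w / y\<close> and \<open>Z w / z\<close> have
        weighted sum 1, so summing Young's inequality pointwise yields
        \<open>G * (\<alpha> + \<beta>) = G\<close>.\<close>
      define G where "G = y powr \<alpha> * z powr \<beta>"
      have G0: "G > 0" unfolding G_def using yp zp by simp
      have Gp: "G ^ (a + b) = y ^ a * z ^ b"
      proof -
        have "G ^ (a+b) = (y powr \<alpha>) ^ (a + b) * (z powr \<beta>) ^ (a+b)"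
          unfolding G_def by (rule power_mult_distrib)
        also have "\<dots> = y powr (real (a+b) * \<alpha>) * z powr (real (a+b) * \<beta>)"
          by (subst (1 2) powr_power) (use yp zp in auto)
        also have "\<dots> = y ^ a * z ^ b" unfolding \<alpha>_def \<beta>_def using 3 yp zp
          by (simp add: powr_realpow)
        finally show ?thesis .
      qed
      have pw: "g w \<le> G * (\<alpha> * (Y w / y) + \<beta> * (Z w / z))" if w: "w \<in> \<Omega>" for w
      proof (cases "Y w = 0 \<or> Z w = 0")
        case True
        then show ?thesis using zero[OF w] G0 al Y[OF w] Z[OF w] yp zp by simp
      next
        case False
        then have Yp: "Y w > 0" and Zp: "Z w > 0" using Y[OF w] Z[OF w] by auto
        have young: "(Y w / y) powr \<alpha> * (Z w / z) powr \<beta> \<le> \<alpha> * (Y w / y) + \<beta> * (Z w / z)"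
          by (rule Youngs_inequality_0) (use al Yp Zp yp zp in auto)
        have e: "(Y w / y) powr \<alpha> * (Z w / z) powr \<beta> * G = Y w powr \<alpha> * Z w powr \<beta>"
          unfolding G_def using Yp Zp yp zp by (simp add: powr_divide field_simps)
        have "(Y w powr \<alpha> * Z w powr \<beta>) ^ (a + b) = (Y w powr \<alpha>) ^ (a + b) * (Z w powr \<beta>) ^ (a+b)"
          by (simp add: power_mult_distrib)
        also have "\<dots> = Y w powr (real (a+b) * \<alpha>) * Z w powr (real (a+b) * \<beta>)"
          by (subst (1 2) powr_power) (use Yp Zp in auto)
        also have "\<dots> = Y w ^ a * Z w ^ b" unfolding \<alpha>_def \<beta>_def using 3 Yp Zp
          by (simp add: powr_realpow)
        finally have "g w ^ (a+b) \<le> (Y w powr \<alpha> * Z w powr \<beta>) ^ (a + b)" using le[OF w] by simp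
        then have "g w \<le> Y w powr \<alpha> * Z w powr \<beta>"
          using g[OF w] 3 by (subst (asm) power_mono_iff) auto
        also have "\<dots> \<le> G * (\<alpha> * (Y w / y) + \<beta> * (Z w / z))"
          using mult_right_mono[OF young, of G] G0 e by (simp only: mult.commute less_imp_le)
        finally show ?thesis .
      qed
      have "(\<Sum>w\<in>\<Omega>. \<mu> w * g w) \<le> (\<Sum>w\<in>\<Omega>. \<mu> w * (G * (\<alpha> * (Y w / y) + \<beta> * (Z w / z))))"
        by (intro sum_mono mult_left_mono mu pw)
      also have "\<dots> = (\<Sum>w\<in>\<Omega>. (G * \<alpha> / y) * (\<mu> w * Y w) + (G * \<beta> / z) * (\<mu> w * Z w))"
        by (intro sum.cong refl) (simp add: algebra_simps)
      also have "\<dots> = (G * \<alpha> / y) * y + (G * \<beta> / z) * z"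
        by (simp only: sum.distrib sum_distrib_left[symmetric] y_def[symmetric] z_def[symmetric])
      also have "\<dots> = G * (\<alpha> + \<beta>)" using yp zp by (simp add: algebra_simps)
      also have "\<dots> = G" using yp zp al by simp
      finally have "(\<Sum>w\<in>\<Omega>. \<mu> w * g w) ^ (a + b) \<le> G ^ (a + b)"
        by (rule power_mono) (auto intro!: sum_nonneg mult_nonneg_nonneg mu g)
      then show ?thesis using Gp unfolding y_def z_def by simp
    qed
  qed
qed

lemma sum_power_le_power_sum:
  fixes g :: "'a \<Rightarrow> real"
  assumes "finite S" "\<And>i. i \<in> S \<Longrightarrow> 0 \<le> g i" "r \<ge> 1"
  shows "(\<Sum>i\<in>S. g i ^ r) \<le> (\<Sum>i\<in>S. g i) ^ r"
proof -
  obtain q where q: "r = Suc q" using assms(3) by (cases r) auto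
  have "(\<Sum>i\<in>S. g i ^ r) \<le> (\<Sum>i\<in>S. g i * (\<Sum>i\<in>S. g i) ^ q)"
    unfolding q power_Suc using assms(1,2)
    by (intro sum_mono mult_left_mono power_mono member_le_sum) auto
  also have "\<dots> = (\<Sum>i\<in>S. g i) ^ r" by (simp add: q sum_distrib_right)
  finally show ?thesis .
qed

lemma root_sum_le:
  fixes g :: "'a \<Rightarrow> real"
  assumes "finite S" "\<And>i. i \<in> S \<Longrightarrow> 0 \<le> g i" "r \<ge> 1"
  shows "root r (\<Sum>i\<in>S. g i) \<le> (\<Sum>i\<in>S. root r (g i))"
proof -
  have "(\<Sum>i\<in>S. g i) = (\<Sum>i\<in>S. root r (g i) ^ r)"
    by (rule sum.cong) (use assms in auto)
  also have "\<dots> \<le> (\<Sum>i\<in>S. root r (g i)) ^ r"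
    by (rule sum_power_le_power_sum) (use assms in auto)
  finally have "root r (\<Sum>i\<in>S. g i) \<le> root r ((\<Sum>i\<in>S. root r (g i)) ^ r)"
    using assms by (intro real_root_le_mono) auto
  also have "\<dots> = (\<Sum>i\<in>S. root r (g i))"
    using assms by (intro real_root_power_cancel sum_nonneg) auto
  finally show ?thesis .
qed

text \<open>Comparison with the largest summand. Against the power mean inequality this loses one
  factor \<open>m\<close>, which ends up in constants or in a small power of 1 / \<delta>.\<close>

lemma norm_sum_power_le:
  fixes F :: "'a \<Rightarrow> complex"
  assumes "finite S" "real (card S) \<le> m" "q \<ge> 1"
  shows "norm (\<Sum>n\<in>S. F n) ^ q \<le> m ^ q * (\<Sum>n\<in>S. norm (F n) ^ q)"
proof (cases "S = {}")
  case False
  define M where "M = Max ((\<lambda>n. norm (F n)) ` S)"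
  have "M \<in> (\<lambda>n. norm (F n)) ` S"
    unfolding M_def by (rule Max_in) (use assms False in auto)
  then obtain n0 where n0: "n0 \<in> S" "norm (F n0) = M" by auto
  have "norm (\<Sum>n\<in>S. F n) \<le> (\<Sum>n\<in>S. norm (F n))" by (rule norm_sum)
  also have "\<dots> \<le> (\<Sum>n\<in>S. M)" unfolding M_def using assms by (intro sum_mono) auto
  also have "\<dots> = real (card S) * M" by simp
  also have "\<dots> \<le> m * M" using assms n0 by (intro mult_right_mono) auto
  finally have "norm (\<Sum>n\<in>S. F n) ^ q \<le> (m * M) ^ q" by (intro power_mono) auto
  also have "\<dots> = m ^ q * norm (F n0) ^ q" using n0 by (simp add: power_mult_distrib)
  also have "\<dots> \<le> m ^ q * (\<Sum>n\<in>S. norm (F n) ^ q)"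
    using assms n0 by (intro mult_left_mono member_le_sum) auto
  finally show ?thesis .
qed (use assms in \<open>cases q; auto\<close>)

lemma card_floor_le:
  fixes S :: "real set"
  assumes "finite S" "\<And>x y. x \<in> S \<Longrightarrow> y \<in> S \<Longrightarrow> \<bar>x - y\<bar> \<le> t" "t \<ge> 0"
  shows "real (card (floor ` S)) \<le> t + 2"
proof (cases "S = {}")
  case False
  define m where "m = Min S"
  have mS: "m \<in> S" "\<And>x. x \<in> S \<Longrightarrow> m \<le> x" unfolding m_def using assms False by auto
  have "floor ` S \<subseteq> {\<lfloor>m\<rfloor>..\<lfloor>m + t\<rfloor>}"
  proof
    fix n assume "n \<in> floor ` S"
    then obtain x where x: "x \<in> S" "n = \<lfloor>x\<rfloor>" by auto
    have "x \<le> m + t" using assms(2)[OF x(1) mS(1)] by linarith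
    then show "n \<in> {\<lfloor>m\<rfloor>..\<lfloor>m + t\<rfloor>}" using mS(2)[OF x(1)] x by (auto intro: floor_mono)
  qed
  then have "card (floor ` S) \<le> card {\<lfloor>m\<rfloor>..\<lfloor>m + t\<rfloor>}" by (intro card_mono) auto
  also have "\<dots> = nat (\<lfloor>m + t\<rfloor> - \<lfloor>m\<rfloor> + 1)" by simp
  finally show ?thesis using assms(3) by linarith
qed (use assms in auto)

section \<open>Triangular numbers: half of the critical exponent\<close>

definition tri :: "nat \<Rightarrow> nat" where "tri k = k * (k + 1) div 2"

lemma two_tri: "2 * tri k = k * (k + 1)"
  unfolding tri_def by (rule dvd_mult_div_cancel) simp

lemma tri_0 [simp]: "tri 0 = 0" by (simp add: tri_def)

lemma tri_Suc: "tri (Suc k) = tri k + Suc k"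
  using two_tri[of k] two_tri[of "Suc k"] by simp

lemma tri_mono: "l \<le> k \<Longrightarrow> tri l \<le> tri k"
  by (induction rule: dec_induct) (auto simp: tri_Suc)

lemma tri_pos: "k \<ge> 1 \<Longrightarrow> tri k \<ge> 1"
  using tri_mono[of 1 k] by (simp add: tri_def)

lemma tri_less: "l < k \<Longrightarrow> tri l < tri k"
  using tri_mono[of "Suc l" k] by (simp add: tri_Suc)

section \<open>Moments and correlations of weighted families\<close>

abbreviation tup :: "'i set \<Rightarrow> nat \<Rightarrow> 'i list set" where
  "tup A n \<equiv> {xs. set xs \<subseteq> A \<and> length xs = n}"

lemma sum_power_eq_sum_tup:
  fixes g :: "'i \<Rightarrow> complex"
  assumes "finite A"
  shows "(\<Sum>i\<in>A. g i) ^ n = (\<Sum>xs\<in>tup A n. prod_list (map g xs))"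
proof (induction n)
  case (Suc n)
  have "inj_on (\<lambda>(xs, i). i # xs) (tup A n \<times> A)" by (auto simp: inj_on_def)
  then have "(\<Sum>xs\<in>tup A (Suc n). prod_list (map g xs))
      = (\<Sum>(xs, i)\<in>tup A n \<times> A. g i * prod_list (map g xs))"
    unfolding lists_length_Suc_eq by (subst sum.reindex) (auto simp: case_prod_unfold)
  also have "\<dots> = (\<Sum>i\<in>A. g i) ^ Suc n"
    unfolding power_Suc Suc.IH
    by (simp add: sum.cartesian_product[symmetric] sum_product) (rule sum.swap)
  finally show ?case by simp
next
  case 0
  have "tup A 0 = {[]}" by auto
  then show ?case by simp
qed

text \<open>The weight is left out of the locale because the proof keeps changing it while the
  functions stay the same.\<close>

locale family =
  fixes \<Omega> :: "'w set" and f :: "'i \<Rightarrow> 'w \<Rightarrow> complex"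
  assumes finite_space: "finite \<Omega>"
begin

definition F :: "'i set \<Rightarrow> 'w \<Rightarrow> complex" where
  "F B w = (\<Sum>i\<in>B. f i w)"

definition av :: "('w \<Rightarrow> real) \<Rightarrow> ('w \<Rightarrow> real) \<Rightarrow> real" where
  "av \<mu> g = (\<Sum>w\<in>\<Omega>. \<mu> w * g w)"

definition wt :: "('w \<Rightarrow> real) \<Rightarrow> bool" where
  "wt \<mu> \<longleftrightarrow> (\<forall>w\<in>\<Omega>. 0 \<le> \<mu> w)"

definition moment :: "('w \<Rightarrow> real) \<Rightarrow> nat \<Rightarrow> 'i set \<Rightarrow> real" where
  "moment \<mu> r B = av \<mu> (\<lambda>w. norm (F B w) ^ (2 * r))"

text \<open>The square of the L^(2r) norm, so that \<open>gsum\<close> is the sum on the right of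
  \<ell>^2-decoupling.\<close>

definition nm :: "('w \<Rightarrow> real) \<Rightarrow> nat \<Rightarrow> 'i set \<Rightarrow> real" where
  "nm \<mu> r B = root r (moment \<mu> r B)"

definition gsum :: "('w \<Rightarrow> real) \<Rightarrow> nat \<Rightarrow> ('i \<Rightarrow> int) \<Rightarrow> 'i set \<Rightarrow> real" where
  "gsum \<mu> r \<kappa> B = (\<Sum>n\<in>\<kappa> ` B. nm \<mu> r {i\<in>B. \<kappa> i = n})"

definition corr :: "('w \<Rightarrow> real) \<Rightarrow> 'i list \<Rightarrow> 'i list \<Rightarrow> complex" where
  "corr \<mu> xs ys = (\<Sum>w\<in>\<Omega>. of_real (\<mu> w) * (\<Prod>i\<leftarrow>xs. f i w) * cnj (\<Prod>i\<leftarrow>ys. f i w))"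

definition positive :: "('w \<Rightarrow> real) \<Rightarrow> nat \<Rightarrow> 'i set \<Rightarrow> bool" where
  "positive \<mu> r A \<longleftrightarrow>
     (\<forall>xs\<in>tup A r. \<forall>ys\<in>tup A r. Im (corr \<mu> xs ys) = 0 \<and> 0 \<le> Re (corr \<mu> xs ys))"

text \<open>A mixed moment of two sets becomes the ordinary moment of one set for a new weight, so
  that results about single sets apply to bilinear expressions.\<close>

definition reweight :: "('w \<Rightarrow> real) \<Rightarrow> nat \<Rightarrow> 'i set \<Rightarrow> 'w \<Rightarrow> real" where
  "reweight \<mu> q C w = \<mu> w * norm (F C w) ^ (2 * q)"

lemma av_nonneg: "wt \<mu> \<Longrightarrow> (\<And>w. w \<in> \<Omega> \<Longrightarrow> 0 \<le> g w) \<Longrightarrow> 0 \<le> av \<mu> g"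
  unfolding av_def wt_def by (auto intro!: sum_nonneg mult_nonneg_nonneg)

lemma av_mono: "wt \<mu> \<Longrightarrow> (\<And>w. w \<in> \<Omega> \<Longrightarrow> g w \<le> h w) \<Longrightarrow> av \<mu> g \<le> av \<mu> h"
  unfolding av_def wt_def by (auto intro!: sum_mono mult_left_mono)

lemma av_add: "av \<mu> (\<lambda>w. g w + h w) = av \<mu> g + av \<mu> h"
  by (simp add: av_def algebra_simps sum.distrib)

lemma av_cmult: "av \<mu> (\<lambda>w. c * g w) = c * av \<mu> g"
  by (simp add: av_def algebra_simps sum_distrib_left)

lemma av_sum: "finite S \<Longrightarrow> av \<mu> (\<lambda>w. \<Sum>n\<in>S. g n w) = (\<Sum>n\<in>S. av \<mu> (g n))"
  by (simp add: av_def sum_distrib_left) (rule sum.swap)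

lemma moment_nonneg: "wt \<mu> \<Longrightarrow> 0 \<le> moment \<mu> r B"
  unfolding moment_def by (intro av_nonneg) auto

lemma nm_nonneg: "wt \<mu> \<Longrightarrow> 0 \<le> nm \<mu> r B"
  unfolding nm_def by (cases "r = 0") (auto intro: moment_nonneg)

lemma nm_power: "wt \<mu> \<Longrightarrow> r \<ge> 1 \<Longrightarrow> nm \<mu> r B ^ r = moment \<mu> r B"
  unfolding nm_def by (intro real_root_pow_pos2) (auto intro: moment_nonneg)

lemma gsum_nonneg: "wt \<mu> \<Longrightarrow> 0 \<le> gsum \<mu> r \<kappa> B"
  unfolding gsum_def by (intro sum_nonneg nm_nonneg)

lemma wt_reweight: "wt \<mu> \<Longrightarrow> wt (reweight \<mu> q C)"
  unfolding wt_def reweight_def by auto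

lemma moment_reweight:
  "moment (reweight \<mu> q C) r B = av \<mu> (\<lambda>w. norm (F B w) ^ (2 * r) * norm (F C w) ^ (2 * q))"
  unfolding moment_def av_def reweight_def by (simp add: algebra_simps)

lemma finite_tup [simp]: "finite A \<Longrightarrow> finite (tup A n)"
  by (rule finite_lists_length_eq)

lemma F_power: "finite B \<Longrightarrow> F B w ^ r = (\<Sum>xs\<in>tup B r. \<Prod>i\<leftarrow>xs. f i w)"
  unfolding F_def by (rule sum_power_eq_sum_tup)

lemma norm_F_power:
  assumes "finite B"
  shows "complex_of_real (norm (F B w) ^ (2 * r)) =
    (\<Sum>xs\<in>tup B r. \<Sum>ys\<in>tup B r. (\<Prod>i\<leftarrow>xs. f i w) * cnj (\<Prod>i\<leftarrow>ys. f i w))"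
proof -
  have "complex_of_real (norm (F B w) ^ (2 * r)) = (F B w * cnj (F B w)) ^ r"
    by (simp add: power_mult complex_norm_square[symmetric])
  also have "\<dots> = F B w ^ r * cnj (F B w ^ r)" by (simp add: power_mult_distrib)
  also have "\<dots> = (\<Sum>xs\<in>tup B r. \<Sum>ys\<in>tup B r. (\<Prod>i\<leftarrow>xs. f i w) * cnj (\<Prod>i\<leftarrow>ys. f i w))"
    unfolding F_power[OF assms] by (simp add: sum_product)
  finally show ?thesis .
qed

lemma moment_eq_corr:
  assumes "finite B"
  shows "complex_of_real (moment \<mu> r B) = (\<Sum>xs\<in>tup B r. \<Sum>ys\<in>tup B r. corr \<mu> xs ys)"
proof -
  have "complex_of_real (moment \<mu> r B) =
    (\<Sum>w\<in>\<Omega>. \<Sum>xs\<in>tup B r. \<Sum>ys\<in>tup B r. of_real (\<mu> w) * (\<Prod>i\<leftarrow>xs. f i w) * cnj (\<Prod>i\<leftarrow>ys. f i w))"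
    unfolding moment_def av_def using norm_F_power[OF assms]
    by (simp add: sum_distrib_left mult.assoc)
  also have "\<dots> = (\<Sum>xs\<in>tup B r. \<Sum>w\<in>\<Omega>. \<Sum>ys\<in>tup B r. of_real (\<mu> w) * (\<Prod>i\<leftarrow>xs. f i w) * cnj (\<Prod>i\<leftarrow>ys. f i w))"
    by (rule sum.swap)
  also have "\<dots> = (\<Sum>xs\<in>tup B r. \<Sum>ys\<in>tup B r. corr \<mu> xs ys)"
    unfolding corr_def by (intro sum.cong refl sum.swap)
  finally show ?thesis .
qed

text \<open>Expanded into correlations, the moment of \<open>B\<close> is a subsum of the
  nonnegative sum for \<open>C\<close>. This takes the place of the boundedness of frequency
  projections.\<close>

lemma moment_mono:
  assumes "positive \<mu> r A" "B \<subseteq> C" "C \<subseteq> A" "finite A"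
  shows "moment \<mu> r B \<le> moment \<mu> r C"
proof -
  have fin: "finite B" "finite C"
    using finite_subset[OF assms(3,4)] finite_subset[OF assms(2)] by auto
  have e: "moment \<mu> r D = (\<Sum>xs\<in>tup D r. \<Sum>ys\<in>tup D r. Re (corr \<mu> xs ys))" if "finite D" for D
    using arg_cong[OF moment_eq_corr[OF that, of \<mu> r], of Re] by (simp only: Re_complex_of_real Re_sum)
  have sub: "tup B r \<subseteq> tup C r" using assms(2) by auto
  have "tup C r \<subseteq> tup A r" using assms(3) by auto
  then have nn: "0 \<le> Re (corr \<mu> xs ys)" if "xs \<in> tup C r" "ys \<in> tup C r" for xs ys
    using assms(1) that unfolding positive_def by blast
  have inner: "(\<Sum>ys\<in>tup B r. Re (corr \<mu> xs ys)) \<le> (\<Sum>ys\<in>tup C r. Re (corr \<mu> xs ys))"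
    if "xs \<in> tup C r" for xs
    by (rule sum_mono2[OF finite_tup[OF fin(2)] sub]) (rule nn[OF that], blast)
  have "(\<Sum>xs\<in>tup B r. \<Sum>ys\<in>tup B r. Re (corr \<mu> xs ys)) \<le> (\<Sum>xs\<in>tup B r. \<Sum>ys\<in>tup C r. Re (corr \<mu> xs ys))"
    by (rule sum_mono, rule inner) (use sub in blast)
  also have "\<dots> \<le> (\<Sum>xs\<in>tup C r. \<Sum>ys\<in>tup C r. Re (corr \<mu> xs ys))"
    by (rule sum_mono2[OF finite_tup[OF fin(2)] sub], rule sum_nonneg, rule nn, blast, assumption)
  finally show ?thesis by (simp only: e[OF fin(1)] e[OF fin(2)])
qed

lemma nm_mono:
  assumes "positive \<mu> r A" "B \<subseteq> C" "C \<subseteq> A" "finite A" "r \<ge> 1"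
  shows "nm \<mu> r B \<le> nm \<mu> r C"
  unfolding nm_def using moment_mono[OF assms(1-4)] assms(5) by simp

lemma corr_reweight:
  assumes "finite C"
  shows "corr (reweight \<mu> q C) xs ys = (\<Sum>zs\<in>tup C q. \<Sum>ws\<in>tup C q. corr \<mu> (xs @ zs) (ys @ ws))"
proof -
  have "corr (reweight \<mu> q C) xs ys =
    (\<Sum>w\<in>\<Omega>. of_real (\<mu> w) * complex_of_real (norm (F C w) ^ (2 * q)) * (\<Prod>i\<leftarrow>xs. f i w) * cnj (\<Prod>i\<leftarrow>ys. f i w))"
    unfolding corr_def reweight_def of_real_mult ..
  also have "\<dots> = (\<Sum>w\<in>\<Omega>. \<Sum>zs\<in>tup C q. \<Sum>ws\<in>tup C q.
      of_real (\<mu> w) * (\<Prod>i\<leftarrow>xs@zs. f i w) * cnj (\<Prod>i\<leftarrow>ys@ws. f i w))"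
  proof (rule sum.cong[OF refl])
    fix w
    have "of_real (\<mu> w) * complex_of_real (norm (F C w) ^ (2 * q)) * (\<Prod>i\<leftarrow>xs. f i w) * cnj (\<Prod>i\<leftarrow>ys. f i w)
      = (of_real (\<mu> w) * (\<Prod>i\<leftarrow>xs. f i w) * cnj (\<Prod>i\<leftarrow>ys. f i w)) * complex_of_real (norm (F C w) ^ (2 * q))"
      by (simp only: mult_ac)
    also have "\<dots> = (\<Sum>zs\<in>tup C q. \<Sum>ws\<in>tup C q.
       (of_real (\<mu> w) * (\<Prod>i\<leftarrow>xs. f i w) * cnj (\<Prod>i\<leftarrow>ys. f i w)) * ((\<Prod>i\<leftarrow>zs. f i w) * cnj (\<Prod>i\<leftarrow>ws. f i w)))"
      by (simp only: norm_F_power[OF assms] sum_distrib_left)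
    also have "\<dots> = (\<Sum>zs\<in>tup C q. \<Sum>ws\<in>tup C q.
      of_real (\<mu> w) * (\<Prod>i\<leftarrow>xs@zs. f i w) * cnj (\<Prod>i\<leftarrow>ys@ws. f i w))"
      by (simp only: map_append prod_list.append complex_cnj_mult mult_ac)
    finally show "of_real (\<mu> w) * complex_of_real (norm (F C w) ^ (2 * q)) * (\<Prod>i\<leftarrow>xs. f i w) * cnj (\<Prod>i\<leftarrow>ys. f i w)
      = (\<Sum>zs\<in>tup C q. \<Sum>ws\<in>tup C q. of_real (\<mu> w) * (\<Prod>i\<leftarrow>xs@zs. f i w) * cnj (\<Prod>i\<leftarrow>ys@ws. f i w))" .
  qed
  also have "\<dots> = (\<Sum>zs\<in>tup C q. \<Sum>w\<in>\<Omega>. \<Sum>ws\<in>tup C q.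
      of_real (\<mu> w) * (\<Prod>i\<leftarrow>xs@zs. f i w) * cnj (\<Prod>i\<leftarrow>ys@ws. f i w))"
    by (rule sum.swap)
  also have "\<dots> = (\<Sum>zs\<in>tup C q. \<Sum>ws\<in>tup C q. corr \<mu> (xs @ zs) (ys @ ws))"
    unfolding corr_def by (intro sum.cong refl sum.swap)
  finally show ?thesis .
qed

text \<open>Expanding the power of \<open>norm (F C w)\<close> appends a \<open>q\<close>-tuple over
  \<open>C\<close> to each side, so a correlation for the new weight is a sum of correlations of
  longer tuples for the old one. This is why positivity of order \<open>r + q\<close> is consumed to
  get order \<open>r\<close>.\<close>

lemma positive_reweight:
  assumes "positive \<mu> (r + q) A" "C \<subseteq> A" "finite A"
  shows "positive (reweight \<mu> q C) r A"
  unfolding positive_def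
proof (intro ballI)
  fix xs ys assume xy: "xs \<in> tup A r" "ys \<in> tup A r"
  have fin: "finite C" by (rule finite_subset[OF assms(2,3)])
  have *: "Im (corr \<mu> (xs @ zs) (ys @ ws)) = 0 \<and> 0 \<le> Re (corr \<mu> (xs @ zs) (ys @ ws))"
    if "zs \<in> tup C q" "ws \<in> tup C q" for zs ws
    using assms(1,2) xy that unfolding positive_def by auto
  show "Im (corr (reweight \<mu> q C) xs ys) = 0 \<and> 0 \<le> Re (corr (reweight \<mu> q C) xs ys)"
    unfolding corr_reweight[OF fin] by (auto simp: * intro!: sum_nonneg)
qed

lemma F_partition:
  assumes "finite B"
  shows "F B w = (\<Sum>n\<in>\<kappa> ` B. F {i\<in>B. \<kappa> i = n} w)"
  unfolding F_def using sum.image_gen[OF assms, of "\<lambda>i. f i w" \<kappa>] .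

lemma moment_split:
  assumes "finite B" "wt \<mu>" "real (card (\<kappa> ` B)) \<le> m" "r \<ge> 1"
  shows "moment \<mu> r B \<le> m ^ (2 * r) * (\<Sum>n\<in>\<kappa> ` B. moment \<mu> r {i\<in>B. \<kappa> i = n})"
proof -
  have "moment \<mu> r B \<le> av \<mu> (\<lambda>w. m ^ (2*r) * (\<Sum>n\<in>\<kappa> ` B. norm (F {i\<in>B. \<kappa> i = n} w) ^ (2 * r)))"
    unfolding moment_def
  proof (rule av_mono[OF assms(2)])
    fix w
    show "norm (F B w) ^ (2 * r) \<le> m ^ (2*r) * (\<Sum>n\<in>\<kappa> ` B. norm (F {i\<in>B. \<kappa> i = n} w) ^ (2 * r))"
      unfolding F_partition[OF assms(1), of w \<kappa>] by (rule norm_sum_power_le) (use assms in auto)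
  qed
  also have "\<dots> = m ^ (2 * r) * (\<Sum>n\<in>\<kappa> ` B. moment \<mu> r {i\<in>B. \<kappa> i = n})"
    using assms(1) by (simp add: av_cmult av_sum moment_def)
  finally show ?thesis .
qed

lemma nm_split:
  assumes "finite B" "wt \<mu>" "real (card (\<kappa> ` B)) \<le> m" "r \<ge> 1"
  shows "nm \<mu> r B \<le> m\<^sup>2 * gsum \<mu> r \<kappa> B"
proof -
  have m0: "m \<ge> 0" using assms(3) by linarith
  have "nm \<mu> r B \<le> root r (m ^ (2 * r) * (\<Sum>n\<in>\<kappa> ` B. moment \<mu> r {i\<in>B. \<kappa> i = n}))"
    unfolding nm_def using moment_split[OF assms] assms(4) by simp
  also have "\<dots> = m\<^sup>2 * root r (\<Sum>n\<in>\<kappa> ` B. moment \<mu> r {i\<in>B. \<kappa> i = n})"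
    using assms(4) m0 by (simp add: real_root_mult power_mult real_root_power_cancel)
  also have "\<dots> \<le> m\<^sup>2 * gsum \<mu> r \<kappa> B"
    unfolding gsum_def nm_def using assms
    by (intro mult_left_mono root_sum_le) (auto intro: moment_nonneg)
  finally show ?thesis .
qed

lemma gsum_mono:
  assumes "positive \<mu> r A" "B \<subseteq> C" "C \<subseteq> A" "finite A" "r \<ge> 1" "wt \<mu>"
  shows "gsum \<mu> r \<kappa> B \<le> gsum \<mu> r \<kappa> C"
proof -
  have fin: "finite B" "finite C"
    using finite_subset[OF assms(3,4)] finite_subset[OF assms(2)] by auto
  have "gsum \<mu> r \<kappa> B \<le> (\<Sum>n\<in>\<kappa> ` B. nm \<mu> r {i\<in>C. \<kappa> i = n})"
    unfolding gsum_def by (intro sum_mono nm_mono[OF assms(1)]) (use assms in auto)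
  also have "\<dots> \<le> gsum \<mu> r \<kappa> C"
    unfolding gsum_def by (intro sum_mono2 nm_nonneg) (use assms fin in auto)
  finally show ?thesis .
qed

text \<open>The cells of \<open>\<kappa>\<close> may cut a cell of \<open>\<kappa>'\<close> into
  several pieces. By monotonicity each piece is bounded by the whole cell, and \<open>m\<close>
  bounds the number of pieces.\<close>

lemma gsum_superadditive:
  assumes "positive \<mu> r A" "B \<subseteq> A" "finite A" "r \<ge> 1" "wt \<mu>"
    and m: "\<And>n. n \<in> \<kappa>' ` B \<Longrightarrow> real (card (\<kappa> ` {i\<in>B. \<kappa>' i = n})) \<le> m"
  shows "(\<Sum>c\<in>\<kappa> ` B. gsum \<mu> r \<kappa>' {i\<in>B. \<kappa> i = c}) \<le> m * gsum \<mu> r \<kappa>' B"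
proof -
  have fin: "finite B" by (rule finite_subset[OF assms(2,3)])
  have "(\<Sum>c\<in>\<kappa> ` B. gsum \<mu> r \<kappa>' {i\<in>B. \<kappa> i = c})
      \<le> (\<Sum>c\<in>\<kappa> ` B. \<Sum>n\<in>\<kappa>' ` {i\<in>B. \<kappa> i = c}. nm \<mu> r {i\<in>B. \<kappa>' i = n})"
    unfolding gsum_def
    by (intro sum_mono nm_mono[OF assms(1) _ _ assms(3,4)]) (use assms(2) in auto)
  also have "\<dots> = (\<Sum>c\<in>\<kappa> ` B. \<Sum>n\<in>{n\<in>\<kappa>' ` B. c \<in> \<kappa> ` {i\<in>B. \<kappa>' i = n}}. nm \<mu> r {i\<in>B. \<kappa>' i = n})"
  proof (intro sum.cong refl)
    fix c
    show "\<kappa>' ` {i\<in>B. \<kappa> i = c} = {n\<in>\<kappa>' ` B. c \<in> \<kappa> ` {i\<in>B. \<kappa>' i = n}}"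
      by (auto simp: image_iff) metis
  qed
  also have "\<dots> = (\<Sum>n\<in>\<kappa>' ` B. \<Sum>c\<in>{c\<in>\<kappa> ` B. c \<in> \<kappa> ` {i\<in>B. \<kappa>' i = n}}. nm \<mu> r {i\<in>B. \<kappa>' i = n})"
    by (rule sum.swap_restrict) (use fin in auto)
  also have "\<dots> \<le> (\<Sum>n\<in>\<kappa>' ` B. m * nm \<mu> r {i\<in>B. \<kappa>' i = n})"
  proof (rule sum_mono)
    fix n assume n: "n \<in> \<kappa>' ` B"
    have "{c\<in>\<kappa> ` B. c \<in> \<kappa> ` {i\<in>B. \<kappa>' i = n}} = \<kappa> ` {i\<in>B. \<kappa>' i = n}" by auto
    then show "(\<Sum>c\<in>{c\<in>\<kappa> ` B. c \<in> \<kappa> ` {i\<in>B. \<kappa>' i = n}}. nm \<mu> r {i\<in>B. \<kappa>' i = n})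
        \<le> m * nm \<mu> r {i\<in>B. \<kappa>' i = n}"
      using m[OF n] nm_nonneg[OF assms(5)] by (simp add: mult_right_mono)
  qed
  also have "\<dots> = m * gsum \<mu> r \<kappa>' B" by (simp add: gsum_def sum_distrib_left)
  finally show ?thesis .
qed

text \<open>Change of grid: the triangle inequality cuts a cell of \<open>\<kappa>\<close> into at
  most \<open>m'\<close> pieces, at the cost of the square of \<open>m'\<close> because
  \<open>nm\<close> is a squared norm; superadditivity then reassembles the cells of
  \<open>\<kappa>'\<close> at the cost \<open>m\<close>.\<close>

lemma gsum_regroup:
  assumes "positive \<mu> r A" "B \<subseteq> A" "finite A" "r \<ge> 1" "wt \<mu>"
    and m: "\<And>n. n \<in> \<kappa>' ` B \<Longrightarrow> real (card (\<kappa> ` {i\<in>B. \<kappa>' i = n})) \<le> m"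
    and m': "\<And>c. c \<in> \<kappa> ` B \<Longrightarrow> real (card (\<kappa>' ` {i\<in>B. \<kappa> i = c})) \<le> m'"
  shows "gsum \<mu> r \<kappa> B \<le> m'\<^sup>2 * m * gsum \<mu> r \<kappa>' B"
proof -
  have fin: "finite B" by (rule finite_subset[OF assms(2,3)])
  have "gsum \<mu> r \<kappa> B \<le> (\<Sum>c\<in>\<kappa> ` B. m'\<^sup>2 * gsum \<mu> r \<kappa>' {i\<in>B. \<kappa> i = c})"
    unfolding gsum_def[of _ _ \<kappa>] by (intro sum_mono nm_split) (use assms fin in auto)
  also have "\<dots> \<le> m'\<^sup>2 * (m * gsum \<mu> r \<kappa>' B)"
    unfolding sum_distrib_left[symmetric]
    by (intro mult_left_mono gsum_superadditive[OF assms(1-6)]) auto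
  finally show ?thesis by (simp add: mult.assoc)
qed

lemma av_holder:
  assumes "wt \<mu>" "a + b > 0"
    and "\<And>w. 0 \<le> g w" "\<And>w. 0 \<le> Y w" "\<And>w. 0 \<le> Z w"
    and "\<And>w. g w ^ (a + b) \<le> Y w ^ a * Z w ^ b"
  shows "av \<mu> g ^ (a + b) \<le> av \<mu> Y ^ a * av \<mu> Z ^ b"
  unfolding av_def by (rule sum_holder) (use assms finite_space in \<open>auto simp: wt_def\<close>)

end

section \<open>Families with approximate orthogonality\<close>

definition psum :: "('i \<Rightarrow> real) \<Rightarrow> nat \<Rightarrow> 'i list \<Rightarrow> real" where
  "psum \<pi> j xs = (\<Sum>i\<leftarrow>xs. \<pi> i ^ j)"

lemma psum_append [simp]: "psum \<pi> j (xs @ ys) = psum \<pi> j xs + psum \<pi> j ys"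
  by (simp add: psum_def)

lemma psum_Nil [simp]: "psum \<pi> j [] = 0"
  by (simp add: psum_def)

lemma psum_Cons [simp]: "psum \<pi> j (i # xs) = \<pi> i ^ j + psum \<pi> j xs"
  by (simp add: psum_def)

lemma psum_0 [simp]: "psum \<pi> 0 xs = real (length xs)"
  by (induction xs) auto

lemma psum_abs_le:
  assumes "\<And>i. i \<in> set xs \<Longrightarrow> \<bar>\<pi> i\<bar> \<le> t"
  shows "\<bar>psum \<pi> j xs\<bar> \<le> real (length xs) * t ^ j"
  using assms
proof (induction xs)
  case (Cons i xs)
  have "\<bar>\<pi> i ^ j\<bar> \<le> t ^ j" unfolding power_abs using Cons.prems by (intro power_mono) auto
  then show ?case using Cons by (auto simp: algebra_simps)
qed auto

lemma psum_scale: "psum (\<lambda>i. c * \<pi> i) j xs = c ^ j * psum \<pi> j xs"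
  by (induction xs) (auto simp: algebra_simps power_mult_distrib)

lemma psum_shift:
  "psum (\<lambda>i. \<pi> i - x) j xs = (\<Sum>m\<le>j. real (j choose m) * (- x) ^ (j - m) * psum \<pi> m xs)"
proof (induction xs)
  case (Cons i xs)
  have "(\<pi> i - x) ^ j = (\<Sum>m\<le>j. real (j choose m) * (- x) ^ (j - m) * \<pi> i ^ m)"
    using binomial_ring[of "\<pi> i" "- x" j] by (simp add: algebra_simps)
  then show ?case using Cons by (simp add: sum.distrib algebra_simps)
qed auto

text \<open>Binomial theorem: the constant bounds the row sum of the binomial coefficients, and the
  power sums of degree 0 agree because the tuples have equal length.\<close>

lemma psum_shift_diff:
  assumes "\<forall>j\<in>{1..k}. \<bar>psum \<pi> j xs - psum \<pi> j ys\<bar> \<le> \<rho>" "length xs = length ys"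
    and "\<bar>x\<bar> \<le> 1" "0 \<le> \<rho>" "j \<le> k"
  shows "\<bar>psum (\<lambda>i. \<pi> i - x) j xs - psum (\<lambda>i. \<pi> i - x) j ys\<bar> \<le> 2 ^ k * \<rho>"
proof -
  have d: "\<bar>psum \<pi> m xs - psum \<pi> m ys\<bar> \<le> \<rho>" if "m \<le> j" for m
    using assms that by (cases "m = 0") auto
  have "\<bar>psum (\<lambda>i. \<pi> i - x) j xs - psum (\<lambda>i. \<pi> i - x) j ys\<bar>
      = \<bar>\<Sum>m\<le>j. real (j choose m) * (- x) ^ (j - m) * (psum \<pi> m xs - psum \<pi> m ys)\<bar>"
    unfolding psum_shift by (simp add: sum_subtractf right_diff_distrib)
  also have "\<dots> \<le> (\<Sum>m\<le>j. \<bar>real (j choose m) * (- x) ^ (j - m) * (psum \<pi> m xs - psum \<pi> m ys)\<bar>)"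
    by (rule sum_abs)
  also have "\<dots> \<le> (\<Sum>m\<le>j. real (j choose m) * 1 * \<rho>)"
    unfolding abs_mult using d assms(3,4)
    by (intro sum_mono mult_mono) (auto simp: power_abs intro: power_le_one)
  also have "\<dots> = 2 ^ j * \<rho>"
    by (simp add: sum_distrib_right[symmetric] of_nat_sum[symmetric] choose_row_sum del: of_nat_sum)
  also have "\<dots> \<le> 2 ^ k * \<rho>" using assms by (intro mult_right_mono power_increasing) auto
  finally show ?thesis .
qed

section \<open>Intervals of positions and grid cells\<close>

definition diam_le :: "('i \<Rightarrow> real) \<Rightarrow> real \<Rightarrow> 'i set \<Rightarrow> bool" where
  "diam_le \<pi> t B \<longleftrightarrow> (\<forall>i\<in>B. \<forall>j\<in>B. \<bar>\<pi> i - \<pi> j\<bar> \<le> t)"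

definition cell :: "real \<Rightarrow> real \<Rightarrow> ('i \<Rightarrow> real) \<Rightarrow> 'i \<Rightarrow> int" where
  "cell x h \<pi> i = \<lfloor>(\<pi> i - x) / h\<rfloor>"

lemma diam_le_mono: "diam_le \<pi> t B \<Longrightarrow> t \<le> t' \<Longrightarrow> diam_le \<pi> t' B"
  by (force simp: diam_le_def)

lemma diam_le_cell:
  assumes "h > 0"
  shows "diam_le \<pi> h {i\<in>B. cell x h \<pi> i = n}"
  unfolding diam_le_def
proof (intro ballI)
  fix i j assume ij: "i \<in> {i\<in>B. cell x h \<pi> i = n}" "j \<in> {i\<in>B. cell x h \<pi> i = n}"
  have "\<bar>(\<pi> i - x) / h - (\<pi> j - x) / h\<bar> \<le> 1"
    using ij unfolding cell_def by simp linarith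
  then have "\<bar>(\<pi> i - \<pi> j) / h\<bar> \<le> 1" by (simp add: diff_divide_distrib)
  then show "\<bar>\<pi> i - \<pi> j\<bar> \<le> h" using assms by (simp add: abs_divide)
qed

lemma card_cell_le:
  assumes "finite B" "diam_le \<pi> t B" "h > 0" "t \<ge> 0"
  shows "real (card (cell x h \<pi> ` B)) \<le> t / h + 2"
proof -
  have e: "cell x h \<pi> ` B = floor ` (\<lambda>i. (\<pi> i - x) / h) ` B" by (auto simp: cell_def image_image)
  show ?thesis unfolding e
  proof (rule card_floor_le)
    fix u v assume "u \<in> (\<lambda>i. (\<pi> i - x) / h) ` B" "v \<in> (\<lambda>i. (\<pi> i - x) / h) ` B"
    then obtain i j where ij: "i \<in> B" "j \<in> B" "u = (\<pi> i - x) / h" "v = (\<pi> j - x) / h" by auto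
    have "\<bar>u - v\<bar> = \<bar>\<pi> i - \<pi> j\<bar> / h" using ij assms(3)
      by (simp add: diff_divide_distrib[symmetric] abs_divide)
    then show "\<bar>u - v\<bar> \<le> t / h" using assms(2,3) ij
      by (simp add: diam_le_def divide_right_mono)
  qed (use assms in auto)
qed

context family
begin

definition approx :: "('w \<Rightarrow> real) \<Rightarrow> nat \<Rightarrow> nat \<Rightarrow> ('i \<Rightarrow> real) \<Rightarrow> real \<Rightarrow> 'i set \<Rightarrow> bool" where
  "approx \<mu> r k \<pi> \<rho> A \<longleftrightarrow> (\<forall>xs\<in>tup A r. \<forall>ys\<in>tup A r. corr \<mu> xs ys \<noteq> 0 \<longrightarrow>
     (\<forall>j\<in>{1..k}. \<bar>psum \<pi> j xs - psum \<pi> j ys\<bar> \<le> \<rho>))"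

text \<open>The error used below is \<open>\<rho> = \<delta> ^ k\<close> in all degrees at once.
  Rescaling an interval of length \<sigma> to unit length divides the error in degree j by
  \<sigma>^j, at worst by \<sigma>^k, and so produces the error (\<delta> / \<sigma>)^k that belongs
  to the rescaled cell length \<delta> / \<sigma>.\<close>

definition vin :: "('w \<Rightarrow> real) \<Rightarrow> nat \<Rightarrow> ('i \<Rightarrow> real) \<Rightarrow> real \<Rightarrow> 'i set \<Rightarrow> bool" where
  "vin \<mu> k \<pi> \<rho> A \<longleftrightarrow> finite A \<and> wt \<mu> \<and> (\<forall>i\<in>A. \<bar>\<pi> i\<bar> \<le> 1) \<and>
     positive \<mu> (tri k) A \<and> approx \<mu> (tri k) k \<pi> \<rho> A"

end

text \<open>
  Discrete \<open>\<ell>\<^sup>2\<close>-decoupling at the critical exponent \<open>2 * tri k = k (k + 1)\<close> for all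
  exponential-sum-like families; \<open>D\<close> is the critical power of the usual decoupling constant.
  The type argument only fixes the types of the families quantified over.
\<close>

definition decoupling :: "('i \<times> 'w) itself \<Rightarrow> nat \<Rightarrow> real \<Rightarrow> real \<Rightarrow> bool" where
  "decoupling T k \<delta> D \<longleftrightarrow>
     (\<forall>(\<Omega> :: 'w set) (f :: 'i \<Rightarrow> 'w \<Rightarrow> complex) A \<mu> \<pi>. finite \<Omega> \<longrightarrow>
        family.vin \<Omega> f \<mu> k \<pi> (\<delta> ^ k) A \<longrightarrow>
        family.moment \<Omega> f \<mu> (tri k) A \<le> D * family.gsum \<Omega> f \<mu> (tri k) (cell 0 \<delta> \<pi>) A ^ tri k)"

definition dec_exponent :: "('i \<times> 'w) itself \<Rightarrow> nat \<Rightarrow> real \<Rightarrow> bool" where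
  "dec_exponent T k \<eta> \<longleftrightarrow> (\<exists>K\<ge>1. \<forall>\<delta>. 0 < \<delta> \<longrightarrow> \<delta> \<le> 1 \<longrightarrow> decoupling T k \<delta> (K * \<delta> powr (- \<eta>)))"

context family
begin

lemma vinD:
  assumes "vin \<mu> k \<pi> \<rho> A"
  shows "finite A" "wt \<mu>" "\<And>i. i \<in> A \<Longrightarrow> \<bar>\<pi> i\<bar> \<le> 1" "positive \<mu> (tri k) A"
    "approx \<mu> (tri k) k \<pi> \<rho> A"
  using assms unfolding vin_def by auto

lemma vin_diam_le:
  assumes "vin \<mu> k \<pi> \<rho> A" "B \<subseteq> A"
  shows "diam_le \<pi> 2 B"
  unfolding diam_le_def
proof (intro ballI)
  fix i j assume "i \<in> B" "j \<in> B"
  then have "i \<in> A" "j \<in> A" using assms(2) by auto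
  then show "\<bar>\<pi> i - \<pi> j\<bar> \<le> 2" using vinD(3)[OF assms(1), of i] vinD(3)[OF assms(1), of j] by linarith
qed

lemma positive_subset: "positive \<mu> r A \<Longrightarrow> B \<subseteq> A \<Longrightarrow> positive \<mu> r B"
  unfolding positive_def by blast

lemma approx_subset: "approx \<mu> r k \<pi> \<rho> A \<Longrightarrow> B \<subseteq> A \<Longrightarrow> approx \<mu> r k \<pi> \<rho> B"
  unfolding approx_def by blast

lemma decouplingD:
  assumes "decoupling TYPE('i \<times> 'w) k \<delta> D" "vin \<mu> k \<pi> (\<delta> ^ k) A"
  shows "moment \<mu> (tri k) A \<le> D * gsum \<mu> (tri k) (cell 0 \<delta> \<pi>) A ^ tri k"
  using assms finite_space unfolding decoupling_def by blast

lemma gsum_cell_le: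
  assumes "positive \<mu> r A" "B \<subseteq> A" "finite A" "r \<ge> 1" "wt \<mu>" "h > 0" "h' > 0"
  shows "gsum \<mu> r (cell x h \<pi>) B \<le> (h / h' + 2)\<^sup>2 * (h' / h + 2) * gsum \<mu> r (cell x' h' \<pi>) B"
proof (rule gsum_regroup[OF assms(1-5)])
  have fin: "finite B" by (rule finite_subset[OF assms(2,3)])
  show "real (card (cell x h \<pi> ` {i\<in>B. cell x' h' \<pi> i = n})) \<le> h' / h + 2" for n
    by (rule card_cell_le) (use fin assms(6,7) in \<open>auto intro: diam_le_cell\<close>)
  show "real (card (cell x' h' \<pi> ` {i\<in>B. cell x h \<pi> i = n})) \<le> h / h' + 2" for n
    by (rule card_cell_le) (use fin assms(6,7) in \<open>auto intro: diam_le_cell\<close>)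
qed

lemma gsum_cell_superadditive:
  assumes "positive \<mu> r A" "B \<subseteq> A" "finite A" "r \<ge> 1" "wt \<mu>" "h > 0" "h' > 0" "h' \<le> h"
  shows "(\<Sum>c\<in>cell x h \<pi> ` B. gsum \<mu> r (cell x' h' \<pi>) {i\<in>B. cell x h \<pi> i = c})
    \<le> 3 * gsum \<mu> r (cell x' h' \<pi>) B"
proof (rule gsum_superadditive[OF assms(1-5)])
  have fin: "finite B" by (rule finite_subset[OF assms(2,3)])
  fix n
  have "real (card (cell x h \<pi> ` {i\<in>B. cell x' h' \<pi> i = n})) \<le> h' / h + 2"
    by (rule card_cell_le) (use fin assms(6,7) in \<open>auto intro: diam_le_cell\<close>)
  also have "\<dots> \<le> 3" using assms(6-8) by simp
  finally show "real (card (cell x h \<pi> ` {i\<in>B. cell x' h' \<pi> i = n})) \<le> 3" .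
qed

lemma moment_trivial:
  assumes "finite B" "r \<ge> 1" "wt \<mu>" "diam_le \<pi> t B" "t \<ge> 0" "h > 0"
  shows "moment \<mu> r B \<le> ((t / h + 2)\<^sup>2) ^ r * gsum \<mu> r (cell x h \<pi>) B ^ r"
proof -
  have "nm \<mu> r B \<le> (t / h + 2)\<^sup>2 * gsum \<mu> r (cell x h \<pi>) B"
    by (rule nm_split[OF assms(1,3) card_cell_le[OF assms(1,4,6,5)] assms(2)])
  then have "nm \<mu> r B ^ r \<le> ((t / h + 2)\<^sup>2 * gsum \<mu> r (cell x h \<pi>) B) ^ r"
    by (rule power_mono) (rule nm_nonneg[OF assms(3)])
  then show ?thesis using nm_power[OF assms(3,2)] by (simp add: power_mult_distrib)
qed

text \<open>The affine map sending \<open>\<pi> i0\<close> to 0 and stretching by 1 / \<sigma>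
  divides power sums of degree \<open>j\<close> by \<sigma>^j, whence the admissible error. Cells of
  length \<delta> for the stretched positions are cells of length \<sigma> \<delta> for the old
  ones, anchored at \<open>\<pi> i0\<close>.\<close>

lemma moment_rescale:
  assumes dec: "decoupling TYPE('i \<times> 'w) k \<delta> D" and "\<sigma> > 0"
    and pos: "positive \<mu> (tri k) B" and "wt \<mu>" "finite B" "i0 \<in> B" "diam_le \<pi> \<sigma> B"
    and appr: "\<And>xs ys j. xs \<in> tup B (tri k) \<Longrightarrow> ys \<in> tup B (tri k) \<Longrightarrow> corr \<mu> xs ys \<noteq> 0 \<Longrightarrow> j \<in> {1..k} \<Longrightarrow>
      \<bar>psum (\<lambda>i. \<pi> i - \<pi> i0) j xs - psum (\<lambda>i. \<pi> i - \<pi> i0) j ys\<bar> \<le> \<sigma> ^ j * \<delta> ^ k"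
  shows "moment \<mu> (tri k) B \<le> D * gsum \<mu> (tri k) (cell (\<pi> i0) (\<sigma> * \<delta>) \<pi>) B ^ tri k"
proof -
  define \<pi>' where "\<pi>' = (\<lambda>i. (1 / \<sigma>) * (\<pi> i - \<pi> i0))"
  have "vin \<mu> k \<pi>' (\<delta> ^ k) B"
    unfolding vin_def approx_def
  proof (intro conjI ballI impI)
    fix i assume "i \<in> B"
    then have "\<bar>\<pi> i - \<pi> i0\<bar> \<le> \<sigma>" using assms(6,7) unfolding diam_le_def by auto
    then show "\<bar>\<pi>' i\<bar> \<le> 1" unfolding \<pi>'_def using assms(2) by (simp add: abs_mult)
  next
    fix xs ys j assume xy: "xs \<in> tup B (tri k)" "ys \<in> tup B (tri k)" "corr \<mu> xs ys \<noteq> 0" "j \<in> {1..k}"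
    have "\<bar>psum \<pi>' j xs - psum \<pi>' j ys\<bar>
       = (1 / \<sigma>) ^ j * \<bar>psum (\<lambda>i. \<pi> i - \<pi> i0) j xs - psum (\<lambda>i. \<pi> i - \<pi> i0) j ys\<bar>"
      unfolding \<pi>'_def psum_scale using assms(2)
      by (simp add: right_diff_distrib[symmetric] abs_mult del: power_divide)
    also have "\<dots> \<le> (1 / \<sigma>) ^ j * (\<sigma> ^ j * \<delta> ^ k)"
      using appr[OF xy] assms(2) by (intro mult_left_mono) auto
    also have "\<dots> = \<delta> ^ k" using assms(2) by (simp add: power_divide)
    finally show "\<bar>psum \<pi>' j xs - psum \<pi>' j ys\<bar> \<le> \<delta> ^ k" .
  qed (use assms in auto)
  from decouplingD[OF dec this]
  have "moment \<mu> (tri k) B \<le> D * gsum \<mu> (tri k) (cell 0 \<delta> \<pi>') B ^ tri k" .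
  moreover have "cell 0 \<delta> \<pi>' = cell (\<pi> i0) (\<sigma> * \<delta>) \<pi>"
    unfolding cell_def \<pi>'_def by auto
  ultimately show ?thesis by simp
qed

lemma moment_empty: "r \<ge> 1 \<Longrightarrow> moment \<mu> r {} = 0"
  by (simp add: moment_def av_def F_def zero_power)

text \<open>Decoupling is used at scale \<open>2 * \<delta> / \<sigma>\<close> instead of \<delta> /
  \<sigma> so that the 2 absorbs the factor 2^k lost in recentring at \<open>\<pi> i0\<close>. The
  return from cells of length 2 \<delta> anchored at \<open>\<pi> i0\<close> to cells of length
  \<delta> anchored at 0 costs (2 + 2)^2 (1/2 + 2) = 40.\<close>

lemma moment_local:
  assumes dec: "decoupling TYPE('i \<times> 'w) k (2 * \<delta> / \<sigma>) D" and "D \<ge> 0" "k \<ge> 1"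
    and vin: "vin \<mu> k \<pi> (\<delta> ^ k) A" and "0 < \<delta>" "0 < \<sigma>" "\<sigma> \<le> 1" "B \<subseteq> A" "diam_le \<pi> \<sigma> B"
  shows "moment \<mu> (tri k) B \<le> D * 40 ^ tri k * gsum \<mu> (tri k) (cell 0 \<delta> \<pi>) B ^ tri k"
proof (cases "B = {}")
  case True
  have "wt \<mu>" using vinD[OF vin] by auto
  then show ?thesis unfolding True using tri_pos[OF assms(3)] assms(2)
    by (auto simp: moment_empty intro!: mult_nonneg_nonneg zero_le_power gsum_nonneg)
next
  case False
  then obtain i0 where i0: "i0 \<in> B" by auto
  note v = vinD[OF vin]
  have r1: "tri k \<ge> 1" by (rule tri_pos[OF assms(3)])
  have finB: "finite B" by (rule finite_subset[OF assms(8) v(1)])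
  have posB: "positive \<mu> (tri k) B" by (rule positive_subset[OF v(4) assms(8)])
  have "moment \<mu> (tri k) B \<le> D * gsum \<mu> (tri k) (cell (\<pi> i0) (\<sigma> * (2 * \<delta> / \<sigma>)) \<pi>) B ^ tri k"
  proof (rule moment_rescale[OF dec assms(6)])
    fix xs ys j assume xy: "xs \<in> tup B (tri k)" "ys \<in> tup B (tri k)" "corr \<mu> xs ys \<noteq> 0" "j \<in> {1..k}"
    have "\<forall>j\<in>{1..k}. \<bar>psum \<pi> j xs - psum \<pi> j ys\<bar> \<le> \<delta> ^ k"
      using approx_subset[OF v(5) assms(8), unfolded approx_def, rule_format, OF xy(1,2,3)] by blast
    then have "\<bar>psum (\<lambda>i. \<pi> i - \<pi> i0) j xs - psum (\<lambda>i. \<pi> i - \<pi> i0) j ys\<bar> \<le> 2 ^ k * \<delta> ^ k"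
      by (rule psum_shift_diff) (use xy v(3) i0 assms(5,8) in auto)
    also have "\<dots> = \<sigma> ^ k * (2 * \<delta> / \<sigma>) ^ k"
      using assms(6) by (simp add: power_mult_distrib power_divide)
    also have "\<dots> \<le> \<sigma> ^ j * (2 * \<delta> / \<sigma>) ^ k"
      using xy(4) assms(5-7) by (intro mult_right_mono power_decreasing) auto
    finally show "\<bar>psum (\<lambda>i. \<pi> i - \<pi> i0) j xs - psum (\<lambda>i. \<pi> i - \<pi> i0) j ys\<bar> \<le> \<sigma> ^ j * (2 * \<delta> / \<sigma>) ^ k" .
  qed (use v(2) assms(9) i0 finB posB in auto)
  also have "\<dots> = D * gsum \<mu> (tri k) (cell (\<pi> i0) (2 * \<delta>) \<pi>) B ^ tri k" using assms(6) by simp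
  also have "\<dots> \<le> D * (40 * gsum \<mu> (tri k) (cell 0 \<delta> \<pi>) B) ^ tri k"
  proof (intro mult_left_mono power_mono)
    have "gsum \<mu> (tri k) (cell (\<pi> i0) (2 * \<delta>) \<pi>) B
      \<le> (2 * \<delta> / \<delta> + 2)\<^sup>2 * (\<delta> / (2 * \<delta>) + 2) * gsum \<mu> (tri k) (cell 0 \<delta> \<pi>) B"
      by (rule gsum_cell_le[OF v(4) assms(8) v(1) r1 v(2)]) (use assms(5) in auto)
    then show "gsum \<mu> (tri k) (cell (\<pi> i0) (2 * \<delta>) \<pi>) B \<le> 40 * gsum \<mu> (tri k) (cell 0 \<delta> \<pi>) B"
      using assms(5) by simp
  qed (use assms(2) gsum_nonneg[OF v(2)] in auto)
  finally show ?thesis by (simp add: power_mult_distrib mult.assoc)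
qed

end

section \<open>Decoupling on short intervals\<close>

definition local_bound :: "('i \<times> 'w) itself \<Rightarrow> real \<Rightarrow> nat \<Rightarrow> real \<Rightarrow> bool" where
  "local_bound T K k \<eta> \<longleftrightarrow>
     (\<forall>(\<Omega> :: 'w set) (f :: 'i \<Rightarrow> 'w \<Rightarrow> complex) \<mu> \<pi> A B \<delta> \<sigma>. finite \<Omega> \<longrightarrow>
        family.vin \<Omega> f \<mu> k \<pi> (\<delta> ^ k) A \<longrightarrow> 0 < \<delta> \<longrightarrow> \<delta> \<le> \<sigma> \<longrightarrow> \<sigma> \<le> 1 \<longrightarrow> B \<subseteq> A \<longrightarrow> diam_le \<pi> \<sigma> B \<longrightarrow>
        family.moment \<Omega> f \<mu> (tri k) B \<le>
          K * (\<sigma> / \<delta>) powr \<eta> * family.gsum \<Omega> f \<mu> (tri k) (cell 0 \<delta> \<pi>) B ^ tri k)"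

lemma (in family) local_boundD:
  assumes "local_bound TYPE('i \<times> 'w) K k \<eta>" "vin \<mu> k \<pi> (\<delta> ^ k) A" "0 < \<delta>" "\<delta> \<le> \<sigma>" "\<sigma> \<le> 1"
    "B \<subseteq> A" "diam_le \<pi> \<sigma> B"
  shows "moment \<mu> (tri k) B \<le> K * (\<sigma> / \<delta>) powr \<eta> * gsum \<mu> (tri k) (cell 0 \<delta> \<pi>) B ^ tri k"
  using assms finite_space unfolding local_bound_def by blast

text \<open>If \<sigma> < 2 \<delta>, the rescaled scale would exceed 1; but then at most \<sigma> /
  \<delta> + 2 \<le> 4 cells meet \<open>B\<close>, and the triangle inequality is enough.\<close>

lemma moment_local_exponent:
  assumes "dec_exponent TYPE('i \<times> 'w) k \<eta>" "k \<ge> 1" "\<eta> \<ge> 0"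
  obtains K where "K \<ge> 1" "local_bound TYPE('i \<times> 'w) K k \<eta>"
proof -
  obtain K where K: "K \<ge> 1" "\<And>\<delta>. 0 < \<delta> \<Longrightarrow> \<delta> \<le> 1 \<Longrightarrow> decoupling TYPE('i \<times> 'w) k \<delta> (K * \<delta> powr (- \<eta>))"
    using assms(1) unfolding dec_exponent_def by auto
  define K' where "K' = K * 40 ^ tri k"
  have r1: "tri k \<ge> 1" by (rule tri_pos[OF assms(2)])
  have K40: "40 ^ tri k \<le> K'" unfolding K'_def using mult_right_mono[OF K(1), of "40 ^ tri k"] by simp
  have "(1::real) \<le> 40 ^ tri k" by simp
  then have K'1: "K' \<ge> 1" using K40 by linarith
  show thesis
  proof (rule that[OF K'1], unfold local_bound_def, intro allI impI)
    fix \<Omega> :: "'w set" and f :: "'i \<Rightarrow> 'w \<Rightarrow> complex" and \<mu> \<pi> A B \<delta> \<sigma>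
    assume fin: "finite \<Omega>" and vin: "family.vin \<Omega> f \<mu> k \<pi> (\<delta> ^ k) A"
      and d: "0 < \<delta>" "\<delta> \<le> \<sigma>" "\<sigma> \<le> 1" and B: "B \<subseteq> A" "diam_le \<pi> \<sigma> B"
    interpret family \<Omega> f by unfold_locales (rule fin)
    note v = vinD[OF vin]
    have G0: "0 \<le> gsum \<mu> (tri k) (cell 0 \<delta> \<pi>) B ^ tri k" by (intro zero_le_power gsum_nonneg v)
    have sd: "\<sigma> / \<delta> \<ge> 1" using d by simp
    show "moment \<mu> (tri k) B \<le> K' * (\<sigma> / \<delta>) powr \<eta> * gsum \<mu> (tri k) (cell 0 \<delta> \<pi>) B ^ tri k"
    proof (cases "2 * \<delta> / \<sigma> \<le> 1")
      case True
      have "moment \<mu> (tri k) B \<le> (K * (2 * \<delta> / \<sigma>) powr (- \<eta>)) * 40 ^ tri k * gsum \<mu> (tri k) (cell 0 \<delta> \<pi>) B ^ tri k"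
        by (rule moment_local[OF K(2) _ assms(2) vin]) (use True d B K(1) in auto)
      also have "\<dots> \<le> (K * (\<sigma> / \<delta>) powr \<eta>) * 40 ^ tri k * gsum \<mu> (tri k) (cell 0 \<delta> \<pi>) B ^ tri k"
      proof (intro mult_right_mono mult_left_mono)
        have "(2 * \<delta> / \<sigma>) powr (- \<eta>) = (1 / (2 * \<delta> / \<sigma>)) powr \<eta>"
          using d by (simp add: powr_minus powr_divide)
        also have "\<dots> \<le> (\<sigma> / \<delta>) powr \<eta>" using d assms(3) by (intro powr_mono2) (auto simp: field_simps)
        finally show "(2 * \<delta> / \<sigma>) powr (- \<eta>) \<le> (\<sigma> / \<delta>) powr \<eta>" .
      qed (use K G0 in auto)
      finally show ?thesis unfolding K'_def by (simp add: mult_ac)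
    next
      case False
      then have sd2: "\<sigma> / \<delta> \<le> 2" using d by (simp add: field_simps)
      have "moment \<mu> (tri k) B \<le> ((\<sigma> / \<delta> + 2)\<^sup>2) ^ tri k * gsum \<mu> (tri k) (cell 0 \<delta> \<pi>) B ^ tri k"
        by (rule moment_trivial[OF finite_subset[OF B(1) v(1)] r1 v(2) B(2)]) (use d in auto)
      also have "\<dots> \<le> (40 :: real) ^ tri k * gsum \<mu> (tri k) (cell 0 \<delta> \<pi>) B ^ tri k"
      proof (intro mult_right_mono power_mono G0)
        have "(\<sigma> / \<delta> + 2)\<^sup>2 \<le> 4\<^sup>2" using sd sd2 by (intro power_mono) auto
        then show "(\<sigma> / \<delta> + 2)\<^sup>2 \<le> 40" by simp
      qed auto
      also have "\<dots> \<le> K' * gsum \<mu> (tri k) (cell 0 \<delta> \<pi>) B ^ tri k"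
        using K40 G0 by (rule mult_right_mono)
      also have "\<dots> \<le> (K' * (\<sigma> / \<delta>) powr \<eta>) * gsum \<mu> (tri k) (cell 0 \<delta> \<pi>) B ^ tri k"
      proof (rule mult_right_mono[OF _ G0])
        have "1 \<le> (\<sigma> / \<delta>) powr \<eta>" using sd assms(3) by (rule ge_one_powr_ge_zero)
        then show "K' \<le> K' * (\<sigma> / \<delta>) powr \<eta>" using K'1 mult_left_mono[of 1 "(\<sigma> / \<delta>) powr \<eta>" K'] by simp
      qed
      finally show ?thesis .
    qed
  qed
qed

section \<open>Bilinear estimates\<close>

lemma decoupling_mono:
  assumes "decoupling TYPE('i \<times> 'w) k \<delta> D" "D \<le> D'"
  shows "decoupling TYPE('i \<times> 'w) k \<delta> D'"
  unfolding decoupling_def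
proof (intro allI impI)
  fix \<Omega> :: "'w set" and f :: "'i \<Rightarrow> 'w \<Rightarrow> complex" and A \<mu> \<pi>
  assume h: "finite \<Omega>" "family.vin \<Omega> f \<mu> k \<pi> (\<delta> ^ k) A"
  interpret family \<Omega> f by unfold_locales (rule h(1))
  have "moment \<mu> (tri k) A \<le> D * gsum \<mu> (tri k) (cell 0 \<delta> \<pi>) A ^ tri k"
    by (rule decouplingD[OF assms(1) h(2)])
  also have "\<dots> \<le> D' * gsum \<mu> (tri k) (cell 0 \<delta> \<pi>) A ^ tri k"
    by (intro mult_right_mono assms(2) zero_le_power gsum_nonneg vinD(2)[OF h(2)])
  finally show "moment \<mu> (tri k) A \<le> D' * gsum \<mu> (tri k) (cell 0 \<delta> \<pi>) A ^ tri k" .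
qed

lemma dec_exponent_mono:
  assumes "dec_exponent TYPE('i \<times> 'w) k \<eta>" "\<eta> \<le> \<eta>'"
  shows "dec_exponent TYPE('i \<times> 'w) k \<eta>'"
proof -
  obtain K where K: "K \<ge> 1" "\<And>\<delta>. 0 < \<delta> \<Longrightarrow> \<delta> \<le> 1 \<Longrightarrow> decoupling TYPE('i \<times> 'w) k \<delta> (K * \<delta> powr (- \<eta>))"
    using assms(1) unfolding dec_exponent_def by blast
  have "decoupling TYPE('i \<times> 'w) k \<delta> (K * \<delta> powr (- \<eta>'))" if d: "0 < \<delta>" "\<delta> \<le> 1" for \<delta>
    using K(2)[OF d] by (rule decoupling_mono) (use K(1) d assms(2) in \<open>auto intro: powr_mono'\<close>)
  then show ?thesis unfolding dec_exponent_def using K(1) by blast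
qed

lemma decoupling_trivial:
  assumes "k \<ge> 1" and d: "0 < \<delta>" "\<delta> \<le> 1"
  shows "decoupling TYPE('i \<times> 'w) k \<delta> (16 ^ tri k * \<delta> powr (- (2 * real (tri k))))"
  unfolding decoupling_def
proof (intro allI impI)
  fix \<Omega> :: "'w set" and f :: "'i \<Rightarrow> 'w \<Rightarrow> complex" and A \<mu> \<pi>
  assume fin: "finite \<Omega>" and vin: "family.vin \<Omega> f \<mu> k \<pi> (\<delta> ^ k) A"
  interpret family \<Omega> f by unfold_locales (rule fin)
  note v = vinD[OF vin]
  have G0: "0 \<le> gsum \<mu> (tri k) (cell 0 \<delta> \<pi>) A ^ tri k" by (intro zero_le_power gsum_nonneg v)
  have "moment \<mu> (tri k) A \<le> ((2 / \<delta> + 2)\<^sup>2) ^ tri k * gsum \<mu> (tri k) (cell 0 \<delta> \<pi>) A ^ tri k"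
    by (rule moment_trivial[OF v(1) tri_pos[OF assms(1)] v(2) vin_diam_le[OF vin order_refl]]) (use d in auto)
  also have "\<dots> \<le> ((4 / \<delta>)\<^sup>2) ^ tri k * gsum \<mu> (tri k) (cell 0 \<delta> \<pi>) A ^ tri k"
    by (intro mult_right_mono power_mono G0) (use d in \<open>auto simp: field_simps\<close>)
  also have "((4 / \<delta>)\<^sup>2) ^ tri k = 16 ^ tri k * \<delta> powr (- (2 * real (tri k)))"
  proof -
    have "\<delta> powr (- (2 * real (tri k))) = inverse (\<delta> ^ (2 * tri k))"
      using d powr_realpow[of \<delta> "2 * tri k"] by (simp add: powr_minus)
    then show ?thesis by (simp add: power_divide power_mult divide_inverse power_inverse)
  qed
  finally show "moment \<mu> (tri k) A \<le> 16 ^ tri k * \<delta> powr (- (2 * real (tri k))) * gsum \<mu> (tri k) (cell 0 \<delta> \<pi>) A ^ tri k" .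
qed

lemma dec_exponent_trivial: "k \<ge> 1 \<Longrightarrow> dec_exponent TYPE('i \<times> 'w) k (2 * real (tri k))"
  unfolding dec_exponent_def by (intro exI[of _ "16 ^ tri k"]) (auto intro: decoupling_trivial)

text \<open>In degree one the correlation of two points vanishes unless they lie within \<delta> of
  each other, so only equal or adjacent cells interact. The 3 counts these neighbours.\<close>

lemma (in family) moment_orthogonality:
  assumes vin: "vin \<mu> 1 \<pi> \<delta> A" and d: "0 < \<delta>"
  shows "moment \<mu> 1 A \<le> 3 * (\<Sum>n\<in>cell 0 \<delta> \<pi> ` A. moment \<mu> 1 {i\<in>A. cell 0 \<delta> \<pi> i = n})"
proof -
  note v = vinD[OF vin]
  define \<kappa> where "\<kappa> = cell 0 \<delta> \<pi>"
  define S where "S = \<kappa> ` A"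
  define P where "P n = {i\<in>A. \<kappa> i = n}" for n
  define m where "m n = moment \<mu> 1 (P n)" for n
  define c where "c n n' = av \<mu> (\<lambda>w. Re (F (P n) w * cnj (F (P n') w)))" for n n'
  have finS: "finite S" unfolding S_def using v(1) by simp
  have t1: "tri 1 = 1" by (simp add: tri_def)
  have m1: "moment \<mu> 1 B = av \<mu> (\<lambda>w. norm (F B w) ^ 2)" for B by (simp add: moment_def)
  have "norm (F A w) ^ 2 = (\<Sum>n\<in>S. \<Sum>n'\<in>S. Re (F (P n) w * cnj (F (P n') w)))" for w
  proof -
    have "complex_of_real (norm (F A w) ^ 2) = F A w * cnj (F A w)" by (rule complex_norm_square)
    also have "\<dots> = (\<Sum>n\<in>S. \<Sum>n'\<in>S. F (P n) w * cnj (F (P n') w))"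
      unfolding F_partition[OF v(1), of w \<kappa>] S_def P_def by (simp add: sum_product)
    finally have "Re (complex_of_real (norm (F A w) ^ 2)) = Re (\<Sum>n\<in>S. \<Sum>n'\<in>S. F (P n) w * cnj (F (P n') w))"
      by (rule arg_cong)
    then show ?thesis by (simp only: Re_complex_of_real Re_sum)
  qed
  then have e: "moment \<mu> 1 A = (\<Sum>n\<in>S. \<Sum>n'\<in>S. c n n')"
    unfolding m1 c_def by (simp only: av_sum[OF finS])
  have zero: "c n n' = 0" if nn: "\<bar>n - n'\<bar> > 1" for n n'
  proof -
    have fP: "finite (P n)" for n unfolding P_def using v(1) by simp
    have "(\<Sum>w\<in>\<Omega>. of_real (\<mu> w) * (F (P n) w * cnj (F (P n') w)))
      = (\<Sum>w\<in>\<Omega>. \<Sum>i\<in>P n. \<Sum>j\<in>P n'. of_real (\<mu> w) * (f i w * cnj (f j w)))"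
      unfolding F_def cnj_sum unfolding sum_product by (simp only: sum_distrib_left)
    also have "\<dots> = (\<Sum>i\<in>P n. \<Sum>w\<in>\<Omega>. \<Sum>j\<in>P n'. of_real (\<mu> w) * (f i w * cnj (f j w)))"
      by (rule sum.swap)
    also have "\<dots> = (\<Sum>i\<in>P n. \<Sum>j\<in>P n'. corr \<mu> [i] [j])"
      unfolding corr_def by (intro sum.cong refl, subst sum.swap) (simp add: mult.assoc)
    also have "\<dots> = 0"
    proof (intro sum.neutral ballI)
      fix i j assume ij: "i \<in> P n" "j \<in> P n'"
      show "corr \<mu> [i] [j] = 0"
      proof (rule ccontr)
        assume nz: "corr \<mu> [i] [j] \<noteq> 0"
        have "[i] \<in> tup A (tri 1)" "[j] \<in> tup A (tri 1)" using ij unfolding P_def t1 by auto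
        from v(5)[unfolded approx_def, rule_format, OF this nz, of 1]
        have "\<bar>\<pi> i - \<pi> j\<bar> \<le> \<delta>" by simp
        then have "\<bar>\<pi> i / \<delta> - \<pi> j / \<delta>\<bar> \<le> 1" using d by (simp add: diff_divide_distrib[symmetric])
        then have "\<bar>\<kappa> i - \<kappa> j\<bar> \<le> 1" unfolding \<kappa>_def cell_def by simp linarith
        then show False using nn ij unfolding P_def by auto
      qed
    qed
    finally have "(\<Sum>w\<in>\<Omega>. of_real (\<mu> w) * (F (P n) w * cnj (F (P n') w))) = 0" .
    then have "Re (\<Sum>w\<in>\<Omega>. of_real (\<mu> w) * (F (P n) w * cnj (F (P n') w))) = 0" by simp
    moreover have "Re (of_real x * z) = x * Re z" for x z by simp
    ultimately show ?thesis unfolding c_def av_def by (simp only: Re_sum)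
  qed
  have le: "c n n' \<le> (m n + m n') / 2" for n n'
  proof -
    have "c n n' \<le> av \<mu> (\<lambda>w. (1/2) * (norm (F (P n) w) ^ 2 + norm (F (P n') w) ^ 2))"
      unfolding c_def
    proof (rule av_mono[OF v(2)])
      fix w
      have "Re (F (P n) w * cnj (F (P n') w)) \<le> norm (F (P n) w) * norm (F (P n') w)"
        using complex_Re_le_cmod[of "F (P n) w * cnj (F (P n') w)"]
        by (simp only: complex_mod_cnj norm_mult)
      also have "\<dots> \<le> (1/2) * (norm (F (P n) w) ^ 2 + norm (F (P n') w) ^ 2)"
        using sum_squares_bound[of "norm (F (P n) w)" "norm (F (P n') w)"] by simp
      finally show "Re (F (P n) w * cnj (F (P n') w)) \<le> (1/2) * (norm (F (P n) w) ^ 2 + norm (F (P n') w) ^ 2)" .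
    qed
    then show ?thesis unfolding m_def m1 by (simp only: av_cmult av_add)
  qed
  have m0: "m n \<ge> 0" for n unfolding m_def by (rule moment_nonneg[OF v(2)])
  have cnt: "real (card {n'\<in>S. \<bar>n - n'\<bar> \<le> 1}) \<le> 3" for n
  proof -
    have "card {n'\<in>S. \<bar>n - n'\<bar> \<le> 1} \<le> card {n-1..n+1}" by (intro card_mono) auto
    then show ?thesis by simp
  qed
  have "moment \<mu> 1 A \<le> (\<Sum>n\<in>S. \<Sum>n'\<in>{n'\<in>S. \<bar>n - n'\<bar> \<le> 1}. c n n')"
  proof -
    have "(\<Sum>n'\<in>S. c n n') = (\<Sum>n'\<in>{n'\<in>S. \<bar>n - n'\<bar> \<le> 1}. c n n')" for n
      by (rule sum.mono_neutral_right) (use finS in \<open>auto intro!: zero\<close>)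
    then show ?thesis unfolding e by simp
  qed
  also have "\<dots> \<le> (\<Sum>n\<in>S. \<Sum>n'\<in>{n'\<in>S. \<bar>n - n'\<bar> \<le> 1}. m n / 2 + m n' / 2)"
    using le by (intro sum_mono) (simp add: add_divide_distrib)
  also have "\<dots> = (\<Sum>n\<in>S. \<Sum>n'\<in>{n'\<in>S. \<bar>n - n'\<bar> \<le> 1}. m n / 2)
      + (\<Sum>n\<in>S. \<Sum>n'\<in>{n'\<in>S. \<bar>n - n'\<bar> \<le> 1}. m n' / 2)"
    by (simp only: sum.distrib)
  also have "(\<Sum>n\<in>S. \<Sum>n'\<in>{n'\<in>S. \<bar>n - n'\<bar> \<le> 1}. m n' / 2)
      = (\<Sum>n'\<in>S. \<Sum>n\<in>{n\<in>S. \<bar>n - n'\<bar> \<le> 1}. m n' / 2)"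
    by (rule sum.swap_restrict[OF finS finS])
  also have "\<dots> = (\<Sum>n\<in>S. \<Sum>n'\<in>{n'\<in>S. \<bar>n - n'\<bar> \<le> 1}. m n / 2)"
    by (simp add: abs_minus_commute)
  also have "(\<Sum>n\<in>S. \<Sum>n'\<in>{n'\<in>S. \<bar>n - n'\<bar> \<le> 1}. m n / 2) \<le> (\<Sum>n\<in>S. 3 * (m n / 2))"
  proof (rule sum_mono)
    fix n
    show "(\<Sum>n'\<in>{n'\<in>S. \<bar>n - n'\<bar> \<le> 1}. m n / 2) \<le> 3 * (m n / 2)"
      using mult_right_mono[OF cnt[of n], of "m n / 2"] m0[of n] by simp
  qed
  finally show ?thesis unfolding S_def m_def P_def \<kappa>_def by (simp add: sum_distrib_left)
qed

lemma dec_exponent_1: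
  assumes "\<eta> \<ge> 0"
  shows "dec_exponent TYPE('i \<times> 'w) 1 \<eta>"
  unfolding dec_exponent_def decoupling_def
proof (intro exI[of _ 3] conjI allI impI)
  fix \<delta> :: real and \<Omega> :: "'w set" and f :: "'i \<Rightarrow> 'w \<Rightarrow> complex" and A \<mu> \<pi>
  assume d: "0 < \<delta>" "\<delta> \<le> 1" and fin: "finite \<Omega>" and vin: "family.vin \<Omega> f \<mu> 1 \<pi> (\<delta> ^ 1) A"
  interpret family \<Omega> f by unfold_locales (rule fin)
  have t1: "tri 1 = 1" by (simp add: tri_def)
  note v = vinD[OF vin]
  have g: "gsum \<mu> 1 (cell 0 \<delta> \<pi>) A = (\<Sum>n\<in>cell 0 \<delta> \<pi> ` A. moment \<mu> 1 {i\<in>A. cell 0 \<delta> \<pi> i = n})"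
    unfolding gsum_def nm_def by simp
  have "moment \<mu> 1 A \<le> 3 * gsum \<mu> 1 (cell 0 \<delta> \<pi>) A"
    unfolding g by (rule moment_orthogonality) (use vin d in auto)
  also have "\<dots> \<le> 3 * \<delta> powr (- \<eta>) * gsum \<mu> 1 (cell 0 \<delta> \<pi>) A"
  proof (rule mult_right_mono[OF _ gsum_nonneg[OF v(2)]])
    show "3 \<le> 3 * \<delta> powr (- \<eta>)" using powr_mono2'[of "- \<eta>" \<delta> 1] d assms by simp
  qed
  finally show "moment \<mu> (tri 1) A \<le> 3 * \<delta> powr (- \<eta>) * gsum \<mu> (tri 1) (cell 0 \<delta> \<pi>) A ^ tri 1"
    unfolding t1 by simp
qed simp

text \<open>
  The asymmetric bilinear estimate: \<open>\<beta>\<close> is the exponent of \<open>1 / \<delta>\<close> lost for intervals of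
  lengths \<open>\<delta>\<^sup>a\<close> and \<open>\<delta>\<^sup>b\<close> at distance at least \<open>\<tau>\<close>.
\<close>

definition bilinear_bound ::
  "('i \<times> 'w) itself \<Rightarrow> real \<Rightarrow> nat \<Rightarrow> real \<Rightarrow> nat \<Rightarrow> real \<Rightarrow> real \<Rightarrow> real \<Rightarrow> bool" where
  "bilinear_bound T K k \<tau> l a b \<beta> \<longleftrightarrow>
     (\<forall>(\<Omega> :: 'w set) (f :: 'i \<Rightarrow> 'w \<Rightarrow> complex) A \<mu> \<pi> \<delta> B C.
        finite \<Omega> \<longrightarrow> family.vin \<Omega> f \<mu> k \<pi> (\<delta> ^ k) A \<longrightarrow> 0 < \<delta> \<longrightarrow> \<delta> \<le> 1 \<longrightarrow>
        B \<subseteq> A \<longrightarrow> C \<subseteq> A \<longrightarrow> diam_le \<pi> (\<delta> powr a) B \<longrightarrow> diam_le \<pi> (\<delta> powr b) C \<longrightarrow>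
        (\<forall>i\<in>B. \<forall>j\<in>C. \<tau> \<le> \<bar>\<pi> i - \<pi> j\<bar>) \<longrightarrow>
        family.moment \<Omega> f (family.reweight f \<mu> (tri k - tri l) C) (tri l) B \<le>
          K * \<delta> powr (- \<beta>) *
          (family.gsum \<Omega> f \<mu> (tri k) (cell 0 \<delta> \<pi>) B ^ tri l *
           family.gsum \<Omega> f \<mu> (tri k) (cell 0 \<delta> \<pi>) C ^ (tri k - tri l)))"

definition bilinear :: "('i \<times> 'w) itself \<Rightarrow> nat \<Rightarrow> real \<Rightarrow> nat \<Rightarrow> real \<Rightarrow> real \<Rightarrow> real \<Rightarrow> bool" where
  "bilinear T k \<tau> l a b \<beta> \<longleftrightarrow> (\<exists>K\<ge>1. bilinear_bound T K k \<tau> l a b \<beta>)"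

lemma bilinearI:
  assumes "K \<ge> 1"
    and "\<And>(\<Omega> :: 'w set) (f :: 'i \<Rightarrow> 'w \<Rightarrow> complex) A \<mu> \<pi> \<delta> B C. finite \<Omega> \<Longrightarrow>
      family.vin \<Omega> f \<mu> k \<pi> (\<delta> ^ k) A \<Longrightarrow> 0 < \<delta> \<Longrightarrow> \<delta> \<le> 1 \<Longrightarrow>
      B \<subseteq> A \<Longrightarrow> C \<subseteq> A \<Longrightarrow> diam_le \<pi> (\<delta> powr a) B \<Longrightarrow> diam_le \<pi> (\<delta> powr b) C \<Longrightarrow>
      (\<And>i j. i \<in> B \<Longrightarrow> j \<in> C \<Longrightarrow> \<tau> \<le> \<bar>\<pi> i - \<pi> j\<bar>) \<Longrightarrow>
      family.moment \<Omega> f (family.reweight f \<mu> (tri k - tri l) C) (tri l) B \<le>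
          K * \<delta> powr (- \<beta>) *
          (family.gsum \<Omega> f \<mu> (tri k) (cell 0 \<delta> \<pi>) B ^ tri l *
           family.gsum \<Omega> f \<mu> (tri k) (cell 0 \<delta> \<pi>) C ^ (tri k - tri l))"
  shows "bilinear TYPE('i \<times> 'w) k \<tau> l a b \<beta>"
  unfolding bilinear_def bilinear_bound_def
proof (intro exI[of _ K] conjI allI impI)
qed (use assms(1) in simp, rule assms(2), assumption+, blast)

lemma bilinearE:
  assumes "bilinear TYPE('i \<times> 'w) k \<tau> l a b \<beta>"
  obtains K where "K \<ge> 1" "bilinear_bound TYPE('i \<times> 'w) K k \<tau> l a b \<beta>"
  using assms unfolding bilinear_def by blast

lemma (in family) bilinear_boundD:
  assumes "bilinear_bound TYPE('i \<times> 'w) K k \<tau> l a b \<beta>" "vin \<mu> k \<pi> (\<delta> ^ k) A" "0 < \<delta>" "\<delta> \<le> 1"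
    "B \<subseteq> A" "C \<subseteq> A" "diam_le \<pi> (\<delta> powr a) B" "diam_le \<pi> (\<delta> powr b) C"
    "\<And>i j. i \<in> B \<Longrightarrow> j \<in> C \<Longrightarrow> \<tau> \<le> \<bar>\<pi> i - \<pi> j\<bar>"
  shows "moment (reweight \<mu> (tri k - tri l) C) (tri l) B \<le> K * \<delta> powr (- \<beta>) *
    (gsum \<mu> (tri k) (cell 0 \<delta> \<pi>) B ^ tri l * gsum \<mu> (tri k) (cell 0 \<delta> \<pi>) C ^ (tri k - tri l))"
  using assms finite_space unfolding bilinear_bound_def by blast

text \<open>As \<delta> \<le> 1, a larger exponent \<open>a'\<close> means a shorter interval for
  \<open>B\<close>.\<close>

lemma bilinear_mono:
  assumes "bilinear TYPE('i \<times> 'w) k \<tau> l a b \<beta>" "\<beta> \<le> \<beta>'" "a \<le> a'"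
  shows "bilinear TYPE('i \<times> 'w) k \<tau> l a' b \<beta>'"
proof -
  obtain K where K: "K \<ge> 1" and H: "bilinear_bound TYPE('i \<times> 'w) K k \<tau> l a b \<beta>"
    by (rule bilinearE[OF assms(1)])
  show ?thesis
  proof (rule bilinearI[OF K])
    fix \<Omega> :: "'w set" and f :: "'i \<Rightarrow> 'w \<Rightarrow> complex" and A \<mu> \<pi> and \<delta> :: real and B C
    assume h: "finite \<Omega>" "family.vin \<Omega> f \<mu> k \<pi> (\<delta> ^ k) A" "0 < \<delta>" "\<delta> \<le> 1"
      "B \<subseteq> A" "C \<subseteq> A" "diam_le \<pi> (\<delta> powr a') B" "diam_le \<pi> (\<delta> powr b) C"
      "\<And>i j. i \<in> B \<Longrightarrow> j \<in> C \<Longrightarrow> \<tau> \<le> \<bar>\<pi> i - \<pi> j\<bar>"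
    interpret family \<Omega> f by unfold_locales (rule h(1))
    note v = vinD[OF h(2)]
    have "diam_le \<pi> (\<delta> powr a) B"
      using h(7) by (rule diam_le_mono) (use h assms in \<open>auto intro: powr_mono'\<close>)
    from bilinear_boundD[OF H h(2-6) this h(8,9)]
    have "moment (reweight \<mu> (tri k - tri l) C) (tri l) B \<le>
      K * \<delta> powr (- \<beta>) * (gsum \<mu> (tri k) (cell 0 \<delta> \<pi>) B ^ tri l * gsum \<mu> (tri k) (cell 0 \<delta> \<pi>) C ^ (tri k - tri l))" .
    also have "\<dots> \<le> K * \<delta> powr (- \<beta>') * (gsum \<mu> (tri k) (cell 0 \<delta> \<pi>) B ^ tri l * gsum \<mu> (tri k) (cell 0 \<delta> \<pi>) C ^ (tri k - tri l))"
      using K h(3,4) assms(2)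
      by (intro mult_right_mono mult_left_mono powr_mono' mult_nonneg_nonneg zero_le_power gsum_nonneg v) auto
    finally show "moment (reweight \<mu> (tri k - tri l) C) (tri l) B \<le>
      K * \<delta> powr (- \<beta>') * (gsum \<mu> (tri k) (cell 0 \<delta> \<pi>) B ^ tri l * gsum \<mu> (tri k) (cell 0 \<delta> \<pi>) C ^ (tri k - tri l))" .
  qed
qed

text \<open>Inserts two bounds into Hoelder's inequality. The exponents \<open>\<beta>1\<close> and
  \<open>\<beta>2\<close> are averaged with the Hoelder weights, because they carry the gain; the
  constants are merely multiplied, which is cruder but keeps them free of roots.\<close>

lemma power_interpolate:
  fixes X Y Z K1 K2 U U1 U2 \<delta> :: real
  assumes le: "X ^ (a + b) \<le> Y ^ a * Z ^ b" and ab: "a + b > 0"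
    and Y: "0 \<le> Y" "Y \<le> K1 * \<delta> powr (- \<beta>1) * U1" and Z: "0 \<le> Z" "Z \<le> K2 * \<delta> powr (- \<beta>2) * U2"
    and U: "U ^ (a + b) = U1 ^ a * U2 ^ b" "0 \<le> U" "0 \<le> U1" "0 \<le> U2"
    and K: "1 \<le> K1" "1 \<le> K2" and d: "0 < \<delta>"
  shows "X \<le> K1 * K2 * \<delta> powr (- ((real a * \<beta>1 + real b * \<beta>2) / real (a + b))) * U"
proof -
  define D where "D = \<delta> powr (- ((real a * \<beta>1 + real b * \<beta>2) / real (a + b)))"
  have D: "D ^ (a + b) = (\<delta> powr (- \<beta>1)) ^ a * (\<delta> powr (- \<beta>2)) ^ b"
  proof -
    have "D ^ (a + b) = \<delta> powr (real (a + b) * (- ((real a * \<beta>1 + real b * \<beta>2) / real (a + b))))"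
      unfolding D_def by (rule powr_power) (use d in simp)
    also have "real (a + b) * (- ((real a * \<beta>1 + real b * \<beta>2) / real (a + b)))
        = real a * (- \<beta>1) + real b * (- \<beta>2)"
      using ab by (simp del: of_nat_add)
    also have "\<delta> powr \<dots> = (\<delta> powr (- \<beta>1)) ^ a * (\<delta> powr (- \<beta>2)) ^ b"
      unfolding powr_add using d powr_power[of \<delta> "- \<beta>1" a] powr_power[of \<delta> "- \<beta>2" b] by simp
    finally show ?thesis .
  qed
  have "X ^ (a + b) \<le> (K1 * \<delta> powr (- \<beta>1) * U1) ^ a * (K2 * \<delta> powr (- \<beta>2) * U2) ^ b"
    using le by (rule order_trans) (intro mult_mono power_mono Y Z zero_le_power order_trans[OF Y] order_trans[OF Z])
  also have "\<dots> = K1 ^ a * K2 ^ b * (D ^ (a + b) * U ^ (a + b))"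
    unfolding D U(1) by (simp add: power_mult_distrib mult_ac)
  also have "\<dots> \<le> K1 ^ (a + b) * K2 ^ (a + b) * (D ^ (a + b) * U ^ (a + b))"
    using K U(2) unfolding D_def
    by (intro mult_right_mono mult_mono power_increasing) auto
  also have "\<dots> = (K1 * K2 * D * U) ^ (a + b)" by (simp add: power_mult_distrib mult_ac)
  finally have *: "X ^ (a + b) \<le> (K1 * K2 * D * U) ^ (a + b)" .
  obtain n where n: "a + b = Suc n" using ab by (cases "a + b") auto
  have "X \<le> K1 * K2 * D * U"
    using * unfolding n by (rule power_le_imp_le_base) (use K U in \<open>auto simp: D_def\<close>)
  then show ?thesis unfolding D_def .
qed

text \<open>The source of all gain: \<open>tri 0 = 0\<close>, so the left side is the moment of
  \<open>C\<close> alone, and decoupling an interval of length \<delta>^b down to \<delta> loses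
  only (\<delta>^b / \<delta>)^\<eta>.\<close>

lemma bilinear_0:
  assumes "dec_exponent TYPE('i \<times> 'w) k \<eta>" "k \<ge> 1" "\<eta> \<ge> 0" "0 \<le> b" "b \<le> 1"
  shows "bilinear TYPE('i \<times> 'w) k \<tau> 0 a b (\<eta> * (1 - b))"
proof -
  obtain K where K: "K \<ge> 1" and H: "local_bound TYPE('i \<times> 'w) K k \<eta>"
    by (rule moment_local_exponent[OF assms(1-3)])
  show ?thesis
  proof (rule bilinearI[OF K])
    fix \<Omega> :: "'w set" and f :: "'i \<Rightarrow> 'w \<Rightarrow> complex" and A \<mu> \<pi> and \<delta> :: real and B C
    assume h: "finite \<Omega>" "family.vin \<Omega> f \<mu> k \<pi> (\<delta> ^ k) A" "0 < \<delta>" "\<delta> \<le> 1"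
      "B \<subseteq> A" "C \<subseteq> A" "diam_le \<pi> (\<delta> powr a) B" "diam_le \<pi> (\<delta> powr b) C"
    interpret family \<Omega> f by unfold_locales (rule h(1))
    have "moment \<mu> (tri k) C \<le> K * (\<delta> powr b / \<delta>) powr \<eta> * gsum \<mu> (tri k) (cell 0 \<delta> \<pi>) C ^ tri k"
    proof (rule local_boundD[OF H h(2,3) _ _ h(6,8)])
      show "\<delta> \<le> \<delta> powr b" using powr_mono'[of b 1 \<delta>] h assms by simp
      show "\<delta> powr b \<le> 1" using powr_mono'[of 0 b \<delta>] h assms by simp
    qed
    also have "(\<delta> powr b / \<delta>) powr \<eta> = \<delta> powr (- (\<eta> * (1 - b)))"
    proof -
      have "\<delta> powr b / \<delta> = \<delta> powr (b - 1)" using h(3) by (simp add: powr_diff)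
      then show ?thesis by (simp add: powr_powr algebra_simps)
    qed
    finally show "moment (reweight \<mu> (tri k - tri 0) C) (tri 0) B \<le> K * \<delta> powr (- (\<eta> * (1 - b))) *
      (gsum \<mu> (tri k) (cell 0 \<delta> \<pi>) B ^ tri 0 * gsum \<mu> (tri k) (cell 0 \<delta> \<pi>) C ^ (tri k - tri 0))"
      unfolding moment_reweight by (simp add: moment_def)
  qed
qed

text \<open>Hoelder's inequality separates \<open>B\<close> from \<open>C\<close>, and each is
  decoupled by itself. There is no gain here; the iteration starts from this estimate.\<close>

lemma bilinear_trivial:
  assumes "dec_exponent TYPE('i \<times> 'w) k \<eta>" "k \<ge> 1" "\<eta> \<ge> 0" "0 \<le> a" "a \<le> 1" "0 \<le> b" "b \<le> 1" "l \<le> k"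
  shows "bilinear TYPE('i \<times> 'w) k \<tau> l a b \<eta>"
proof -
  obtain K where K: "K \<ge> 1" and H: "local_bound TYPE('i \<times> 'w) K k \<eta>"
    by (rule moment_local_exponent[OF assms(1-3)])
  have KK: "1 \<le> K * K" using mult_mono[OF K K] K by simp
  have tl: "tri l \<le> tri k" using assms(8) by (rule tri_mono)
  show ?thesis
  proof (rule bilinearI[OF KK])
    fix \<Omega> :: "'w set" and f :: "'i \<Rightarrow> 'w \<Rightarrow> complex" and A \<mu> \<pi> and \<delta> :: real and B C
    assume h: "finite \<Omega>" "family.vin \<Omega> f \<mu> k \<pi> (\<delta> ^ k) A" "0 < \<delta>" "\<delta> \<le> 1"
      "B \<subseteq> A" "C \<subseteq> A" "diam_le \<pi> (\<delta> powr a) B" "diam_le \<pi> (\<delta> powr b) C"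
    interpret family \<Omega> f by unfold_locales (rule h(1))
    note v = vinD[OF h(2)]
    define G where "G = gsum \<mu> (tri k) (cell 0 \<delta> \<pi>)"
    have G0: "0 \<le> G D" for D unfolding G_def by (rule gsum_nonneg[OF v(2)])
    have loc: "moment \<mu> (tri k) D \<le> K * \<delta> powr (- \<eta>) * G D ^ tri k"
      if D: "D \<subseteq> A" "diam_le \<pi> (\<delta> powr c) D" "0 \<le> c" "c \<le> 1" for D c
    proof -
      have s1: "\<delta> powr c \<le> 1" using powr_mono'[of 0 c \<delta>] h(3,4) D by simp
      have "moment \<mu> (tri k) D \<le> K * (\<delta> powr c / \<delta>) powr \<eta> * G D ^ tri k"
        unfolding G_def
      proof (rule local_boundD[OF H h(2,3) _ s1 D(1,2)])
        show "\<delta> \<le> \<delta> powr c" using powr_mono'[of c 1 \<delta>] h(3,4) D by simp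
      qed
      also have "\<dots> \<le> K * (1 / \<delta>) powr \<eta> * G D ^ tri k"
        using s1 h(3) K G0 assms(3)
        by (intro mult_right_mono mult_left_mono powr_mono2 divide_right_mono) auto
      also have "(1 / \<delta>) powr \<eta> = \<delta> powr (- \<eta>)" using h(3) by (simp add: powr_minus_divide powr_divide)
      finally show ?thesis .
    qed
    define g where "g w = norm (F B w) ^ (2 * tri l) * norm (F C w) ^ (2 * (tri k - tri l))" for w
    have e: "tri l + (tri k - tri l) = tri k" using tl by simp
    have hold: "av \<mu> g ^ (tri l + (tri k - tri l)) \<le> moment \<mu> (tri k) B ^ tri l * moment \<mu> (tri k) C ^ (tri k - tri l)"
      unfolding moment_def
    proof (rule av_holder[OF v(2)])
      fix w
      show "g w ^ (tri l + (tri k - tri l)) \<le> (norm (F B w) ^ (2 * tri k)) ^ tri l * (norm (F C w) ^ (2 * tri k)) ^ (tri k - tri l)"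
        unfolding e g_def by (simp add: power_mult_distrib power_mult[symmetric] mult_ac)
    qed (use e tri_pos[OF assms(2)] in \<open>auto simp: g_def\<close>)
    have "av \<mu> g \<le> K * K * \<delta> powr (- ((real (tri l) * \<eta> + real (tri k - tri l) * \<eta>) / real (tri l + (tri k - tri l))))
       * (G B ^ tri l * G C ^ (tri k - tri l))"
    proof (rule power_interpolate[OF hold])
      show "moment \<mu> (tri k) B \<le> K * \<delta> powr (- \<eta>) * G B ^ tri k"
        by (rule loc[OF h(5,7)]) (use assms in auto)
      show "moment \<mu> (tri k) C \<le> K * \<delta> powr (- \<eta>) * G C ^ tri k"
        by (rule loc[OF h(6,8)]) (use assms in auto)
      show "(G B ^ tri l * G C ^ (tri k - tri l)) ^ (tri l + (tri k - tri l))
         = (G B ^ tri k) ^ tri l * (G C ^ tri k) ^ (tri k - tri l)"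
        unfolding e by (simp add: power_mult_distrib power_mult[symmetric] mult_ac)
    qed (use e tri_pos[OF assms(2)] K G0 h(3) in \<open>auto intro: moment_nonneg[OF v(2)]\<close>)
    also have "(real (tri l) * \<eta> + real (tri k - tri l) * \<eta>) / real (tri l + (tri k - tri l)) = \<eta>"
      using tl tri_pos[OF assms(2)] by (simp add: distrib_right[symmetric] of_nat_diff)
    finally show "moment (reweight \<mu> (tri k - tri l) C) (tri l) B \<le> K * K * \<delta> powr (- \<eta>) *
      (gsum \<mu> (tri k) (cell 0 \<delta> \<pi>) B ^ tri l * gsum \<mu> (tri k) (cell 0 \<delta> \<pi>) C ^ (tri k - tri l))"
      unfolding moment_reweight G_def g_def by simp
  qed
qed

text \<open>The exponents of the Hoelder step: (tri l, tri k - tri l) is the average of (tri (l -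
  1), tri k - tri (l - 1)) and (tri k - tri (k - l), tri (k - l)) with weights (k - l) / (k - l + 1)
  and 1 / (k - l + 1). In the second pair it is \<open>C\<close> that carries a lower critical
  exponent, the one of degree k - l.\<close>

lemma tri_interpolate:
  assumes "1 \<le> l" "l < k"
  shows "(k - l + 1) * tri l = (k - l) * tri (l - 1) + (tri k - tri (k - l))"
    and "(k - l + 1) * (tri k - tri l) = (k - l) * (tri k - tri (l - 1)) + tri (k - l)"
proof -
  obtain j where l: "l = Suc j" using assms(1) by (cases l) auto
  obtain m where k: "k = l + m" using assms(2) by (metis less_imp_add_positive)
  have T: "2 * int (tri n) = int n * (int n + 1)" for n
  proof -
    have "int (2 * tri n) = int (n * (n + 1))" by (simp only: two_tri)
    then show ?thesis by (simp add: algebra_simps)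
  qed
  have le: "tri m \<le> tri k" "tri l \<le> tri k" "tri j \<le> tri k" using k l by (auto intro: tri_mono)
  have "2 * (int (m + 1) * int (tri l)) = 2 * (int m * int (tri j) + (int (tri k) - int (tri m)))"
    using T[of l] T[of j] T[of k] T[of m] unfolding k l by (simp add: algebra_simps)
  then have 1: "int (m + 1) * int (tri l) = int m * int (tri j) + (int (tri k) - int (tri m))" by simp
  have "int ((m + 1) * tri l) = int (m * tri j + (tri k - tri m))"
    using 1 le by (simp add: of_nat_diff algebra_simps)
  then have a: "(m + 1) * tri l = m * tri j + (tri k - tri m)" by (simp only: of_nat_eq_iff)
  have "int ((m + 1) * (tri k - tri l)) = int (m * (tri k - tri j) + tri m)"
    unfolding of_nat_mult of_nat_add of_nat_diff[OF le(1)] of_nat_diff[OF le(2)] of_nat_diff[OF le(3)]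
    using 1 by (simp add: algebra_simps)
  then have b: "(m + 1) * (tri k - tri l) = m * (tri k - tri j) + tri m" by (simp only: of_nat_eq_iff)
  have e: "k - l = m" "l - 1 = j" using k l by auto
  show "(k - l + 1) * tri l = (k - l) * tri (l - 1) + (tri k - tri (k - l))" unfolding e using a .
  show "(k - l + 1) * (tri k - tri l) = (k - l) * (tri k - tri (l - 1)) + tri (k - l)" unfolding e using b .
qed

text \<open>The second estimate enters with \<open>B\<close> and \<open>C\<close> exchanged, hence
  with \<open>a\<close> and \<open>b\<close> exchanged. This is legitimate because separation is
  symmetric and the mixed moment does not depend on which factor is put into the weight.\<close>

lemma bilinear_holder:
  assumes 1: "bilinear TYPE('i \<times> 'w) k \<tau> (l - 1) a b \<beta>1" and 2: "bilinear TYPE('i \<times> 'w) k \<tau> (k - l) b a \<beta>2"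
    and l: "1 \<le> l" "l < k"
  shows "bilinear TYPE('i \<times> 'w) k \<tau> l a b ((real (k - l) * \<beta>1 + \<beta>2) / real (k - l + 1))"
proof -
  obtain K1 where K1: "K1 \<ge> 1" and H1: "bilinear_bound TYPE('i \<times> 'w) K1 k \<tau> (l - 1) a b \<beta>1"
    by (rule bilinearE[OF 1])
  obtain K2 where K2: "K2 \<ge> 1" and H2: "bilinear_bound TYPE('i \<times> 'w) K2 k \<tau> (k - l) b a \<beta>2"
    by (rule bilinearE[OF 2])
  have KK: "1 \<le> K1 * K2" using mult_mono[OF K1 K2] K1 by simp
  note ti = tri_interpolate[OF l]
  show ?thesis
  proof (rule bilinearI[OF KK])
    fix \<Omega> :: "'w set" and f :: "'i \<Rightarrow> 'w \<Rightarrow> complex" and A \<mu> \<pi> and \<delta> :: real and B C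
    assume h: "finite \<Omega>" "family.vin \<Omega> f \<mu> k \<pi> (\<delta> ^ k) A" "0 < \<delta>" "\<delta> \<le> 1"
      "B \<subseteq> A" "C \<subseteq> A" "diam_le \<pi> (\<delta> powr a) B" "diam_le \<pi> (\<delta> powr b) C"
    assume sep: "\<And>i j. i \<in> B \<Longrightarrow> j \<in> C \<Longrightarrow> \<tau> \<le> \<bar>\<pi> i - \<pi> j\<bar>"
    have sep': "\<tau> \<le> \<bar>\<pi> i - \<pi> j\<bar>" if "i \<in> C" "j \<in> B" for i j
      using sep[OF that(2,1)] by (simp add: abs_minus_commute)
    interpret family \<Omega> f by unfold_locales (rule h(1))
    note v = vinD[OF h(2)]
    define G where "G = gsum \<mu> (tri k) (cell 0 \<delta> \<pi>)"
    have G0: "0 \<le> G D" for D unfolding G_def by (rule gsum_nonneg[OF v(2)])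
    define g where "g q w = norm (F B w) ^ (2 * q) * norm (F C w) ^ (2 * (tri k - q))" for q w
    define q1 q2 q3 where "q1 = tri l" and "q2 = tri (l - 1)" and "q3 = tri k - tri (k - l)"
    have q3: "tri k - q3 = tri (k - l)" unfolding q3_def using tri_mono[of "k - l" k] by simp
    have qq: "(k - l + 1) * q1 = (k - l) * q2 + q3" "(k - l + 1) * (tri k - q1) = (k - l) * (tri k - q2) + (tri k - q3)"
      using ti unfolding q3 unfolding q1_def q2_def q3_def by auto
    have pw: "(x ^ q1 * y ^ (tri k - q1)) ^ (k - l + 1) = (x ^ q2 * y ^ (tri k - q2)) ^ (k - l) * (x ^ q3 * y ^ (tri k - q3)) ^ 1"
      for x y :: real
    proof -
      have "(x ^ q1 * y ^ (tri k - q1)) ^ (k - l + 1) = x ^ ((k - l + 1) * q1) * y ^ ((k - l + 1) * (tri k - q1))"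
        unfolding power_mult_distrib power_mult[symmetric] by (simp only: mult.commute)
      also have "\<dots> = (x ^ q2 * y ^ (tri k - q2)) ^ (k - l) * (x ^ q3 * y ^ (tri k - q3)) ^ 1"
        unfolding qq power_add power_mult_distrib power_mult[symmetric] by (simp add: mult_ac)
      finally show ?thesis .
    qed
    have m1: "moment (reweight \<mu> (tri k - tri (l - 1)) C) (tri (l - 1)) B = av \<mu> (g q2)"
      unfolding moment_reweight g_def q2_def ..
    have m2: "moment (reweight \<mu> (tri k - tri (k - l)) B) (tri (k - l)) C = av \<mu> (g q3)"
      unfolding moment_reweight g_def q3 unfolding q3_def by (simp add: mult.commute)
    have m3: "moment (reweight \<mu> (tri k - tri l) C) (tri l) B = av \<mu> (g q1)"
      unfolding moment_reweight g_def q1_def ..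
    have hold: "av \<mu> (g q1) ^ (k - l + 1) \<le> av \<mu> (g q2) ^ (k - l) * av \<mu> (g q3) ^ 1"
    proof (rule av_holder[OF v(2)])
      fix w
      have "g q w = (norm (F B w) ^ 2) ^ q * (norm (F C w) ^ 2) ^ (tri k - q)" for q
        unfolding g_def by (simp add: power_mult)
      then show "g q1 w ^ (k - l + 1) \<le> g q2 w ^ (k - l) * g q3 w ^ 1" using pw by simp
    qed (auto simp: g_def)
    have "av \<mu> (g q1) \<le> K1 * K2 * \<delta> powr (- ((real (k - l) * \<beta>1 + real 1 * \<beta>2) / real (k - l + 1)))
       * (G B ^ q1 * G C ^ (tri k - q1))"
    proof (rule power_interpolate[OF hold])
      show "av \<mu> (g q2) \<le> K1 * \<delta> powr (- \<beta>1) * (G B ^ q2 * G C ^ (tri k - q2))"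
        using bilinear_boundD[OF H1 h(2-8) sep] unfolding m1 G_def q2_def .
      show "av \<mu> (g q3) \<le> K2 * \<delta> powr (- \<beta>2) * (G B ^ q3 * G C ^ (tri k - q3))"
        using bilinear_boundD[OF H2 h(2-4,6,5,8,7) sep'] unfolding m2 G_def q3 unfolding q3_def by (simp add: mult_ac)
      show "(G B ^ q1 * G C ^ (tri k - q1)) ^ (k - l + 1)
         = (G B ^ q2 * G C ^ (tri k - q2)) ^ (k - l) * (G B ^ q3 * G C ^ (tri k - q3)) ^ 1"
        by (rule pw)
    qed (use K1 K2 G0 h(3) in \<open>auto intro!: av_nonneg[OF v(2)] simp: g_def\<close>)
    then show "moment (reweight \<mu> (tri k - tri l) C) (tri l) B \<le>
      K1 * K2 * \<delta> powr (- ((real (k - l) * \<beta>1 + \<beta>2) / real (k - l + 1))) *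
      (gsum \<mu> (tri k) (cell 0 \<delta> \<pi>) B ^ tri l * gsum \<mu> (tri k) (cell 0 \<delta> \<pi>) C ^ (tri k - tri l))"
      unfolding m3 G_def q1_def by simp
  qed
qed

section \<open>Decoupling for locally lower-degree systems\<close>

text \<open>
  Uses the antiderivative \<open>H\<close> of \<open>x^m (x - 1)^l\<close>, which differs from \<open>H 1\<close> by \<open>O(\<bar>x - 1\<bar>^(l + 1))\<close>
  and whose lowest monomial is a nonzero multiple of \<open>x^(m + 1)\<close>.
\<close>

lemma lowest_monomial_approx:
  fixes U :: real
  assumes "U \<ge> 0"
  obtains e g K where "K \<ge> 0" "\<And>u. \<bar>u\<bar> \<le> U \<Longrightarrow>
    \<bar>e + (\<Sum>j\<in>{1..l}. g j * (1 + u) ^ (Suc m + j)) - (1 + u) ^ (Suc m)\<bar> \<le> K * \<bar>u\<bar> ^ (l + 1)"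
proof -
  define b where "b i = real (l choose i) * (-1) ^ (l - i)" for i
  define H where "H x = (\<Sum>i\<le>l. b i * x ^ (m + i + 1) / real (m + i + 1))" for x :: real
  \<comment> \<open>The coefficient of x^(m + 1) in \<open>H\<close> is (-1)^l / (m + 1);
    \<open>s\<close> normalises it to 1.\<close>
  define s where "s = real (Suc m) * (-1) ^ l"
  have b0: "b 0 = (-1) ^ l" by (simp add: b_def)
  have deriv: "(H has_field_derivative (x ^ m * (x - 1) ^ l)) (at x within S)" for x S
  proof -
    have "(H has_field_derivative (\<Sum>i\<le>l. b i * x ^ (m + i))) (at x within S)"
      unfolding H_def by (rule derivative_eq_intros refl | simp)+ (simp add: field_simps)
    also have "(\<Sum>i\<le>l. b i * x ^ (m + i)) = x ^ m * (x - 1) ^ l"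
      using binomial_ring[of x "-1" l] by (simp add: b_def power_add sum_distrib_left mult_ac)
    finally show ?thesis .
  qed
  have bnd: "\<bar>H (1 + u) - H 1\<bar> \<le> (1 + U) ^ m * \<bar>u\<bar> ^ l * \<bar>u\<bar>" if u: "\<bar>u\<bar> \<le> U" for u
  proof -
    have "norm (H (1 + u) - H 1) \<le> ((1 + U) ^ m * \<bar>u\<bar> ^ l) * norm ((1 + u) - 1)"
    proof (rule field_differentiable_bound[of "{1 - \<bar>u\<bar>..1 + \<bar>u\<bar>}" H "\<lambda>x. x ^ m * (x - 1) ^ l"])
      fix z assume z: "z \<in> {1 - \<bar>u\<bar>..1 + \<bar>u\<bar>}"
      have "\<bar>z\<bar> \<le> 1 + U" "\<bar>z - 1\<bar> \<le> \<bar>u\<bar>" using z u by auto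
      then show "norm (z ^ m * (z - 1) ^ l) \<le> (1 + U) ^ m * \<bar>u\<bar> ^ l"
        unfolding real_norm_def abs_mult power_abs using assms
        by (intro mult_mono power_mono) auto
    qed (auto intro: deriv)
    then show ?thesis by simp
  qed
  show thesis
  proof (rule that[of "\<bar>s\<bar> * (1 + U) ^ m" "s * H 1" "\<lambda>j. - s * b j / real (m + j + 1)"])
    show "0 \<le> \<bar>s\<bar> * (1 + U) ^ m" using assms by simp
  next
    fix u :: real assume u: "\<bar>u\<bar> \<le> U"
    have "{..l} = insert 0 {1..l}" by auto
    then have "H (1 + u) = b 0 * (1 + u) ^ (Suc m) / real (Suc m)
        + (\<Sum>i\<in>{1..l}. b i * (1 + u) ^ (m + i + 1) / real (m + i + 1))"
      unfolding H_def by simp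
    then have "s * H (1 + u) = s * (b 0 * (1 + u) ^ (Suc m) / real (Suc m))
        + s * (\<Sum>i\<in>{1..l}. b i * (1 + u) ^ (m + i + 1) / real (m + i + 1))"
      by (simp only: distrib_left)
    also have "s * (b 0 * (1 + u) ^ (Suc m) / real (Suc m)) = (1 + u) ^ (Suc m)"
    proof -
      have "s * b 0 = real (Suc m)" unfolding s_def b0 by (simp add: power_mult_distrib[symmetric])
      then have "s * (b 0 * (1 + u) ^ (Suc m) / real (Suc m)) = real (Suc m) * (1 + u) ^ (Suc m) / real (Suc m)"
        by (metis mult.assoc times_divide_eq_right)
      then show ?thesis by (simp del: of_nat_Suc power_Suc)
    qed
    finally have eH: "s * H (1 + u) = (1 + u) ^ (Suc m)
        + s * (\<Sum>i\<in>{1..l}. b i * (1 + u) ^ (m + i + 1) / real (m + i + 1))" .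
    have "(\<Sum>j\<in>{1..l}. - s * b j / real (m + j + 1) * (1 + u) ^ (Suc m + j))
        = - (s * (\<Sum>i\<in>{1..l}. b i * (1 + u) ^ (m + i + 1) / real (m + i + 1)))"
      unfolding sum_distrib_left sum_negf[symmetric] by (intro sum.cong refl) simp
    with eH have "s * H 1 + (\<Sum>j\<in>{1..l}. - s * b j / real (m + j + 1) * (1 + u) ^ (Suc m + j)) - (1 + u) ^ (Suc m)
      = - (s * (H (1 + u) - H 1))"
      by (simp only: right_diff_distrib)
    then have "\<bar>s * H 1 + (\<Sum>j\<in>{1..l}. - s * b j / real (m + j + 1) * (1 + u) ^ (Suc m + j)) - (1 + u) ^ (Suc m)\<bar>
      = \<bar>s\<bar> * \<bar>H (1 + u) - H 1\<bar>" by (simp only: abs_minus_cancel abs_mult)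
    also have "\<dots> \<le> \<bar>s\<bar> * ((1 + U) ^ m * \<bar>u\<bar> ^ l * \<bar>u\<bar>)" by (intro mult_left_mono bnd[OF u]) simp
    finally show "\<bar>s * H 1 + (\<Sum>j\<in>{1..l}. - s * b j / real (m + j + 1) * (1 + u) ^ (Suc m + j)) - (1 + u) ^ (Suc m)\<bar>
      \<le> \<bar>s\<bar> * (1 + U) ^ m * \<bar>u\<bar> ^ (l + 1)" by (simp add: mult_ac)
  qed
qed

text \<open>Induction on m. For m = 0 the binomial expansion of ((1 + u) - 1)^i is exact. In the
  step only the lowest power (1 + u)^(m + 1) has to go, and \<open>lowest_monomial_approx\<close>
  replaces it by the l next ones within the allowed error. The constant \<open>d\<close> will cancel
  when two tuples of equal length are compared.\<close>

lemma power_approx_by_high_powers: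
  fixes U :: real
  assumes "U \<ge> 0" "1 \<le> i" "i \<le> l"
  shows "\<exists>d c K. K \<ge> 0 \<and> (\<forall>u. \<bar>u\<bar> \<le> U \<longrightarrow>
    \<bar>d + (\<Sum>j\<in>{1..l}. c j * (1 + u) ^ (m + j)) - u ^ i\<bar> \<le> K * \<bar>u\<bar> ^ (l + 1))"
proof (induction m)
  case 0
  define c where "c j = real (i choose j) * (-1) ^ (i - j)" for j
  have "c 0 + (\<Sum>j\<in>{1..l}. c j * (1 + u) ^ (0 + j)) - u ^ i = 0" for u :: real
  proof -
    have "u ^ i = (\<Sum>j\<le>i. c j * (1 + u) ^ j)"
      using binomial_ring[of "1 + u" "-1" i] by (simp add: c_def mult_ac)
    also have "\<dots> = (\<Sum>j\<le>l. c j * (1 + u) ^ j)"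
      using assms by (intro sum.mono_neutral_left) (auto simp: c_def)
    also have "{..l} = insert 0 {1..l}" by auto
    finally show ?thesis by simp
  qed
  then have "\<bar>c 0 + (\<Sum>j\<in>{1..l}. c j * (1 + u) ^ (0 + j)) - u ^ i\<bar> \<le> 0 * \<bar>u\<bar> ^ (l + 1)" for u :: real
    by (simp only: abs_zero mult_zero_left order_refl)
  then show ?case by blast
next
  case (Suc m)
  then obtain d c K where K: "K \<ge> 0" "\<And>u. \<bar>u\<bar> \<le> U \<Longrightarrow>
    \<bar>d + (\<Sum>j\<in>{1..l}. c j * (1 + u) ^ (m + j)) - u ^ i\<bar> \<le> K * \<bar>u\<bar> ^ (l + 1)" by blast
  obtain e g K' where K': "K' \<ge> 0" "\<And>u. \<bar>u\<bar> \<le> U \<Longrightarrow>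
    \<bar>e + (\<Sum>j\<in>{1..l}. g j * (1 + u) ^ (Suc m + j)) - (1 + u) ^ (Suc m)\<bar> \<le> K' * \<bar>u\<bar> ^ (l + 1)"
    using lowest_monomial_approx[OF assms(1), where l = l and m = m] by metis
  \<comment> \<open>The old coefficients from the second on move down by one index, and
    \<open>c 1\<close> is spread over the new powers through \<open>g\<close>. The last index
    receives nothing from the shift.\<close>
  define c' where "c' j = (if j < l then c (Suc j) else 0) + c 1 * g j" for j
  show ?case
  proof (rule exI[of _ "d + c 1 * e"], rule exI[of _ c'], rule exI[of _ "K + \<bar>c 1\<bar> * K'"], intro conjI allI impI)
    fix u :: real assume u: "\<bar>u\<bar> \<le> U"
    define a1 where "a1 = d + (\<Sum>j\<in>{1..l}. c j * (1 + u) ^ (m + j)) - u ^ i"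
    define a2 where "a2 = e + (\<Sum>j\<in>{1..l}. g j * (1 + u) ^ (Suc m + j)) - (1 + u) ^ (Suc m)"
    obtain l' where l': "l = Suc l'" using assms by (cases l) auto
    have "(\<Sum>j\<in>{1..l}. c j * (1 + u) ^ (m + j))
        = c 1 * (1 + u) ^ (Suc m) + (\<Sum>j\<in>{2..l}. c j * (1 + u) ^ (m + j))"
    proof -
      have "{1..l} = insert 1 {2..l}" using l' by auto
      then show ?thesis by simp
    qed
    also have "(\<Sum>j\<in>{2..l}. c j * (1 + u) ^ (m + j)) = (\<Sum>j\<in>{1..l'}. c (Suc j) * (1 + u) ^ (Suc m + j))"
      unfolding l' using sum.shift_bounds_cl_Suc_ivl[of "\<lambda>j. c j * (1 + u) ^ (m + j)" 1 l'] by (simp add: numeral_2_eq_2)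
    also have "\<dots> = (\<Sum>j\<in>{1..l}. (if j < l then c (Suc j) else 0) * (1 + u) ^ (Suc m + j))"
      unfolding l' by simp
    finally have e1: "(\<Sum>j\<in>{1..l}. c j * (1 + u) ^ (m + j)) = c 1 * (1 + u) ^ (Suc m)
      + (\<Sum>j\<in>{1..l}. (if j < l then c (Suc j) else 0) * (1 + u) ^ (Suc m + j))" .
    have e2: "(\<Sum>j\<in>{1..l}. c' j * (1 + u) ^ (Suc m + j)) =
      (\<Sum>j\<in>{1..l}. (if j < l then c (Suc j) else 0) * (1 + u) ^ (Suc m + j))
      + c 1 * (\<Sum>j\<in>{1..l}. g j * (1 + u) ^ (Suc m + j))"
      unfolding c'_def by (simp only: distrib_right sum.distrib sum_distrib_left mult.assoc)
    have "d + c 1 * e + (\<Sum>j\<in>{1..l}. c' j * (1 + u) ^ (Suc m + j)) - u ^ i = a1 + c 1 * a2"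
      unfolding a1_def a2_def e1 e2 by (simp add: algebra_simps)
    also have "\<bar>\<dots>\<bar> \<le> \<bar>a1\<bar> + \<bar>c 1\<bar> * \<bar>a2\<bar>" using abs_triangle_ineq[of a1 "c 1 * a2"] by (simp only: abs_mult)
    also have "\<dots> \<le> K * \<bar>u\<bar> ^ (l + 1) + \<bar>c 1\<bar> * (K' * \<bar>u\<bar> ^ (l + 1))"
      using K(2)[OF u] K'(2)[OF u] unfolding a1_def a2_def by (intro add_mono mult_left_mono) auto
    finally show "\<bar>d + c 1 * e + (\<Sum>j\<in>{1..l}. c' j * (1 + u) ^ (Suc m + j)) - u ^ i\<bar> \<le> (K + \<bar>c 1\<bar> * K') * \<bar>u\<bar> ^ (l + 1)"
      by (simp only: distrib_right mult.assoc)
  qed (use K K' in auto)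
qed

lemma psum_combination:
  assumes "\<And>i. i \<in> set xs \<Longrightarrow> \<bar>d + (\<Sum>j\<in>J. c j * \<phi> i ^ (m + j)) - \<psi> i ^ n\<bar> \<le> e"
  shows "\<bar>d * real (length xs) + (\<Sum>j\<in>J. c j * psum \<phi> (m + j) xs) - psum \<psi> n xs\<bar> \<le> real (length xs) * e"
  using assms
proof (induction xs)
  case (Cons i xs)
  have "d * real (length (i # xs)) + (\<Sum>j\<in>J. c j * psum \<phi> (m + j) (i # xs)) - psum \<psi> n (i # xs)
    = (d + (\<Sum>j\<in>J. c j * \<phi> i ^ (m + j)) - \<psi> i ^ n)
      + (d * real (length xs) + (\<Sum>j\<in>J. c j * psum \<phi> (m + j) xs) - psum \<psi> n xs)"
    by (simp add: algebra_simps sum.distrib)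
  also have "\<bar>\<dots>\<bar> \<le> e + real (length xs) * e"
    using Cons.prems[of i] Cons.IH Cons.prems by (intro order_trans[OF abs_triangle_ineq] add_mono) auto
  finally show ?case by (simp add: algebra_simps)
qed simp

section \<open>Systems of lower degree that hold only locally\<close>

context family
begin

text \<open>The two errors have different origins: \<open>\<rho>\<close> comes from the variables
  hidden in the weight, and \<open>\<sigma> ^ (l + 1)\<close> is a Taylor remainder of order l at
  distance \<sigma> from \<open>\<pi> i0\<close>. The second one forces the restriction to tuples
  near a point.\<close>

definition local_system :: "('w \<Rightarrow> real) \<Rightarrow> nat \<Rightarrow> ('i \<Rightarrow> real) \<Rightarrow> real \<Rightarrow> real \<Rightarrow> 'i set \<Rightarrow> bool" where
  "local_system \<nu> l \<pi> K \<rho> A \<longleftrightarrow> finite A \<and> wt \<nu> \<and> positive \<nu> (tri l) A \<and>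
     (\<forall>i0\<in>A. \<forall>\<sigma>. 0 < \<sigma> \<longrightarrow> \<sigma> \<le> 1 \<longrightarrow> (\<forall>xs\<in>tup A (tri l). \<forall>ys\<in>tup A (tri l).
        (\<forall>i\<in>set xs \<union> set ys. \<bar>\<pi> i - \<pi> i0\<bar> \<le> \<sigma>) \<longrightarrow> corr \<nu> xs ys \<noteq> 0 \<longrightarrow>
        (\<forall>j\<in>{1..l}. \<bar>psum (\<lambda>i. \<pi> i - \<pi> i0) j xs - psum (\<lambda>i. \<pi> i - \<pi> i0) j ys\<bar> \<le> K * (\<rho> + \<sigma> ^ (l + 1)))))"

lemma nm_le:
  assumes "wt \<mu>" "moment \<mu> r B \<le> c * G ^ r" "r \<ge> 1" "0 \<le> c" "0 \<le> G"
  shows "nm \<mu> r B \<le> root r c * G"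
proof -
  have "nm \<mu> r B \<le> root r (c * G ^ r)" unfolding nm_def using assms by simp
  also have "\<dots> = root r c * G" using assms by (simp add: real_root_mult real_root_power_cancel)
  finally show ?thesis .
qed

text \<open>Decoupling in two steps, from \<open>B\<close> to length \<open>h\<close> and from there
  to \<open>h'\<close>. The finer step may use another weight and another exponent, which permits
  the passage from the reweighted problem of degree l back to the original one of degree k. The
  factor 3 per power is the overlap of the two grids.\<close>

lemma moment_chain:
  assumes "wt \<nu>" "r \<ge> 1" "0 \<le> c1" "0 \<le> c2" "finite A" "B \<subseteq> A"
    and 1: "moment \<nu> r B \<le> c1 * gsum \<nu> r (cell 0 h \<pi>) B ^ r"
    and 2: "\<And>n. moment \<nu> r {i\<in>B. cell 0 h \<pi> i = n} \<le> c2 * gsum \<mu> q (cell 0 h' \<pi>) {i\<in>B. cell 0 h \<pi> i = n} ^ r"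
    and mu: "wt \<mu>" "positive \<mu> q A" "q \<ge> 1" and h: "0 < h'" "h' \<le> h"
  shows "moment \<nu> r B \<le> c1 * c2 * 3 ^ r * gsum \<mu> q (cell 0 h' \<pi>) B ^ r"
proof -
  have "gsum \<nu> r (cell 0 h \<pi>) B \<le> (\<Sum>n\<in>cell 0 h \<pi> ` B. root r c2 * gsum \<mu> q (cell 0 h' \<pi>) {i\<in>B. cell 0 h \<pi> i = n})"
    unfolding gsum_def[of \<nu>] by (intro sum_mono nm_le[OF assms(1) 2 assms(2,4)] gsum_nonneg mu)
  also have "\<dots> \<le> root r c2 * (3 * gsum \<mu> q (cell 0 h' \<pi>) B)"
    unfolding sum_distrib_left[symmetric]
    by (intro mult_left_mono gsum_cell_superadditive[OF mu(2) assms(6,5) mu(3,1)]) (use h assms(2,4) in auto)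
  finally have "gsum \<nu> r (cell 0 h \<pi>) B ^ r \<le> (root r c2 * (3 * gsum \<mu> q (cell 0 h' \<pi>) B)) ^ r"
    by (rule power_mono) (rule gsum_nonneg[OF assms(1)])
  also have "\<dots> = c2 * 3 ^ r * gsum \<mu> q (cell 0 h' \<pi>) B ^ r"
    using assms(2,4) by (simp add: power_mult_distrib)
  finally have "c1 * gsum \<nu> r (cell 0 h \<pi>) B ^ r \<le> c1 * (c2 * 3 ^ r * gsum \<mu> q (cell 0 h' \<pi>) B ^ r)"
    by (rule mult_left_mono) (rule assms(3))
  then show ?thesis using 1 by (simp add: mult.assoc)
qed

end

lemma powr_neg_antimono: "0 < x \<Longrightarrow> x \<le> y \<Longrightarrow> 0 \<le> e \<Longrightarrow> y powr (- e) \<le> x powr (- e)" for x y e :: real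
  using powr_mono2'[of "- e" x y] by simp

text \<open>
  On an interval of length \<open>\<sigma>\<close> the system is a degree \<open>l\<close> Vinogradov system up to an error
  \<open>\<sigma>^(l + 1)\<close>, so decoupling in degree \<open>l\<close> reaches intervals of length \<open>\<sigma>^((l + 1) / l)\<close>.
\<close>

lemma local_decoupling:
  assumes dec: "\<And>\<epsilon>. \<epsilon> > 0 \<Longrightarrow> dec_exponent TYPE('i \<times> 'w) l \<epsilon>" and l: "1 \<le> l" and Kc: "1 \<le> Kc" and "\<epsilon> > 0"
  shows "\<exists>K\<ge>1. \<forall>(\<Omega> :: 'w set) (f :: 'i \<Rightarrow> 'w \<Rightarrow> complex) \<nu> \<pi> A B R.
    finite \<Omega> \<longrightarrow> family.local_system \<Omega> f \<nu> l \<pi> Kc (R ^ l) A \<longrightarrow> 0 < R \<longrightarrow> R \<le> 1 \<longrightarrow>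
    B \<subseteq> A \<longrightarrow> diam_le \<pi> (R powr ((real l / real (l + 1)) ^ m)) B \<longrightarrow>
    family.moment \<Omega> f \<nu> (tri l) B \<le> K * R powr (- \<epsilon>) * family.gsum \<Omega> f \<nu> (tri l) (cell 0 R \<pi>) B ^ tri l"
  using \<open>\<epsilon> > 0\<close>
proof (induction m arbitrary: \<epsilon>)
  case 0
  show ?case
  proof (intro exI[of _ "(3\<^sup>2) ^ tri l"] conjI allI impI)
    fix \<Omega> :: "'w set" and f :: "'i \<Rightarrow> 'w \<Rightarrow> complex" and \<nu> \<pi> A B and R :: real
    assume h: "finite \<Omega>" "family.local_system \<Omega> f \<nu> l \<pi> Kc (R ^ l) A" "0 < R" "R \<le> 1" "B \<subseteq> A"
      "diam_le \<pi> (R powr ((real l / real (l + 1)) ^ 0)) B"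
    interpret family \<Omega> f by unfold_locales (rule h(1))
    have s: "finite A" "wt \<nu>" using h(2) unfolding local_system_def by auto
    have "moment \<nu> (tri l) B \<le> ((R / R + 2)\<^sup>2) ^ tri l * gsum \<nu> (tri l) (cell 0 R \<pi>) B ^ tri l"
      by (rule moment_trivial[OF finite_subset[OF h(5) s(1)] tri_pos[OF l] s(2)]) (use h in auto)
    also have "\<dots> = (3\<^sup>2) ^ tri l * 1 * gsum \<nu> (tri l) (cell 0 R \<pi>) B ^ tri l" using h by simp
    also have "\<dots> \<le> (3\<^sup>2) ^ tri l * R powr (- \<epsilon>) * gsum \<nu> (tri l) (cell 0 R \<pi>) B ^ tri l"
      using powr_neg_antimono[of R 1 \<epsilon>] h 0
      by (intro mult_right_mono mult_left_mono zero_le_power gsum_nonneg s) auto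
    finally show "moment \<nu> (tri l) B \<le> (3\<^sup>2) ^ tri l * R powr (- \<epsilon>) * gsum \<nu> (tri l) (cell 0 R \<pi>) B ^ tri l" .
  qed simp
next
  case (Suc m)
  define T where "T = tri l"
  have T1: "T \<ge> 1" unfolding T_def by (rule tri_pos[OF l])
  define q where "q = (real l / real (l + 1)) ^ m"
  have q: "0 < q" "q \<le> 1" unfolding q_def using l by (auto intro!: power_le_one)
  \<comment> \<open>The starting length is \<sigma> = R^p and the intermediate one is H = R^q. The
    relation (l + 1) p = l q says \<sigma>^(l + 1) = H^l: the Taylor remainder on the long interval
    is the error tolerated at length H.\<close>
  define p where "p = (real l / real (l + 1)) ^ Suc m"
  have pq: "real (l + 1) * p = q * real l" unfolding p_def q_def power_Suc using l by simp
  have p: "0 < p" unfolding p_def using l by simp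
  \<comment> \<open>One half of \<epsilon> pays for reaching length H, the other half for the
    induction hypothesis, which leads from H to R.\<close>
  have e2: "\<epsilon> / 2 > 0" using Suc.prems by simp
  obtain K2 where K2: "K2 \<ge> 1" "\<forall>(\<Omega> :: 'w set) (f :: 'i \<Rightarrow> 'w \<Rightarrow> complex) \<nu> \<pi> A B R.
    finite \<Omega> \<longrightarrow> family.local_system \<Omega> f \<nu> l \<pi> Kc (R ^ l) A \<longrightarrow> 0 < R \<longrightarrow> R \<le> 1 \<longrightarrow>
    B \<subseteq> A \<longrightarrow> diam_le \<pi> (R powr q) B \<longrightarrow>
    family.moment \<Omega> f \<nu> T B \<le> K2 * R powr (- (\<epsilon>/2)) * family.gsum \<Omega> f \<nu> T (cell 0 R \<pi>) B ^ T"
    using Suc.IH[OF e2] unfolding q_def T_def by blast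
  obtain K0 where K0: "K0 \<ge> 1" "\<And>\<delta>. 0 < \<delta> \<Longrightarrow> \<delta> \<le> 1 \<Longrightarrow> decoupling TYPE('i \<times> 'w) l \<delta> (K0 * \<delta> powr (- (\<epsilon>/2)))"
    using dec[OF e2] unfolding dec_exponent_def by blast
  \<comment> \<open>Both R^l and \<sigma>^(l + 1) are at most H^l, so the total error is at most
    \<open>K3 * H ^ l\<close>.\<close>
  define K3 where "K3 = 2 * Kc"
  have K3: "K3 \<ge> 1" "K3 \<ge> 0" "K3 > 0" unfolding K3_def using Kc by auto
  define c where "c = (K3 + 2)\<^sup>2 * 3"
  have "(K3 + 2)\<^sup>2 \<ge> 1" using K3 by (intro one_le_power) auto
  then have c1: "c \<ge> 1" unfolding c_def by linarith
  define K1 where "K1 = K0 * c ^ T"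
  have K1: "K1 \<ge> 1" "K1 \<ge> c ^ T" unfolding K1_def using K0(1) c1 mult_mono[of 1 K0 1 "c ^ T"] mult_mono[of 1 K0 "c ^ T" "c ^ T"] one_le_power[OF c1, of T]
    by auto
  show ?case
  proof (intro exI[of _ "K1 * K2 * 3 ^ T"] conjI allI impI)
    have "1 \<le> K1 * K2" using mult_mono[of 1 K1 1 K2] K1(1) K2(1) by simp
    then show "1 \<le> K1 * K2 * 3 ^ T" using mult_mono[of 1 "K1 * K2" 1 "3 ^ T"] by simp
  next
    fix \<Omega> :: "'w set" and f :: "'i \<Rightarrow> 'w \<Rightarrow> complex" and \<nu> \<pi> A B and R :: real
    assume h: "finite \<Omega>" "family.local_system \<Omega> f \<nu> l \<pi> Kc (R ^ l) A" "0 < R" "R \<le> 1" "B \<subseteq> A"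
    assume "diam_le \<pi> (R powr ((real l / real (l + 1)) ^ Suc m)) B"
    then have dB: "diam_le \<pi> (R powr p) B" unfolding p_def .
    interpret family \<Omega> f by unfold_locales (rule h(1))
    have s: "finite A" "wt \<nu>" "positive \<nu> T A" using h(2) unfolding local_system_def T_def by auto
    have finB: "finite B" by (rule finite_subset[OF h(5) s(1)])
    define \<sigma> where "\<sigma> = R powr p"
    define H where "H = R powr q"
    have sig: "0 < \<sigma>" "\<sigma> \<le> 1" unfolding \<sigma>_def using h p powr_mono'[of 0 p R] by auto
    have H: "0 < H" "R \<le> H" unfolding H_def using h q powr_mono'[of q 1 R] by auto
    have sH: "\<sigma> ^ (l + 1) = H ^ l"
    proof -
      have "\<sigma> ^ (l + 1) = R powr (real (l + 1) * p)" unfolding \<sigma>_def by (rule powr_power) (use h in simp)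
      also have "\<dots> = R powr (real l * q)" unfolding pq by (simp only: mult.commute)
      also have "\<dots> = H ^ l" unfolding H_def using h by (subst powr_power) auto
      finally show ?thesis .
    qed
    have RH: "R ^ l \<le> H ^ l" using H h by (intro power_mono) auto
    have G0: "0 \<le> gsum \<nu> T \<kappa> D" for \<kappa> D by (rule gsum_nonneg[OF s(2)])
    have Re: "1 \<le> R powr (- (\<epsilon>/2))" using powr_neg_antimono[of R 1 "\<epsilon>/2"] h e2 by simp
    have 1: "moment \<nu> T B \<le> K1 * R powr (- (\<epsilon>/2)) * gsum \<nu> T (cell 0 H \<pi>) B ^ T"
    proof (cases "B = {}")
      case True
      then show ?thesis using T1 G0 K1 by (simp add: moment_empty)
    next
      case False
      then obtain i0 where i0: "i0 \<in> B" by auto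
      \<comment> \<open>Chosen so that \<sigma>^l \<delta>^l = K3^l H^l, which dominates the error
        because K3 \<ge> 1.\<close>
      define \<delta> where "\<delta> = K3 * H / \<sigma>"
      have d0: "0 < \<delta>" unfolding \<delta>_def using K3 H sig by simp
      show ?thesis
      proof (cases "\<delta> \<le> 1")
        case True
        have "moment \<nu> (tri l) B \<le> K0 * \<delta> powr (- (\<epsilon>/2)) * gsum \<nu> (tri l) (cell (\<pi> i0) (\<sigma> * \<delta>) \<pi>) B ^ tri l"
        proof (rule moment_rescale[OF K0(2)[OF d0 True] sig(1)])
          fix xs ys j assume xy: "xs \<in> tup B (tri l)" "ys \<in> tup B (tri l)" "corr \<nu> xs ys \<noteq> 0" "j \<in> {1..l}"
          have i0A: "i0 \<in> A" using i0 h(5) by auto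
          have xyA: "xs \<in> tup A (tri l)" "ys \<in> tup A (tri l)" using xy(1,2) h(5) by auto
          have near: "\<forall>i\<in>set xs \<union> set ys. \<bar>\<pi> i - \<pi> i0\<bar> \<le> \<sigma>"
            using dB xy(1,2) i0 unfolding diam_le_def \<sigma>_def by auto
          have "\<bar>psum (\<lambda>i. \<pi> i - \<pi> i0) j xs - psum (\<lambda>i. \<pi> i - \<pi> i0) j ys\<bar> \<le> Kc * (R ^ l + \<sigma> ^ (l + 1))"
            using h(2) i0A sig xyA near xy(3,4) unfolding local_system_def by blast
          also have "\<dots> \<le> K3 * H ^ l" unfolding sH K3_def using RH Kc
            mult_left_mono[of "R ^ l + H ^ l" "H ^ l + H ^ l" Kc] by simp
          also have "\<dots> \<le> K3 ^ l * H ^ l" using K3 l H self_le_power[of K3 l] by (intro mult_right_mono) auto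
          also have "\<dots> = \<sigma> ^ l * \<delta> ^ l" unfolding \<delta>_def using sig by (simp add: power_divide power_mult_distrib)
          also have "\<dots> \<le> \<sigma> ^ j * \<delta> ^ l" using sig d0 xy(4) by (intro mult_right_mono power_decreasing) auto
          finally show "\<bar>psum (\<lambda>i. \<pi> i - \<pi> i0) j xs - psum (\<lambda>i. \<pi> i - \<pi> i0) j ys\<bar> \<le> \<sigma> ^ j * \<delta> ^ l" .
        qed (use s finB i0 dB positive_subset[OF s(3) h(5)] in \<open>auto simp: T_def \<sigma>_def\<close>)
        also have "\<sigma> * \<delta> = K3 * H" unfolding \<delta>_def using sig by simp
        also have "K0 * \<delta> powr (- (\<epsilon>/2)) * gsum \<nu> (tri l) (cell (\<pi> i0) (K3 * H) \<pi>) B ^ tri l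
          \<le> K0 * R powr (- (\<epsilon>/2)) * (c * gsum \<nu> T (cell 0 H \<pi>) B) ^ T"
          unfolding T_def[symmetric]
        proof (intro mult_mono power_mono)
          have "R \<le> \<delta>"
          proof -
            have "R * \<sigma> \<le> H * 1" using H sig h by (intro mult_mono) auto
            also have "\<dots> \<le> K3 * H" using K3 H mult_right_mono[of 1 K3 H] by simp
            finally show ?thesis unfolding \<delta>_def using sig by (simp add: field_simps)
          qed
          then show "\<delta> powr (- (\<epsilon>/2)) \<le> R powr (- (\<epsilon>/2))" using h e2 by (intro powr_neg_antimono) auto
          have "gsum \<nu> T (cell (\<pi> i0) (K3 * H) \<pi>) B \<le> (K3 * H / H + 2)\<^sup>2 * (H / (K3 * H) + 2) * gsum \<nu> T (cell 0 H \<pi>) B"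
            by (rule gsum_cell_le[OF s(3) h(5) s(1) T1 s(2)]) (use K3 H in auto)
          also have "\<dots> = (K3 + 2)\<^sup>2 * (1 / K3 + 2) * gsum \<nu> T (cell 0 H \<pi>) B"
            using K3 H by simp
          also have "\<dots> \<le> c * gsum \<nu> T (cell 0 H \<pi>) B"
            unfolding c_def using K3 by (intro mult_right_mono mult_left_mono G0) auto
          finally show "gsum \<nu> T (cell (\<pi> i0) (K3 * H) \<pi>) B \<le> c * gsum \<nu> T (cell 0 H \<pi>) B" .
        qed (use K0 G0 in auto)
        finally show ?thesis unfolding K1_def T_def by (simp add: power_mult_distrib mult_ac)
      next
        \<comment> \<open>Here the interval is not much longer than \<open>H\<close>: at most K3 + 2
          cells meet \<open>B\<close>, and the triangle inequality suffices.\<close>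
        case False
        then have "\<sigma> \<le> K3 * H" unfolding \<delta>_def using sig by (simp add: field_simps)
        then have dd: "diam_le \<pi> (K3 * H) B" using dB unfolding \<sigma>_def by (rule diam_le_mono[rotated])
        have "moment \<nu> T B \<le> ((K3 * H / H + 2)\<^sup>2) ^ T * gsum \<nu> T (cell 0 H \<pi>) B ^ T"
          by (rule moment_trivial[OF finB T1 s(2) dd]) (use K3 H in auto)
        also have "\<dots> \<le> (c ^ T * R powr (- (\<epsilon>/2))) * gsum \<nu> T (cell 0 H \<pi>) B ^ T"
        proof (intro mult_right_mono zero_le_power G0)
          have "(K3 * H / H + 2)\<^sup>2 \<le> c" unfolding c_def using H by simp
          then have "((K3 * H / H + 2)\<^sup>2) ^ T \<le> c ^ T * 1" by (simp only: mult_1_right) (intro power_mono, auto)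
          also have "\<dots> \<le> c ^ T * R powr (- (\<epsilon>/2))" using Re c1 by (intro mult_left_mono) auto
          finally show "((K3 * H / H + 2)\<^sup>2) ^ T \<le> c ^ T * R powr (- (\<epsilon>/2))" .
        qed
        also have "\<dots> \<le> (K1 * R powr (- (\<epsilon>/2))) * gsum \<nu> T (cell 0 H \<pi>) B ^ T"
          using K1 by (intro mult_right_mono zero_le_power G0) auto
        finally show ?thesis .
      qed
    qed
    have 2: "moment \<nu> T {i\<in>B. cell 0 H \<pi> i = n} \<le> K2 * R powr (- (\<epsilon>/2)) * gsum \<nu> T (cell 0 R \<pi>) {i\<in>B. cell 0 H \<pi> i = n} ^ T" for n
    proof -
      have "{i\<in>B. cell 0 H \<pi> i = n} \<subseteq> A" using h(5) by auto
      moreover have "diam_le \<pi> (R powr q) {i\<in>B. cell 0 H \<pi> i = n}"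
        unfolding H_def[symmetric] by (rule diam_le_cell[OF H(1)])
      ultimately show ?thesis using K2(2) h(1-4) by blast
    qed
    have "moment \<nu> T B \<le> (K1 * R powr (- (\<epsilon>/2))) * (K2 * R powr (- (\<epsilon>/2))) * 3 ^ T * gsum \<nu> T (cell 0 R \<pi>) B ^ T"
      by (rule moment_chain[OF s(2) T1 _ _ s(1) h(5) 1 2 s(2,3) T1 h(3) H(2)]) (use K1 K2 in auto)
    also have "(K1 * R powr (- (\<epsilon>/2))) * (K2 * R powr (- (\<epsilon>/2))) * 3 ^ T = K1 * K2 * 3 ^ T * R powr (- \<epsilon>)"
      using powr_add[of R "- (\<epsilon>/2)" "- (\<epsilon>/2)"] by (simp add: mult_ac)
    finally show "moment \<nu> (tri l) B \<le> K1 * K2 * 3 ^ T * R powr (- \<epsilon>) * gsum \<nu> (tri l) (cell 0 R \<pi>) B ^ tri l"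
      unfolding T_def .
  qed
qed

context family
begin

text \<open>
  For \<open>C\<close> within \<open>\<theta>\<close> of \<open>\<xi>\<close>, the equations of degrees \<open>k - l + 1, \<dots>, k\<close>, recentred at \<open>\<xi>\<close>, barely
  see the variables in \<open>C\<close>. These are \<open>l\<close> equations for the variables in \<open>B\<close>, which stay away
  from \<open>\<xi>\<close>, so near any point of \<open>B\<close> they can be solved for the first \<open>l\<close> power sums.
\<close>

lemma corr_reweight_psum:
  assumes vin: "vin \<mu> k \<pi> (\<delta> ^ k) A" and BC: "B \<subseteq> A" "C \<subseteq> A" and c0: "c0 \<in> C" and lk: "l \<le> k"
    and C: "diam_le \<pi> \<theta> C" and \<theta>: "0 < \<delta>" "\<delta> \<le> \<theta>" "\<theta> \<le> 1"
    and xy: "xs \<in> tup B (tri l)" "ys \<in> tup B (tri l)"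
    and nz: "corr (reweight \<mu> (tri k - tri l) C) xs ys \<noteq> 0" and j: "j \<in> {1..l}"
  shows "\<bar>psum (\<lambda>i. \<pi> i - \<pi> c0) (k - l + j) xs - psum (\<lambda>i. \<pi> i - \<pi> c0) (k - l + j) ys\<bar>
    \<le> (2 ^ k + 2 * real (tri k)) * \<theta> ^ (k - l + 1)"
proof -
  note v = vinD[OF vin]
  define q where "q = tri k - tri l"
  define \<phi> where "\<phi> = (\<lambda>i. \<pi> i - \<pi> c0)"
  define n where "n = k - l + j"
  have n: "n \<le> k" "k - l + 1 \<le> n" "n \<ge> 1" unfolding n_def using j lk by auto
  have finC: "finite C" by (rule finite_subset[OF BC(2) v(1)])
  \<comment> \<open>The reweighted correlation is a sum over tuples from \<open>C\<close>. A single
    nonzero summand already provides the equations for the extended tuples.\<close>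
  obtain zs ws where zw: "zs \<in> tup C q" "ws \<in> tup C q" "corr \<mu> (xs @ zs) (ys @ ws) \<noteq> 0"
  proof -
    have "\<exists>zs\<in>tup C q. \<exists>ws\<in>tup C q. corr \<mu> (xs @ zs) (ys @ ws) \<noteq> 0"
    proof (rule ccontr)
      assume "\<not> ?thesis"
      then have "(\<Sum>zs\<in>tup C q. \<Sum>ws\<in>tup C q. corr \<mu> (xs @ zs) (ys @ ws)) = 0"
        by (intro sum.neutral ballI) blast
      then show False using nz unfolding corr_reweight[OF finC] q_def by simp
    qed
    then show thesis using that by blast
  qed
  have e: "tri l + q = tri k" unfolding q_def using tri_mono[OF lk] by simp
  have tup: "xs @ zs \<in> tup A (tri k)" "ys @ ws \<in> tup A (tri k)" using xy zw(1,2) BC e by auto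
  have "\<forall>j\<in>{1..k}. \<bar>psum \<pi> j (xs @ zs) - psum \<pi> j (ys @ ws)\<bar> \<le> \<delta> ^ k"
    using v(5)[unfolded approx_def, rule_format, OF tup zw(3)] by blast
  moreover have "length (xs @ zs) = length (ys @ ws)" using tup by auto
  moreover have "\<bar>\<pi> c0\<bar> \<le> 1" using v(3) c0 BC by auto
  ultimately have 1: "\<bar>psum \<phi> n (xs @ zs) - psum \<phi> n (ys @ ws)\<bar> \<le> 2 ^ k * \<delta> ^ k"
    unfolding \<phi>_def by (rule psum_shift_diff) (use \<theta> n in auto)
  \<comment> \<open>Seen from \<open>\<pi> c0\<close> all positions in \<open>C\<close> are at most
    \<theta>, so a power of degree at least k - l + 1 is negligible. This is where only the l
    highest equations are kept.\<close>
  have small: "\<bar>psum \<phi> n us\<bar> \<le> real (tri k) * \<theta> ^ (k - l + 1)" if "us \<in> tup C q" for us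
  proof -
    have "\<bar>psum \<phi> n us\<bar> \<le> real (length us) * \<theta> ^ n"
      by (rule psum_abs_le) (use that C c0 in \<open>auto simp: \<phi>_def diam_le_def\<close>)
    also have "\<dots> \<le> real (tri k) * \<theta> ^ (k - l + 1)"
      using that e \<theta> n(2) by (intro mult_mono power_decreasing) auto
    finally show ?thesis .
  qed
  have dl: "\<delta> ^ k \<le> \<theta> ^ (k - l + 1)"
  proof -
    have "\<delta> ^ k \<le> \<theta> ^ k" using \<theta> by (intro power_mono) auto
    also have "\<dots> \<le> \<theta> ^ (k - l + 1)" using \<theta> n by (intro power_decreasing) auto
    finally show ?thesis .
  qed
  have "\<bar>psum \<phi> n xs - psum \<phi> n ys\<bar> \<le> 2 ^ k * \<delta> ^ k + real (tri k) * \<theta> ^ (k - l + 1) + real (tri k) * \<theta> ^ (k - l + 1)"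
    using 1 small[OF zw(1)] small[OF zw(2)] unfolding psum_append by linarith
  also have "\<dots> \<le> 2 ^ k * \<theta> ^ (k - l + 1) + real (tri k) * \<theta> ^ (k - l + 1) + real (tri k) * \<theta> ^ (k - l + 1)"
    using dl by simp
  also have "\<dots> = (2 ^ k + 2 * real (tri k)) * \<theta> ^ (k - l + 1)" by (simp add: algebra_simps)
  finally show ?thesis unfolding \<phi>_def n_def .
qed

end

text \<open>Division by \<open>X = \<pi> i0 - \<pi> c0\<close> turns the distance of
  \<open>i\<close> from \<open>c0\<close> into 1 + u, where u is the scaled distance from
  \<open>i0\<close>. Since \<tau> \<le> \<bar>X\<bar>, u is bounded by 1 / \<tau>, and
  \<open>power_approx_by_high_powers\<close> with m = k - l recovers u^n from the powers of 1 + u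
  that are controlled. The constant depends on k, l and \<tau> alone and is therefore fixed before
  the family.\<close>

lemma reweight_local_system:
  assumes kl: "1 \<le> l" "l < k" and \<tau>: "0 < \<tau>" "\<tau> \<le> 1"
  obtains Kc where "Kc \<ge> 1" "\<And>(\<Omega> :: 'w set) (f :: 'i \<Rightarrow> 'w \<Rightarrow> complex) A \<mu> \<pi> \<delta> \<theta> B C.
    finite \<Omega> \<Longrightarrow> family.vin \<Omega> f \<mu> k \<pi> (\<delta> ^ k) A \<Longrightarrow> 0 < \<delta> \<Longrightarrow> \<delta> \<le> \<theta> \<Longrightarrow> \<theta> \<le> 1 \<Longrightarrow> B \<subseteq> A \<Longrightarrow> C \<subseteq> A \<Longrightarrow>
    C \<noteq> {} \<Longrightarrow> diam_le \<pi> \<theta> C \<Longrightarrow> (\<And>i j. i \<in> B \<Longrightarrow> j \<in> C \<Longrightarrow> \<tau> \<le> \<bar>\<pi> i - \<pi> j\<bar>) \<Longrightarrow>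
    family.local_system \<Omega> f (family.reweight f \<mu> (tri k - tri l) C) l \<pi> Kc (\<theta> ^ (k - l + 1)) B"
proof -
  define m where "m = k - l"
  define t where "t = 1 / \<tau>"
  have t: "t \<ge> 1" unfolding t_def using \<tau> by simp
  have ex: "\<forall>n\<in>{1..l}. \<exists>d c K. K \<ge> 0 \<and> (\<forall>u. \<bar>u\<bar> \<le> t \<longrightarrow>
    \<bar>d + (\<Sum>j\<in>{1..l}. c j * (1 + u) ^ (m + j)) - u ^ n\<bar> \<le> K * \<bar>u\<bar> ^ (l + 1))"
    using t by (intro ballI power_approx_by_high_powers) auto
  obtain d where "\<forall>n\<in>{1..l}. \<exists>c K. K \<ge> 0 \<and> (\<forall>u. \<bar>u\<bar> \<le> t \<longrightarrow>
    \<bar>d n + (\<Sum>j\<in>{1..l}. c j * (1 + u) ^ (m + j)) - u ^ n\<bar> \<le> K * \<bar>u\<bar> ^ (l + 1))"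
    using bchoice[OF ex] by blast
  from bchoice[OF this] obtain c where "\<forall>n\<in>{1..l}. \<exists>K. K \<ge> 0 \<and> (\<forall>u. \<bar>u\<bar> \<le> t \<longrightarrow>
    \<bar>d n + (\<Sum>j\<in>{1..l}. c n j * (1 + u) ^ (m + j)) - u ^ n\<bar> \<le> K * \<bar>u\<bar> ^ (l + 1))" by blast
  from bchoice[OF this] obtain K where K0: "\<And>n. n \<in> {1..l} \<Longrightarrow> K n \<ge> 0" and K: "\<And>n u. n \<in> {1..l} \<Longrightarrow> \<bar>u\<bar> \<le> t \<Longrightarrow>
    \<bar>d n + (\<Sum>j\<in>{1..l}. c n j * (1 + u) ^ (m + j)) - u ^ n\<bar> \<le> K n * \<bar>u\<bar> ^ (l + 1)" by blast
  define E where "E = 2 ^ k + 2 * real (tri k)"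
  have E0: "E \<ge> 0" unfolding E_def by simp
  \<comment> \<open>\<open>P n\<close> collects the errors of the equations that remain after
    discarding \<open>C\<close>, and \<open>Q n\<close> the errors of the polynomial approximation
    for both tuples. The factor 2^l in \<open>Kc\<close> undoes the division by \<open>X\<close>, as
    \<bar>X\<bar> \<le> 2.\<close>
  define P where "P n = (\<Sum>j\<in>{1..l}. \<bar>c n j\<bar> * (t ^ k * E))" for n
  define Q where "Q n = 2 * real (tri l) * (K n * t ^ (l + 1))" for n
  have PQ: "P n \<ge> 0" "n \<in> {1..l} \<Longrightarrow> Q n \<ge> 0" for n
    unfolding P_def Q_def using E0 t K0 by (auto intro!: sum_nonneg mult_nonneg_nonneg)
  define Kc where "Kc = 1 + (\<Sum>n\<in>{1..l}. 2 ^ l * (P n + Q n))"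
  have Kc1: "Kc \<ge> 1" unfolding Kc_def using PQ by (auto intro!: sum_nonneg)
  have Kc: "2 ^ l * (P n + Q n) \<le> Kc" if "n \<in> {1..l}" for n
    unfolding Kc_def using member_le_sum[of n "{1..l}" "\<lambda>n. 2 ^ l * (P n + Q n)"] that PQ
    by (auto simp: add_nonneg_nonneg)
  show thesis
  proof (rule that[OF Kc1])
    fix \<Omega> :: "'w set" and f :: "'i \<Rightarrow> 'w \<Rightarrow> complex" and A \<mu> \<pi> \<delta> \<theta> B C
    assume fin: "finite \<Omega>" and vin: "family.vin \<Omega> f \<mu> k \<pi> (\<delta> ^ k) A" and \<theta>: "0 < \<delta>" "\<delta> \<le> \<theta>" "\<theta> \<le> 1"
      and BC: "B \<subseteq> A" "C \<subseteq> A" "C \<noteq> {}" "diam_le \<pi> \<theta> C"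
      and sep: "\<And>i j. i \<in> B \<Longrightarrow> j \<in> C \<Longrightarrow> \<tau> \<le> \<bar>\<pi> i - \<pi> j\<bar>"
    interpret family \<Omega> f by unfold_locales (rule fin)
    note v = vinD[OF vin]
    obtain c0 where c0: "c0 \<in> C" using BC by auto
    define \<nu> where "\<nu> = reweight \<mu> (tri k - tri l) C"
    define \<rho> where "\<rho> = \<theta> ^ (k - l + 1)"
    have \<rho>0: "\<rho> \<ge> 0" unfolding \<rho>_def using \<theta> by simp
    have tl: "tri l + (tri k - tri l) = tri k" using tri_mono[of l k] kl by simp
    have main: "\<bar>psum (\<lambda>i. \<pi> i - \<pi> i0) n xs - psum (\<lambda>i. \<pi> i - \<pi> i0) n ys\<bar> \<le> Kc * (\<rho> + \<sigma> ^ (l + 1))"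
      if i0: "i0 \<in> B" and \<sigma>: "0 < \<sigma>" "\<sigma> \<le> 1" and xy: "xs \<in> tup B (tri l)" "ys \<in> tup B (tri l)"
        and near: "\<forall>i\<in>set xs \<union> set ys. \<bar>\<pi> i - \<pi> i0\<bar> \<le> \<sigma>" and nz: "corr \<nu> xs ys \<noteq> 0" and n: "n \<in> {1..l}"
      for i0 \<sigma> xs ys n
    proof -
      define X where "X = \<pi> i0 - \<pi> c0"
      have "\<bar>\<pi> i0\<bar> \<le> 1" "\<bar>\<pi> c0\<bar> \<le> 1" using v(3) i0 c0 BC(1,2) by auto
      then have X: "\<tau> \<le> \<bar>X\<bar>" "\<bar>X\<bar> \<le> 2"
        using sep[OF i0 c0] unfolding X_def by auto
      have X0: "X \<noteq> 0" "\<bar>X\<bar> > 0" using X \<tau> by auto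
      have Xt: "\<bar>1 / X\<bar> \<le> t" unfolding t_def using X \<tau> by (simp add: abs_divide frac_le)
      define \<phi> where "\<phi> = (\<lambda>i. (1 / X) * (\<pi> i - \<pi> c0))"
      define \<psi> where "\<psi> = (\<lambda>i. (1 / X) * (\<pi> i - \<pi> i0))"
      have \<phi>\<psi>: "\<phi> i = 1 + \<psi> i" for i unfolding \<phi>_def \<psi>_def X_def using X0 unfolding X_def
        by (simp add: field_simps)
      define e where "e = K n * (t * \<sigma>) ^ (l + 1)"
      have comb: "\<bar>d n * real (length us) + (\<Sum>j\<in>{1..l}. c n j * psum \<phi> (m + j) us) - psum \<psi> n us\<bar> \<le> real (tri l) * e"
        if us: "us \<in> tup B (tri l)" "\<forall>i\<in>set us. \<bar>\<pi> i - \<pi> i0\<bar> \<le> \<sigma>" for us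
      proof -
        have "\<bar>d n * real (length us) + (\<Sum>j\<in>{1..l}. c n j * psum \<phi> (m + j) us) - psum \<psi> n us\<bar> \<le> real (length us) * e"
        proof (rule psum_combination)
          fix i assume i: "i \<in> set us"
          have u1: "\<bar>\<psi> i\<bar> \<le> t * \<sigma>" unfolding \<psi>_def abs_mult using Xt us(2) i t by (intro mult_mono) auto
          also have "\<dots> \<le> t" using mult_left_mono[OF \<sigma>(2), of t] t by simp
          finally have "\<bar>d n + (\<Sum>j\<in>{1..l}. c n j * (1 + \<psi> i) ^ (m + j)) - \<psi> i ^ n\<bar> \<le> K n * \<bar>\<psi> i\<bar> ^ (l + 1)"
            by (rule K[OF n])
          also have "\<dots> \<le> e" unfolding e_def using u1 K0[OF n] by (intro mult_left_mono power_mono) auto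
          finally show "\<bar>d n + (\<Sum>j\<in>{1..l}. c n j * \<phi> i ^ (m + j)) - \<psi> i ^ n\<bar> \<le> e" unfolding \<phi>\<psi> .
        qed
        then show ?thesis using us(1) by simp
      qed
      have len: "length xs = length ys" using xy by simp
      have S: "\<bar>(\<Sum>j\<in>{1..l}. c n j * psum \<phi> (m + j) xs) - (\<Sum>j\<in>{1..l}. c n j * psum \<phi> (m + j) ys)\<bar> \<le> P n * \<rho>"
      proof -
        have "\<bar>(\<Sum>j\<in>{1..l}. c n j * psum \<phi> (m + j) xs) - (\<Sum>j\<in>{1..l}. c n j * psum \<phi> (m + j) ys)\<bar>
          = \<bar>\<Sum>j\<in>{1..l}. c n j * (psum \<phi> (m + j) xs - psum \<phi> (m + j) ys)\<bar>"
          by (simp only: right_diff_distrib sum_subtractf)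
        also have "\<dots> \<le> (\<Sum>j\<in>{1..l}. \<bar>c n j * (psum \<phi> (m + j) xs - psum \<phi> (m + j) ys)\<bar>)" by (rule sum_abs)
        also have "\<dots> \<le> (\<Sum>j\<in>{1..l}. \<bar>c n j\<bar> * (t ^ k * (E * \<rho>)))"
          unfolding abs_mult
        proof (intro sum_mono mult_left_mono)
          fix j assume j: "j \<in> {1..l}"
          have "\<bar>psum \<phi> (m + j) xs - psum \<phi> (m + j) ys\<bar>
             = \<bar>1 / X\<bar> ^ (m + j) * \<bar>psum (\<lambda>i. \<pi> i - \<pi> c0) (m + j) xs - psum (\<lambda>i. \<pi> i - \<pi> c0) (m + j) ys\<bar>"
            unfolding \<phi>_def psum_scale right_diff_distrib[symmetric] abs_mult power_abs ..
          also have "\<dots> \<le> t ^ (m + j) * (E * \<rho>)"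
            unfolding E_def \<rho>_def m_def
            using corr_reweight_psum[OF vin BC(1,2) c0 _ BC(4) \<theta> xy nz[unfolded \<nu>_def] j] kl Xt t
            by (intro mult_mono power_mono) (auto simp: m_def)
          also have "\<dots> \<le> t ^ k * (E * \<rho>)"
            using t E0 \<rho>0 j kl unfolding m_def by (intro mult_right_mono power_increasing) auto
          finally show "\<bar>psum \<phi> (m + j) xs - psum \<phi> (m + j) ys\<bar> \<le> t ^ k * (E * \<rho>)" .
        qed simp
        also have "\<dots> = P n * \<rho>" unfolding P_def sum_distrib_right by (simp only: mult.assoc)
        finally show ?thesis .
      qed
      have cx: "\<bar>d n * real (length xs) + (\<Sum>j\<in>{1..l}. c n j * psum \<phi> (m + j) xs) - psum \<psi> n xs\<bar> \<le> real (tri l) * e"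
        and cy: "\<bar>d n * real (length xs) + (\<Sum>j\<in>{1..l}. c n j * psum \<phi> (m + j) ys) - psum \<psi> n ys\<bar> \<le> real (tri l) * e"
        using comb[OF xy(1)] comb[OF xy(2)] near len by auto
      have "\<bar>psum \<psi> n xs - psum \<psi> n ys\<bar> \<le> P n * \<rho> + 2 * (real (tri l) * e)"
        using cx cy S by linarith
      also have "2 * (real (tri l) * e) = Q n * \<sigma> ^ (l + 1)"
        unfolding e_def Q_def power_mult_distrib by (simp only: mult_ac)
      also have "P n * \<rho> + Q n * \<sigma> ^ (l + 1) \<le> (P n + Q n) * (\<rho> + \<sigma> ^ (l + 1))"
        using PQ(1)[of n] PQ(2)[OF n] \<rho>0 \<sigma> by (simp add: algebra_simps)
      finally have 1: "\<bar>psum \<psi> n xs - psum \<psi> n ys\<bar> \<le> (P n + Q n) * (\<rho> + \<sigma> ^ (l + 1))" .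
      have "psum (\<lambda>i. \<pi> i - \<pi> i0) n us = X ^ n * psum \<psi> n us" for us
        unfolding psum_scale[symmetric] \<psi>_def using X0 by simp
      then have "\<bar>psum (\<lambda>i. \<pi> i - \<pi> i0) n xs - psum (\<lambda>i. \<pi> i - \<pi> i0) n ys\<bar> = \<bar>X\<bar> ^ n * \<bar>psum \<psi> n xs - psum \<psi> n ys\<bar>"
        by (simp only: right_diff_distrib[symmetric] abs_mult power_abs)
      also have "\<dots> \<le> 2 ^ l * ((P n + Q n) * (\<rho> + \<sigma> ^ (l + 1)))"
      proof (rule mult_mono[OF _ 1])
        have "\<bar>X\<bar> ^ n \<le> 2 ^ n" using X by (intro power_mono) auto
        also have "\<dots> \<le> 2 ^ l" using n by (intro power_increasing) auto
        finally show "\<bar>X\<bar> ^ n \<le> 2 ^ l" .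
      qed auto
      also have "\<dots> \<le> Kc * (\<rho> + \<sigma> ^ (l + 1))"
        unfolding mult.assoc[symmetric] using \<rho>0 \<sigma> by (intro mult_right_mono Kc[OF n]) auto
      finally show ?thesis .
    qed
    have "positive \<nu> (tri l) A" unfolding \<nu>_def
      by (rule positive_reweight[OF _ BC(2) v(1)]) (use v(4) tl in simp)
    then have "positive \<nu> (tri l) B" by (rule positive_subset[OF _ BC(1)])
    moreover have "wt \<nu>" unfolding \<nu>_def by (rule wt_reweight[OF v(2)])
    moreover have "finite B" by (rule finite_subset[OF BC(1) v(1)])
    ultimately have "local_system \<nu> l \<pi> Kc \<rho> B"
      unfolding local_system_def using main by blast
    then show "local_system (reweight \<mu> (tri k - tri l) C) l \<pi> Kc (\<theta> ^ (k - l + 1)) B"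
      unfolding \<nu>_def \<rho>_def .
  qed
qed

text \<open>For the weight built from \<open>C\<close> the set \<open>B\<close> satisfies locally a
  degree l system with error \<delta>^(b (k - l + 1)) = R^l, where R = \<delta>^a'; this equation
  determines a'. Decoupling in degree l leads from length \<delta>^a down to R at the cost of an
  \<epsilon> only, and on cells of length R the assumed bilinear estimate takes over.\<close>

lemma bilinear_lower_degree:
  assumes dec: "\<And>\<epsilon>. \<epsilon> > 0 \<Longrightarrow> dec_exponent TYPE('i \<times> 'w) l \<epsilon>" and kl: "1 \<le> l" "l < k" and \<tau>: "0 < \<tau>" "\<tau> \<le> 1"
    and b: "0 < b" and b1: "b \<le> 1" and a': "a' = real (k - l + 1) * b / real l" "a' \<le> 1" and a: "0 < a" and \<epsilon>: "\<epsilon> > 0"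
    and bil: "bilinear TYPE('i \<times> 'w) k \<tau> l a' b \<beta>"
  shows "bilinear TYPE('i \<times> 'w) k \<tau> l a b (\<beta> + \<epsilon>)"
proof -
  obtain Kc where Kc: "Kc \<ge> 1" "\<And>(\<Omega> :: 'w set) (f :: 'i \<Rightarrow> 'w \<Rightarrow> complex) A \<mu> \<pi> \<delta> \<theta> B C.
    finite \<Omega> \<Longrightarrow> family.vin \<Omega> f \<mu> k \<pi> (\<delta> ^ k) A \<Longrightarrow> 0 < \<delta> \<Longrightarrow> \<delta> \<le> \<theta> \<Longrightarrow> \<theta> \<le> 1 \<Longrightarrow> B \<subseteq> A \<Longrightarrow> C \<subseteq> A \<Longrightarrow>
    C \<noteq> {} \<Longrightarrow> diam_le \<pi> \<theta> C \<Longrightarrow> (\<And>i j. i \<in> B \<Longrightarrow> j \<in> C \<Longrightarrow> \<tau> \<le> \<bar>\<pi> i - \<pi> j\<bar>) \<Longrightarrow>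
    family.local_system \<Omega> f (family.reweight f \<mu> (tri k - tri l) C) l \<pi> Kc (\<theta> ^ (k - l + 1)) B"
    using reweight_local_system[OF kl \<tau>, where ?'w = 'w and ?'i = 'i] by blast
  define r where "r = real l / real (l + 1)"
  have r: "0 < r" "r < 1" unfolding r_def using kl by auto
  have a'0: "0 < a'" unfolding a' using kl b by simp
  \<comment> \<open>So many steps of \<open>local_decoupling\<close> that its starting length
    R^(r^m) exceeds \<delta>^a. Any positive a is reached because r < 1.\<close>
  obtain m where m: "r ^ m < a / a'" using real_arch_pow_inv[of "a / a'" r] r a a'0 by auto
  obtain K1 where K1: "K1 \<ge> 1" "\<forall>(\<Omega> :: 'w set) (f :: 'i \<Rightarrow> 'w \<Rightarrow> complex) \<nu> \<pi> A B R.
    finite \<Omega> \<longrightarrow> family.local_system \<Omega> f \<nu> l \<pi> Kc (R ^ l) A \<longrightarrow> 0 < R \<longrightarrow> R \<le> 1 \<longrightarrow>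
    B \<subseteq> A \<longrightarrow> diam_le \<pi> (R powr (r ^ m)) B \<longrightarrow>
    family.moment \<Omega> f \<nu> (tri l) B \<le> K1 * R powr (- \<epsilon>) * family.gsum \<Omega> f \<nu> (tri l) (cell 0 R \<pi>) B ^ tri l"
    using local_decoupling[OF dec kl(1) Kc(1) \<epsilon>, of m] unfolding r_def by blast
  obtain K2 where K2: "K2 \<ge> 1" and K2': "bilinear_bound TYPE('i \<times> 'w) K2 k \<tau> l a' b \<beta>"
    by (rule bilinearE[OF bil])
  define T where "T = tri l"
  have T1: "T \<ge> 1" "tri k \<ge> 1" unfolding T_def using kl tri_pos[of l] tri_pos[of k] by auto
  have Tk: "tri k - T \<ge> 1" unfolding T_def using tri_less[OF kl(2)] by simp
  have KK: "K1 * K2 * 3 ^ T \<ge> 1"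
    using mult_mono[of 1 "K1 * K2" 1 "3 ^ T"] mult_mono[of 1 K1 1 K2] K1(1) K2 by simp
  show ?thesis
  proof (rule bilinearI[OF KK])
    fix \<Omega> :: "'w set" and f :: "'i \<Rightarrow> 'w \<Rightarrow> complex" and A \<mu> \<pi> and \<delta> :: real and B C
    assume h: "finite \<Omega>" "family.vin \<Omega> f \<mu> k \<pi> (\<delta> ^ k) A" "0 < \<delta>" "\<delta> \<le> 1"
      "B \<subseteq> A" "C \<subseteq> A" "diam_le \<pi> (\<delta> powr a) B" "diam_le \<pi> (\<delta> powr b) C"
    assume sep: "\<And>i j. i \<in> B \<Longrightarrow> j \<in> C \<Longrightarrow> \<tau> \<le> \<bar>\<pi> i - \<pi> j\<bar>"
    interpret family \<Omega> f by unfold_locales (rule h(1))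
    note v = vinD[OF h(2)]
    define \<nu> where "\<nu> = reweight \<mu> (tri k - tri l) C"
    define G where "G = gsum \<mu> (tri k) (cell 0 \<delta> \<pi>)"
    have G0: "0 \<le> G D" for D unfolding G_def by (rule gsum_nonneg[OF v(2)])
    have w\<nu>: "wt \<nu>" unfolding \<nu>_def by (rule wt_reweight[OF v(2)])
    have "moment \<nu> T B \<le> K1 * K2 * 3 ^ T * \<delta> powr (- (\<beta> + \<epsilon>)) * (G B ^ T * G C ^ (tri k - T))"
    \<comment> \<open>Recentring needs a point of \<open>C\<close>. For empty \<open>C\<close> the
      new weight vanishes, since its exponent \<open>tri k - tri l\<close> is positive.\<close>
    proof (cases "C = {}")
      case True
      have "reweight \<mu> (tri k - tri l) {} w = 0" for w
        unfolding reweight_def F_def using tri_less[OF kl(2)] by simp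
      then have "moment \<nu> T B = 0" unfolding \<nu>_def True moment_def av_def by simp
      also have "0 \<le> K1 * K2 * 3 ^ T * \<delta> powr (- (\<beta> + \<epsilon>)) * (G B ^ T * G C ^ (tri k - T))"
        using K1(1) K2 G0 by (intro mult_nonneg_nonneg zero_le_power) auto
      finally show ?thesis .
    next
      case False
      define R where "R = \<delta> powr a'"
      have R: "0 < R" "R \<le> 1" "\<delta> \<le> R"
        unfolding R_def using h(3,4) a'0 a'(2) powr_mono'[of a' 1 \<delta>] powr_mono'[of 0 a' \<delta>] by auto
      have lam: "\<delta> \<le> \<delta> powr b" "\<delta> powr b \<le> 1"
        using h(3,4) b b1 powr_mono'[of b 1 \<delta>] powr_mono'[of 0 b \<delta>] by auto
      have Rl: "R ^ l = (\<delta> powr b) ^ (k - l + 1)"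
      proof -
        have "R ^ l = \<delta> powr (real l * a')" unfolding R_def by (rule powr_power) (use h in simp)
        also have "real l * a' = real (k - l + 1) * b" unfolding a'(1) using kl by simp
        also have "\<delta> powr \<dots> = (\<delta> powr b) ^ (k - l + 1)" by (rule powr_power[symmetric]) (use h in simp)
        finally show ?thesis .
      qed
      have ls: "local_system \<nu> l \<pi> Kc (R ^ l) B"
        unfolding Rl \<nu>_def by (rule Kc(2)[OF h(1-3) lam h(5,6) False h(8) sep])
      have dB: "diam_le \<pi> (R powr (r ^ m)) B"
      proof (rule diam_le_mono[OF h(7)])
        have "a' * r ^ m \<le> a" using m a'0 by (simp add: field_simps)
        then show "\<delta> powr a \<le> R powr (r ^ m)"
          unfolding R_def powr_powr using h(3,4) by (intro powr_mono') auto
      qed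
      have 1: "moment \<nu> T B \<le> K1 * R powr (- \<epsilon>) * gsum \<nu> T (cell 0 R \<pi>) B ^ T"
        using K1(2) h(1) ls R(1,2) dB unfolding T_def by blast
      have 2: "moment \<nu> T {i\<in>B. cell 0 R \<pi> i = n}
        \<le> (K2 * \<delta> powr (- \<beta>) * G C ^ (tri k - T)) * gsum \<mu> (tri k) (cell 0 \<delta> \<pi>) {i\<in>B. cell 0 R \<pi> i = n} ^ T" for n
      proof -
        have "moment (reweight \<mu> (tri k - tri l) C) (tri l) {i\<in>B. cell 0 R \<pi> i = n} \<le> K2 * \<delta> powr (- \<beta>) *
          (gsum \<mu> (tri k) (cell 0 \<delta> \<pi>) {i\<in>B. cell 0 R \<pi> i = n} ^ tri l * gsum \<mu> (tri k) (cell 0 \<delta> \<pi>) C ^ (tri k - tri l))"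
        proof (rule bilinear_boundD[OF K2' h(2-4) _ h(6) _ h(8)])
          show "{i\<in>B. cell 0 R \<pi> i = n} \<subseteq> A" using h(5) by auto
          show "diam_le \<pi> (\<delta> powr a') {i\<in>B. cell 0 R \<pi> i = n}"
            unfolding R_def[symmetric] by (rule diam_le_cell[OF R(1)])
        qed (use sep in auto)
        then show ?thesis unfolding \<nu>_def G_def T_def by (simp only: mult_ac)
      qed
      have "moment \<nu> T B \<le> (K1 * R powr (- \<epsilon>)) * (K2 * \<delta> powr (- \<beta>) * G C ^ (tri k - T)) * 3 ^ T * G B ^ T"
        unfolding G_def
        by (rule moment_chain[OF w\<nu> T1(1) _ _ v(1) h(5) 1 2[unfolded G_def] v(2,4) T1(2) h(3) R(3)])
          (use K1 K2 G0[unfolded G_def] in \<open>auto intro!: mult_nonneg_nonneg\<close>)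
      also have "\<dots> = R powr (- \<epsilon>) * ((K1 * K2 * 3 ^ T * \<delta> powr (- \<beta>)) * (G B ^ T * G C ^ (tri k - T)))"
        by (simp only: mult_ac)
      also have "\<dots> \<le> \<delta> powr (- \<epsilon>) * ((K1 * K2 * 3 ^ T * \<delta> powr (- \<beta>)) * (G B ^ T * G C ^ (tri k - T)))"
        using K1(1) K2 G0 h(3) R(3) \<epsilon> by (intro mult_right_mono powr_neg_antimono mult_nonneg_nonneg zero_le_power) auto
      also have "\<dots> = K1 * K2 * 3 ^ T * (\<delta> powr (- \<epsilon>) * \<delta> powr (- \<beta>)) * (G B ^ T * G C ^ (tri k - T))"
        by (simp only: mult_ac)
      also have "\<delta> powr (- \<epsilon>) * \<delta> powr (- \<beta>) = \<delta> powr (- (\<beta> + \<epsilon>))"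
        by (simp add: powr_add[symmetric] algebra_simps)
      finally show ?thesis .
    qed
    then show "moment (reweight \<mu> (tri k - tri l) C) (tri l) B \<le> K1 * K2 * 3 ^ T * \<delta> powr (- (\<beta> + \<epsilon>)) *
      (gsum \<mu> (tri k) (cell 0 \<delta> \<pi>) B ^ tri l * gsum \<mu> (tri k) (cell 0 \<delta> \<pi>) C ^ (tri k - tri l))"
      unfolding \<nu>_def G_def T_def .
  qed
qed

section \<open>Iteration of the bilinear estimates\<close>

text \<open>
  \<open>gain k n l\<close> is the coefficient \<open>c\<close> in the bilinear exponent \<open>\<eta> (1 - c b)\<close> after \<open>n\<close> rounds.
  The all-ones vector is a left eigenvector of the recursion, so each round increases the sum
  by the contribution \<open>(k - 1) / k\<close> of \<open>gain k n 0 = 1\<close>.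
\<close>

fun gain :: "nat \<Rightarrow> nat \<Rightarrow> nat \<Rightarrow> real" where
  "gain k 0 l = (if l = 0 then 1 else 0)"
| "gain k (Suc n) l = (if l = 0 then 1 else
     real (k - l) / real (k - l + 1) * gain k n (l - 1) + gain k n (k - l) / real l)"

lemma gain_0 [simp]: "gain k n 0 = 1"
  by (cases n) auto

text \<open>For 1 \<le> m < k, entry m of the old vector enters the new sum through l = m + 1 with
  weight (k - m - 1) / (k - m), which is 0 for m = k - 1, and through l = k - m with weight 1 / (k -
  m). The weights add up to 1. Entry 0 enters only through l = 1.\<close>

lemma sum_gain:
  assumes "k \<ge> 2"
  shows "(\<Sum>l\<in>{1..<k}. gain k n l) = real n * (real k - 1) / real k"
proof (induction n)
  case (Suc n)
  let ?c = "gain k n"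
  have "(\<Sum>l\<in>{1..<k}. real (k - l) / real (k - l + 1) * ?c (l - 1))
      = (\<Sum>m\<in>{0..<k - 1}. real (k - Suc m) / real (k - m) * ?c m)"
  proof -
    have e: "{1..<k} = {Suc 0..<Suc (k - 1)}" using assms by auto
    show ?thesis unfolding e sum.shift_bounds_Suc_ivl
      by (intro sum.cong refl) (auto simp: Suc_diff_Suc)
  qed
  also have "\<dots> = (\<Sum>m\<in>{0..<k}. real (k - Suc m) / real (k - m) * ?c m)"
    by (rule sum.mono_neutral_left) auto
  also have "{0..<k} = insert 0 {1..<k}" using assms by auto
  finally have 1: "(\<Sum>l\<in>{1..<k}. real (k - l) / real (k - l + 1) * ?c (l - 1))
      = (real k - 1) / real k + (\<Sum>m\<in>{1..<k}. real (k - Suc m) / real (k - m) * ?c m)"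
    using assms by (simp add: of_nat_diff)
  have 2: "(\<Sum>l\<in>{1..<k}. ?c (k - l) / real l) = (\<Sum>m\<in>{1..<k}. ?c m / real (k - m))"
    by (rule sum.reindex_bij_witness[of _ "\<lambda>m. k - m" "\<lambda>m. k - m"]) auto
  have "(\<Sum>l\<in>{1..<k}. gain k (Suc n) l) = (\<Sum>l\<in>{1..<k}. real (k - l) / real (k - l + 1) * ?c (l - 1) + ?c (k - l) / real l)"
    by (intro sum.cong refl) auto
  also have "\<dots> = (real k - 1) / real k + (\<Sum>m\<in>{1..<k}. real (k - Suc m) / real (k - m) * ?c m + ?c m / real (k - m))"
    by (simp only: sum.distrib 1 2 add.assoc)
  also have "(\<Sum>m\<in>{1..<k}. real (k - Suc m) / real (k - m) * ?c m + ?c m / real (k - m)) = (\<Sum>m\<in>{1..<k}. ?c m)"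
  proof (rule sum.cong[OF refl])
    fix m assume m: "m \<in> {1..<k}"
    then have e: "real (k - m) = real (k - Suc m) + 1" by auto
    have "y / (y + 1) * c + c / (y + 1) = c" if "y \<ge> 0" for y c :: real
    proof -
      have "y / (y + 1) * c + c / (y + 1) = (y + 1) * c / (y + 1)" by (simp add: add_divide_distrib distrib_right)
      then show ?thesis using that by simp
    qed
    then show "real (k - Suc m) / real (k - m) * ?c m + ?c m / real (k - m) = ?c m"
      unfolding e by simp
  qed
  finally have "(\<Sum>l\<in>{1..<k}. gain k (Suc n) l) = (real k - 1) / real k + (\<Sum>m\<in>{1..<k}. ?c m)" .
  then show ?case unfolding Suc.IH by (simp only: add_divide_distrib[symmetric]) (simp add: algebra_simps)
qed simp

text \<open>Some entry is at least the average of the k - 1 entries.\<close>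

lemma ex_large_gain:
  assumes "k \<ge> 2"
  obtains l where "1 \<le> l" "l < k" "gain k n l \<ge> real n / real k"
proof -
  have "\<exists>l\<in>{1..<k}. gain k n l \<ge> real n / real k"
  proof (rule ccontr)
    assume "\<not> ?thesis"
    then have "(\<Sum>l\<in>{1..<k}. gain k n l) < (\<Sum>l\<in>{1..<k}. real n / real k)"
      using assms by (intro sum_strict_mono) (auto simp: not_le)
    also have "\<dots> = real n * (real k - 1) / real k" using assms by (simp add: of_nat_diff field_simps)
    finally show False using sum_gain[OF assms, of n] by simp
  qed
  then show thesis using that by auto
qed

text \<open>A round applies \<open>bilinear_holder\<close> at lengths \<delta>^a' and \<delta>^b and
  then \<open>bilinear_lower_degree\<close> to replace a' by a. The second input has a' = (k - l +
  1) b / l in the role of b; divided by the Hoelder denominator k - l + 1, its gain enters with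
  weight 1 / l, as in the recursion of \<open>gain\<close>. Since a' \<le> k b, the bound on b
  leaves room for n rounds.\<close>

lemma bilinear_iterate:
  assumes k: "k \<ge> 2"
    and dec: "\<And>l \<epsilon>. 1 \<le> l \<Longrightarrow> l < k \<Longrightarrow> \<epsilon> > 0 \<Longrightarrow> dec_exponent TYPE('i \<times> 'w) l \<epsilon>"
    and \<eta>: "dec_exponent TYPE('i \<times> 'w) k \<eta>" "\<eta> \<ge> 0" and \<tau>: "0 < \<tau>" "\<tau> \<le> 1"
    and "1 \<le> l" "l < k" "0 < b" "b \<le> 1 / real k ^ (n + 1)" "0 < a" "0 < \<epsilon>"
  shows "bilinear TYPE('i \<times> 'w) k \<tau> l a b (\<eta> * (1 - gain k n l * b) + \<epsilon>)"
  using assms(7-12)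
proof (induction n arbitrary: l a b \<epsilon>)
  case 0
  have b1: "b \<le> 1" using 0(4) k by (rule_tac order_trans) auto
  \<comment> \<open>No gain is asked for yet, as \<open>gain k 0 l = 0\<close> for positive l. The
    minimum with 1 keeps the interval at least as long as a cell.\<close>
  have "bilinear TYPE('i \<times> 'w) k \<tau> l (min a 1) b \<eta>"
    by (rule bilinear_trivial[OF \<eta>(1) _ \<eta>(2)]) (use 0 k b1 in auto)
  then show ?case by (rule bilinear_mono) (use 0 in auto)
next
  case (Suc n)
  define a' where "a' = real (k - l + 1) * b / real l"
  have k0: "real k \<ge> 1" "real k > 0" using k by auto
  have kn: "1 / real k ^ (n + 1) \<le> 1" using k0 by (simp add: divide_le_eq_1 one_le_power del: power_Suc)
  have a'0: "0 < a'" unfolding a'_def using Suc.prems by simp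
  have "a' \<le> real (k - l + 1) * b / 1" unfolding a'_def using Suc.prems by (intro divide_left_mono) auto
  also have "\<dots> \<le> real k * b" using Suc.prems by (simp add: mult_right_mono)
  also have "\<dots> \<le> real k * (1 / real k ^ (Suc n + 1))" using Suc.prems k0 by (intro mult_left_mono) auto
  also have "\<dots> = 1 / real k ^ (n + 1)" using k0 by simp
  finally have a'n: "a' \<le> 1 / real k ^ (n + 1)" .
  have "b \<le> real k * b" using k0 Suc.prems mult_right_mono[of 1 "real k" b] by simp
  also have "\<dots> \<le> real k * (1 / real k ^ (Suc n + 1))" using Suc.prems k0 by (intro mult_left_mono) auto
  also have "\<dots> = 1 / real k ^ (n + 1)" using k0 by simp
  finally have bn: "b \<le> 1 / real k ^ (n + 1)" .
  have b1: "b \<le> 1" and a'1: "a' \<le> 1" using bn a'n kn by auto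
  define e where "e = \<epsilon> / 2"
  have e: "e > 0" unfolding e_def using Suc.prems by simp
  define \<beta>1 where "\<beta>1 = \<eta> * (1 - gain k n (l - 1) * b) + e"
  define \<beta>2 where "\<beta>2 = \<eta> * (1 - gain k n (k - l) * a') + e"
  have 1: "bilinear TYPE('i \<times> 'w) k \<tau> (l - 1) a' b \<beta>1"
  proof (cases "l = 1")
    case True
    have "bilinear TYPE('i \<times> 'w) k \<tau> 0 a' b (\<eta> * (1 - b))"
      by (rule bilinear_0[OF \<eta>(1) _ \<eta>(2)]) (use k b1 Suc.prems in auto)
    then have "bilinear TYPE('i \<times> 'w) k \<tau> 0 a' b \<beta>1"
      by (rule bilinear_mono) (use True e in \<open>auto simp: \<beta>1_def\<close>)
    then show ?thesis using True by simp
  next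
    case False
    show ?thesis unfolding \<beta>1_def by (rule Suc.IH) (use False Suc.prems bn a'0 e in auto)
  qed
  have 2: "bilinear TYPE('i \<times> 'w) k \<tau> (k - l) b a' \<beta>2"
    unfolding \<beta>2_def by (rule Suc.IH) (use Suc.prems a'n a'0 e in auto)
  have 3: "bilinear TYPE('i \<times> 'w) k \<tau> l a' b ((real (k - l) * \<beta>1 + \<beta>2) / real (k - l + 1))"
    by (rule bilinear_holder[OF 1 2 Suc.prems(1,2)])
  have 4: "(real (k - l) * \<beta>1 + \<beta>2) / real (k - l + 1) = \<eta> * (1 - gain k (Suc n) l * b) + e"
  proof -
    define x where "x = real (k - l)"
    have x: "x + 1 > 0" "real (k - l + 1) = x + 1" unfolding x_def by auto
    have l0: "l \<noteq> 0" using Suc.prems by auto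
    have alg: "(x * (\<eta> * (1 - g1 * b) + e) + (\<eta> * (1 - g2 * ((x + 1) * b / L)) + e)) / (x + 1)
      = \<eta> * (1 - (x / (x + 1) * g1 + g2 / L) * b) + e" for g1 g2 L :: real
    proof -
      define v w where "v = 1 / (x + 1)" and "w = 1 / L"
      have "(x + 1) * v = 1" unfolding v_def using x by simp
      then have "(x * (\<eta> * (1 - g1 * b) + e) + (\<eta> * (1 - g2 * ((x + 1) * b * w)) + e)) * v
        = \<eta> * (1 - (x * v * g1 + g2 * w) * b) + e" by algebra
      then show ?thesis unfolding v_def w_def by simp
    qed
    show ?thesis
      unfolding \<beta>1_def \<beta>2_def a'_def x(2) x_def[symmetric] gain.simps using l0 alg by simp
  qed
  have "bilinear TYPE('i \<times> 'w) k \<tau> l a b (\<eta> * (1 - gain k (Suc n) l * b) + e + e)"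
    by (rule bilinear_lower_degree[OF dec[OF Suc.prems(1,2)] Suc.prems(1,2) \<tau> Suc.prems(3) b1 a'_def a'1 Suc.prems(5) e 3[unfolded 4]])
  then show ?case unfolding e_def by (simp add: add.assoc)
qed

section \<open>From short intervals to separated sets\<close>

lemma (in family) moment_reweight_swap:
  "moment (reweight \<mu> q C) r B = moment (reweight \<mu> r B) q C"
  unfolding moment_reweight by (simp add: mult.commute)

definition transversal_bound ::
  "('i \<times> 'w) itself \<Rightarrow> real \<Rightarrow> nat \<Rightarrow> real \<Rightarrow> nat \<Rightarrow> real \<Rightarrow> bool" where
  "transversal_bound T K k \<tau> l \<beta> \<longleftrightarrow>
     (\<forall>(\<Omega> :: 'w set) (f :: 'i \<Rightarrow> 'w \<Rightarrow> complex) A \<mu> \<pi> \<delta> B C.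
        finite \<Omega> \<longrightarrow> family.vin \<Omega> f \<mu> k \<pi> (\<delta> ^ k) A \<longrightarrow> 0 < \<delta> \<longrightarrow> \<delta> \<le> 1 \<longrightarrow> B \<subseteq> A \<longrightarrow> C \<subseteq> A \<longrightarrow>
        (\<forall>i\<in>B. \<forall>j\<in>C. \<tau> \<le> \<bar>\<pi> i - \<pi> j\<bar>) \<longrightarrow>
        family.moment \<Omega> f (family.reweight f \<mu> (tri k - tri l) C) (tri l) B \<le>
          K * \<delta> powr (- \<beta>) * family.gsum \<Omega> f \<mu> (tri k) (cell 0 \<delta> \<pi>) A ^ tri k)"

lemma (in family) transversal_boundD:
  assumes "transversal_bound TYPE('i \<times> 'w) K k \<tau> l \<beta>" "vin \<mu> k \<pi> (\<delta> ^ k) A" "0 < \<delta>" "\<delta> \<le> 1"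
    "B \<subseteq> A" "C \<subseteq> A" "\<forall>i\<in>B. \<forall>j\<in>C. \<tau> \<le> \<bar>\<pi> i - \<pi> j\<bar>"
  shows "moment (reweight \<mu> (tri k - tri l) C) (tri l) B \<le>
    K * \<delta> powr (- \<beta>) * gsum \<mu> (tri k) (cell 0 \<delta> \<pi>) A ^ tri k"
  using assms finite_space unfolding transversal_bound_def by blast

text \<open>Each of \<open>B\<close> and \<open>C\<close> is cut into at most N = 4 / \<delta>^b
  intervals of length \<delta>^b. The triangle inequality, with total power 2 tri k, and the two
  sums over cells cost N^(2 tri k + 2), hence the loss linear in b.\<close>

lemma bilinear_global:
  assumes bil: "bilinear TYPE('i \<times> 'w) k \<tau> l b b \<beta>" and kl: "1 \<le> l" "l < k" and b: "0 < b"
  shows "\<exists>K\<ge>1. transversal_bound TYPE('i \<times> 'w) K k \<tau> l (\<beta> + b * (2 * real (tri k) + 2))"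
proof -
  obtain K where K: "K \<ge> 1" and K': "bilinear_bound TYPE('i \<times> 'w) K k \<tau> l b b \<beta>"
    by (rule bilinearE[OF bil])
  define r q where "r = tri l" and "q = tri k - tri l"
  have rq: "r \<ge> 1" "q \<ge> 1" "r + q = tri k" "tri k \<ge> 1"
    unfolding r_def q_def using tri_less[OF kl(2)] tri_pos[OF kl(1)] by auto
  have "(1::real) \<le> 4 ^ (2 * tri k + 2)" by (rule one_le_power) simp
  then have "1 * 1 \<le> 4 ^ (2 * tri k + 2) * K" using K by (rule mult_mono) auto
  then have K4: "4 ^ (2 * tri k + 2) * K \<ge> 1" by simp
  show ?thesis unfolding transversal_bound_def
  proof (intro exI[of _ "4 ^ (2 * tri k + 2) * K"] conjI K4 allI impI)
    fix \<Omega> :: "'w set" and f :: "'i \<Rightarrow> 'w \<Rightarrow> complex" and A \<mu> \<pi> and \<delta> :: real and B C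
    assume h: "finite \<Omega>" "family.vin \<Omega> f \<mu> k \<pi> (\<delta> ^ k) A" "0 < \<delta>" "\<delta> \<le> 1" "B \<subseteq> A" "C \<subseteq> A"
      "\<forall>i\<in>B. \<forall>j\<in>C. \<tau> \<le> \<bar>\<pi> i - \<pi> j\<bar>"
    interpret family \<Omega> f by unfold_locales (rule h(1))
    note v = vinD[OF h(2)]
    define G where "G = gsum \<mu> (tri k) (cell 0 \<delta> \<pi>)"
    have G0: "0 \<le> G D" for D unfolding G_def by (rule gsum_nonneg[OF v(2)])
    have GA: "G D \<le> G A" if "D \<subseteq> A" for D
      unfolding G_def by (rule gsum_mono[OF v(4) that order_refl v(1) rq(4) v(2)])
    define H where "H = \<delta> powr b"
    have H: "0 < H" "H \<le> 1" unfolding H_def using h(3,4) b powr_mono'[of 0 b \<delta>] by auto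
    define N where "N = 4 / H"
    have N: "N \<ge> 0" unfolding N_def using H by simp
    define \<kappa> where "\<kappa> = cell 0 H \<pi>"
    define B' where "B' n = {i\<in>B. \<kappa> i = n}" for n
    define C' where "C' n = {i\<in>C. \<kappa> i = n}" for n
    have fin: "finite B" "finite C" using finite_subset[OF h(5) v(1)] finite_subset[OF h(6) v(1)] by auto
    have card: "real (card (\<kappa> ` D)) \<le> N" if "D \<subseteq> A" for D
    proof -
      have "real (card (\<kappa> ` D)) \<le> 2 / H + 2"
        unfolding \<kappa>_def
        by (rule card_cell_le[OF finite_subset[OF that v(1)] vin_diam_le[OF h(2) that]]) (use H in auto)
      also have "\<dots> \<le> N" unfolding N_def using H by (simp add: field_simps)
      finally show ?thesis .
    qed
    define X where "X = K * \<delta> powr (- \<beta>) * G A ^ tri k"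
    have X0: "X \<ge> 0" unfolding X_def using K G0 by simp
    have cell: "moment (reweight \<mu> q (C' n')) r (B' n) \<le> X" for n n'
    proof -
      have sub: "B' n \<subseteq> A" "C' n' \<subseteq> A" unfolding B'_def C'_def using h(5,6) by auto
      have "moment (reweight \<mu> q (C' n')) r (B' n) \<le> K * \<delta> powr (- \<beta>) * (G (B' n) ^ r * G (C' n') ^ q)"
        unfolding q_def r_def G_def
      proof (rule bilinear_boundD[OF K' h(2-4) sub])
        show "diam_le \<pi> (\<delta> powr b) (B' n)" "diam_le \<pi> (\<delta> powr b) (C' n')"
          unfolding H_def[symmetric] B'_def C'_def \<kappa>_def using H by (auto intro: diam_le_cell)
      qed (use h(7) in \<open>auto simp: B'_def C'_def\<close>)
      also have "\<dots> \<le> K * \<delta> powr (- \<beta>) * (G A ^ r * G A ^ q)"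
        using K G0 GA sub by (intro mult_left_mono mult_mono power_mono) auto
      also have "\<dots> = X" unfolding X_def power_add[symmetric] rq(3) ..
      finally show ?thesis .
    qed
    have inner: "moment (reweight \<mu> q C) r (B' n) \<le> N ^ (2 * q) * (N * X)" for n
    proof -
      have "moment (reweight \<mu> r (B' n)) q C \<le> N ^ (2 * q) * (\<Sum>n'\<in>\<kappa> ` C. moment (reweight \<mu> r (B' n)) q (C' n'))"
        unfolding C'_def by (rule moment_split[OF fin(2) wt_reweight[OF v(2)] card[OF h(6)] rq(2)])
      also have "\<dots> \<le> N ^ (2 * q) * (\<Sum>n'\<in>\<kappa> ` C. X)"
        unfolding moment_reweight_swap[of _ r] using N cell by (intro mult_left_mono sum_mono) auto
      also have "\<dots> \<le> N ^ (2 * q) * (N * X)"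
        using card[OF h(6)] N X0 by (intro mult_left_mono) (auto intro: mult_right_mono)
      finally show ?thesis unfolding moment_reweight_swap[of _ r] .
    qed
    have "moment (reweight \<mu> q C) r B \<le> N ^ (2 * r) * (\<Sum>n\<in>\<kappa> ` B. moment (reweight \<mu> q C) r (B' n))"
      unfolding B'_def by (rule moment_split[OF fin(1) wt_reweight[OF v(2)] card[OF h(5)] rq(1)])
    also have "\<dots> \<le> N ^ (2 * r) * (\<Sum>n\<in>\<kappa> ` B. N ^ (2 * q) * (N * X))"
      using N inner by (intro mult_left_mono sum_mono) auto
    also have "\<dots> \<le> N ^ (2 * r) * (N * (N ^ (2 * q) * (N * X)))"
      using card[OF h(5)] N X0 by (intro mult_left_mono) (auto intro!: mult_right_mono)
    also have "\<dots> = N ^ (2 * (r + q) + 2) * X" by (simp add: power_add power2_eq_square mult_ac)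
    also have "\<dots> = 4 ^ (2 * tri k + 2) * K * (inverse H ^ (2 * tri k + 2) * \<delta> powr (- \<beta>)) * G A ^ tri k"
      unfolding rq(3) N_def X_def divide_inverse power_mult_distrib by (simp only: mult_ac)
    also have "inverse H ^ (2 * tri k + 2) = \<delta> powr (- (b * (2 * real (tri k) + 2)))"
    proof -
      have "inverse H = \<delta> powr (- b)" unfolding H_def by (simp add: powr_minus)
      then have "inverse H ^ (2 * tri k + 2) = \<delta> powr (real (2 * tri k + 2) * (- b))"
        using h(3) by (simp only: powr_power[OF less_imp_neq[OF h(3), symmetric]])
      also have "real (2 * tri k + 2) * (- b) = - (b * (2 * real (tri k) + 2))" by (simp add: algebra_simps)
      finally show ?thesis .
    qed
    also have "\<delta> powr (- (b * (2 * real (tri k) + 2))) * \<delta> powr (- \<beta>) = \<delta> powr (- (\<beta> + b * (2 * real (tri k) + 2)))"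
      by (simp add: powr_add[symmetric] algebra_simps)
    finally show "moment (reweight \<mu> (tri k - tri l) C) (tri l) B \<le>
      4 ^ (2 * tri k + 2) * K * \<delta> powr (- (\<beta> + b * (2 * real (tri k) + 2))) * gsum \<mu> (tri k) (cell 0 \<delta> \<pi>) A ^ tri k"
      unfolding r_def q_def G_def .
  qed
qed

text \<open>Let x be the largest norm, attained at n0. If all pieces not adjacent to n0 are at most
  x / N, they contribute at most x together, and n0 with its two neighbours at most 3 x; the 16 is
  the square of this 4. Otherwise some piece not adjacent to n0 has norm at least x / N, and then
  either of the two pieces bounds the whole sum up to a factor N^2.\<close>

lemma broad_narrow:
  fixes F :: "int \<Rightarrow> complex"
  assumes S: "finite S" "real (card S) \<le> N" "1 \<le> N" and r: "r \<le> T" "1 \<le> T"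
  shows "norm (\<Sum>n\<in>S. F n) ^ (2 * T) \<le> 16 ^ T * (\<Sum>n\<in>S. norm (F n) ^ (2 * T))
    + N ^ (4 * T) * (\<Sum>(n, n')\<in>{(n, n')\<in>S \<times> S. 2 \<le> \<bar>n - n'\<bar>}. norm (F n) ^ (2 * r) * norm (F n') ^ (2 * (T - r)))"
    (is "?L \<le> 16 ^ T * ?A + N ^ (4 * T) * ?B")
proof (cases "S = {}")
  case True
  then show ?thesis using r by (simp add: zero_power)
next
  case False
  have A0: "?A \<ge> 0" by (intro sum_nonneg) auto
  have B0: "?B \<ge> 0" by (intro sum_nonneg) auto
  define x where "x = Max ((\<lambda>n. norm (F n)) ` S)"
  have "x \<in> (\<lambda>n. norm (F n)) ` S" unfolding x_def by (rule Max_in) (use S False in auto)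
  then obtain n0 where n0: "n0 \<in> S" "norm (F n0) = x" by auto
  have le: "norm (F n) \<le> x" if "n \<in> S" for n unfolding x_def using S that by auto
  have x0: "x \<ge> 0" using n0 by auto
  have tri: "norm (\<Sum>n\<in>S. F n) \<le> (\<Sum>n\<in>S. norm (F n))" by (rule norm_sum)
  show ?thesis
  proof (cases "\<forall>n\<in>S. 2 \<le> \<bar>n0 - n\<bar> \<longrightarrow> norm (F n) \<le> x / N")
    case True
    have "(\<Sum>n\<in>S. norm (F n)) = (\<Sum>n\<in>{n\<in>S. 2 \<le> \<bar>n0 - n\<bar>}. norm (F n)) + (\<Sum>n\<in>{n\<in>S. \<not> 2 \<le> \<bar>n0 - n\<bar>}. norm (F n))"
      using sum.inter_filter[OF S(1), of "\<lambda>n. norm (F n)" "\<lambda>n. 2 \<le> \<bar>n0 - n\<bar>"]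
        sum.inter_filter[OF S(1), of "\<lambda>n. norm (F n)" "\<lambda>n. \<not> 2 \<le> \<bar>n0 - n\<bar>"]
      by (simp add: sum.distrib[symmetric]) (intro sum.cong refl, auto)
    also have "\<dots> \<le> x + 3 * x"
    proof (rule add_mono)
      have "(\<Sum>n\<in>{n\<in>S. 2 \<le> \<bar>n0 - n\<bar>}. norm (F n)) \<le> (\<Sum>n\<in>{n\<in>S. 2 \<le> \<bar>n0 - n\<bar>}. x / N)"
        using True by (intro sum_mono) auto
      also have "\<dots> = real (card {n\<in>S. 2 \<le> \<bar>n0 - n\<bar>}) * (x / N)" by simp
      also have "\<dots> \<le> N * (x / N)"
      proof (rule mult_right_mono)
        have "card {n\<in>S. 2 \<le> \<bar>n0 - n\<bar>} \<le> card S" using S by (intro card_mono) auto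
        then show "real (card {n\<in>S. 2 \<le> \<bar>n0 - n\<bar>}) \<le> N" using S(2) by linarith
      qed (use x0 S in auto)
      also have "\<dots> = x" using S(3) by simp
      finally show "(\<Sum>n\<in>{n\<in>S. 2 \<le> \<bar>n0 - n\<bar>}. norm (F n)) \<le> x" .
      have "(\<Sum>n\<in>{n\<in>S. \<not> 2 \<le> \<bar>n0 - n\<bar>}. norm (F n)) \<le> (\<Sum>n\<in>{n\<in>S. \<not> 2 \<le> \<bar>n0 - n\<bar>}. x)"
        using le by (intro sum_mono) auto
      also have "\<dots> = real (card {n\<in>S. \<not> 2 \<le> \<bar>n0 - n\<bar>}) * x" by simp
      also have "\<dots> \<le> 3 * x"
      proof (rule mult_right_mono[OF _ x0])
        have "card {n\<in>S. \<not> 2 \<le> \<bar>n0 - n\<bar>} \<le> card {n0 - 1..n0 + 1}" by (intro card_mono) auto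
        then show "real (card {n\<in>S. \<not> 2 \<le> \<bar>n0 - n\<bar>}) \<le> 3" by simp
      qed
      finally show "(\<Sum>n\<in>{n\<in>S. \<not> 2 \<le> \<bar>n0 - n\<bar>}. norm (F n)) \<le> 3 * x" .
    qed
    finally have "norm (\<Sum>n\<in>S. F n) \<le> 4 * x" using tri by simp
    then have "?L \<le> (4 * x) ^ (2 * T)" by (intro power_mono) auto
    also have "\<dots> = 16 ^ T * norm (F n0) ^ (2 * T)" unfolding n0 by (simp add: power_mult_distrib power_mult)
    also have "\<dots> \<le> 16 ^ T * ?A" using S n0(1) by (intro mult_left_mono member_le_sum) auto
    also have "\<dots> \<le> 16 ^ T * ?A + N ^ (4 * T) * ?B" using B0 S(3) by simp
    finally show ?thesis .
  next
    case False
    then obtain n where n: "n \<in> S" "2 \<le> \<bar>n0 - n\<bar>" "x / N \<le> norm (F n)" by auto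
    have "norm (\<Sum>n\<in>S. F n) \<le> (\<Sum>n\<in>S. x)" using tri le by (rule_tac order_trans[OF tri sum_mono]) auto
    also have "\<dots> = real (card S) * x" by simp
    also have "\<dots> \<le> N * x" using S x0 by (intro mult_right_mono) auto
    finally have 1: "norm (\<Sum>n\<in>S. F n) \<le> N * x" .
    have "N * x \<le> N * N * x" using S(3) x0 mult_right_mono[of 1 N "N * x"] by (simp add: mult.assoc)
    then have 2: "norm (\<Sum>n\<in>S. F n) \<le> N\<^sup>2 * norm (F n0)" using 1 n0 by (simp add: power2_eq_square)
    have "x \<le> N * norm (F n)" using n(3) S(3) by (simp add: field_simps)
    then have "N * x \<le> N * (N * norm (F n))" using S(3) by (intro mult_left_mono) auto
    then have 3: "norm (\<Sum>n\<in>S. F n) \<le> N\<^sup>2 * norm (F n)" using 1 by (simp add: power2_eq_square mult.assoc)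
    have "?L = norm (\<Sum>n\<in>S. F n) ^ (2 * r) * norm (\<Sum>n\<in>S. F n) ^ (2 * (T - r))"
      using r by (simp add: power_add[symmetric] distrib_left[symmetric] del: mult_Suc_right)
    also have "\<dots> \<le> (N\<^sup>2 * norm (F n0)) ^ (2 * r) * (N\<^sup>2 * norm (F n)) ^ (2 * (T - r))"
      using 2 3 by (intro mult_mono power_mono) auto
    also have "\<dots> = (N\<^sup>2) ^ (2 * r + 2 * (T - r)) * (norm (F n0) ^ (2 * r) * norm (F n) ^ (2 * (T - r)))"
      unfolding power_mult_distrib power_add by (simp only: mult_ac)
    also have "2 * r + 2 * (T - r) = 2 * T" using r by simp
    also have "(N\<^sup>2) ^ (2 * T) = N ^ (4 * T)" by (simp add: power_mult[symmetric])
    also have "N ^ (4 * T) * (norm (F n0) ^ (2 * r) * norm (F n) ^ (2 * (T - r))) \<le> N ^ (4 * T) * ?B"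
    proof (rule mult_left_mono)
      have fin: "finite {(n, n')\<in>S \<times> S. 2 \<le> \<bar>n - n'\<bar>}"
        by (rule finite_subset[of _ "S \<times> S"]) (use S in auto)
      have "(n0, n) \<in> {(n, n')\<in>S \<times> S. 2 \<le> \<bar>n - n'\<bar>}" using n n0 by auto
      from member_le_sum[OF this _ fin, of "\<lambda>(n, n'). norm (F n) ^ (2 * r) * norm (F n') ^ (2 * (T - r))"]
      show "norm (F n0) ^ (2 * r) * norm (F n) ^ (2 * (T - r)) \<le> ?B" by auto
    qed (use S in auto)
    also have "\<dots> \<le> 16 ^ T * ?A + N ^ (4 * T) * ?B" using A0 by simp
    finally show ?thesis .
  qed
qed

section \<open>Vanishing of the decoupling exponent\<close>

text \<open>Induction on scales. Single pieces of length 1 / m are rescaled and decoupled at the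
  coarser scale 2 m \<delta>, which gains (2 m)^-\<beta> against a loss that does not depend on m.
  For large m this leaves half of the constant to the separated pairs, which the transversal bound
  controls.\<close>

lemma dec_exponent_of_transversal:
  assumes k: "k \<ge> 1" and l: "l \<le> k" and \<beta>: "\<beta> > 0"
    and bil: "\<And>\<tau>. 0 < \<tau> \<Longrightarrow> \<tau> \<le> 1 \<Longrightarrow> \<exists>K\<ge>1. transversal_bound TYPE('i \<times> 'w) K k \<tau> l \<beta>"
  shows "dec_exponent TYPE('i \<times> 'w) k \<beta>"
proof -
  define T where "T = tri k"
  have T1: "T \<ge> 1" unfolding T_def by (rule tri_pos[OF k])
  have lT: "tri l \<le> T" unfolding T_def by (rule tri_mono[OF l])
  \<comment> \<open>1920 = 16 * 40 * 3, from \<open>broad_narrow\<close>,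
    \<open>moment_local\<close> and the overlap of the grids.\<close>
  obtain M :: nat where M1: "M \<ge> 1" and M: "(2 * real M) powr \<beta> \<ge> 2 * 1920 ^ T"
  proof -
    obtain M :: nat where M: "real M \<ge> max 1 ((2 * 1920 ^ T) powr (1 / \<beta>))" using real_arch_simple by blast
    have "2 * 1920 ^ T = ((2 * 1920 ^ T) powr (1 / \<beta>)) powr \<beta>" using \<beta> by (simp add: powr_powr)
    also have "\<dots> \<le> (2 * real M) powr \<beta>" using M \<beta> by (intro powr_mono2) auto
    finally show thesis using that[of M] M by auto
  qed
  define m where "m = real M"
  have m: "m \<ge> 1" "m > 0" unfolding m_def using M1 by auto
  have mM: "1920 ^ T * (2 * m) powr (- \<beta>) \<le> 1 / 2"
    using M m unfolding m_def[symmetric] by (simp add: powr_minus field_simps)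
  obtain K where K: "K \<ge> 1" and K': "transversal_bound TYPE('i \<times> 'w) K k (1 / m) l \<beta>"
    using bil[of "1 / m"] m by auto
  define N where "N = 2 * m + 2"
  have N: "N \<ge> 1" unfolding N_def using m by simp
  \<comment> \<open>The first entry covers the trivial bound for scales at least 1 / (2 m), where
    the induction starts; the second makes the contribution of separated pairs at most half of
    \<open>C1\<close>.\<close>
  define C1 where "C1 = max (16 ^ T * (2 * m) ^ (2 * T)) (2 * (N ^ (4 * T) * (N\<^sup>2 * K)))"
  have NK: "N ^ (4 * T) * (N\<^sup>2 * K) \<le> C1 / 2" unfolding C1_def by simp
  have C1b: "16 ^ T * (2 * m) ^ (2 * T) \<le> C1" unfolding C1_def by simp
  have "1 * 1 \<le> 16 ^ T * (2 * m) ^ (2 * T)" using m by (intro mult_mono one_le_power) auto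
  then have C1: "C1 \<ge> 1" using C1b by simp
  have base: "decoupling TYPE('i \<times> 'w) k \<delta> (C1 * \<delta> powr (- \<beta>))" if d: "1 / (2 * m) \<le> \<delta>" "\<delta> \<le> 1" for \<delta>
  proof -
    have "0 < 1 / (2 * m)" using m by simp
    then have d0: "0 < \<delta>" using d by linarith
    have "\<delta> powr (- (2 * real T)) \<le> (1 / (2 * m)) powr (- (2 * real T))"
      using m d by (intro powr_neg_antimono) auto
    also have "\<dots> = (2 * m) powr real (2 * T)" using m by (simp add: powr_minus powr_divide)
    also have "\<dots> = (2 * m) ^ (2 * T)" using m by (intro powr_realpow) auto
    finally have "16 ^ T * \<delta> powr (- (2 * real T)) \<le> 16 ^ T * (2 * m) ^ (2 * T)" by simp
    also have "\<dots> \<le> C1 * 1" using C1b by simp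
    also have "\<dots> \<le> C1 * \<delta> powr (- \<beta>)"
      using C1 powr_neg_antimono[of \<delta> 1 \<beta>] d0 d \<beta> by (intro mult_left_mono) auto
    finally show ?thesis unfolding T_def by (rule decoupling_mono[OF decoupling_trivial[OF k d0 d(2)]])
  qed
  have main: "decoupling TYPE('i \<times> 'w) k \<delta> (C1 * \<delta> powr (- \<beta>))" if "(1 / (2 * m)) ^ j \<le> \<delta>" "\<delta> \<le> 1" for j \<delta>
    using that
  proof (induction j arbitrary: \<delta>)
    case 0
    show ?case by (rule base) (use 0 m in auto)
  next
    case (Suc j)
    have "0 < (1 / (2 * m)) ^ Suc j" using m by simp
    then have d0: "0 < \<delta>" using Suc.prems(1) by linarith
    show ?case
    proof (cases "\<delta> \<ge> 1 / (2 * m)")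
      case True
      then show ?thesis by (rule base) (rule Suc.prems)
    next
      case False
      then have small: "2 * m * \<delta> \<le> 1" using m by (simp add: field_simps)
      have IH: "decoupling TYPE('i \<times> 'w) k (2 * m * \<delta>) (C1 * (2 * m * \<delta>) powr (- \<beta>))"
      proof (rule Suc.IH[OF _ small])
        have "(1 / (2 * m)) ^ j = 2 * m * (1 / (2 * m)) ^ Suc j" using m by simp
        also have "\<dots> \<le> 2 * m * \<delta>" using Suc.prems m by (intro mult_left_mono) auto
        finally show "(1 / (2 * m)) ^ j \<le> 2 * m * \<delta>" .
      qed
      show ?thesis unfolding decoupling_def
      proof (intro allI impI)
        fix \<Omega> :: "'w set" and f :: "'i \<Rightarrow> 'w \<Rightarrow> complex" and A \<mu> \<pi>
        assume h: "finite \<Omega>" "family.vin \<Omega> f \<mu> k \<pi> (\<delta> ^ k) A"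
        interpret family \<Omega> f by unfold_locales (rule h(1))
        note v = vinD[OF h(2)]
        define G where "G = gsum \<mu> T (cell 0 \<delta> \<pi>)"
        have G0: "0 \<le> G D" for D unfolding G_def by (rule gsum_nonneg[OF v(2)])
        define \<kappa> where "\<kappa> = cell 0 (1 / m) \<pi>"
        define P where "P n = {i\<in>A. \<kappa> i = n}" for n
        define S where "S = \<kappa> ` A"
        define far where "far = {(n, n')\<in>S \<times> S. 2 \<le> \<bar>n - n'\<bar>}"
        have PA: "P n \<subseteq> A" for n unfolding P_def by auto
        have finS: "finite S" unfolding S_def using v(1) by simp
        have finfar: "finite far" unfolding far_def by (rule finite_subset[of _ "S \<times> S"]) (use finS in auto)
        have cardS: "real (card S) \<le> N"
        proof -
          have "real (card S) \<le> 2 / (1 / m) + 2" unfolding S_def \<kappa>_def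
            by (rule card_cell_le[OF v(1) vin_diam_le[OF h(2) order_refl]]) (use m in auto)
          then show ?thesis unfolding N_def by simp
        qed
        have cardfar: "real (card far) \<le> N\<^sup>2"
        proof -
          have "card far \<le> card (S \<times> S)" unfolding far_def using finS by (intro card_mono) auto
          then have "real (card far) \<le> real (card S) * real (card S)" by (simp add: card_cartesian_product of_nat_mult[symmetric] del: of_nat_mult)
          also have "\<dots> \<le> N * N" using cardS by (intro mult_mono) auto
          finally show ?thesis by (simp add: power2_eq_square)
        qed
        have near: "(\<Sum>n\<in>S. moment \<mu> T (P n)) \<le> C1 * (2 * m * \<delta>) powr (- \<beta>) * 40 ^ T * 3 ^ T * G A ^ T"
        proof -
          define D where "D = C1 * (2 * m * \<delta>) powr (- \<beta>) * 40 ^ T"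
          have D0: "D \<ge> 0" unfolding D_def using C1 by simp
          have "moment \<mu> T (P n) \<le> D * G (P n) ^ T" for n
            unfolding D_def G_def T_def
          proof (rule moment_local[OF _ _ k h(2) d0 _ _ PA])
            show "decoupling TYPE('i \<times> 'w) k (2 * \<delta> / (1 / m)) (C1 * (2 * m * \<delta>) powr (- \<beta>))"
              using IH by (simp add: mult_ac)
            show "diam_le \<pi> (1 / m) (P n)" unfolding P_def \<kappa>_def by (rule diam_le_cell) (use m in simp)
          qed (use C1 m in auto)
          then have "(\<Sum>n\<in>S. moment \<mu> T (P n)) \<le> (\<Sum>n\<in>S. D * G (P n) ^ T)" by (intro sum_mono)
          also have "\<dots> = D * (\<Sum>n\<in>S. G (P n) ^ T)" by (simp add: sum_distrib_left)
          also have "\<dots> \<le> D * (\<Sum>n\<in>S. G (P n)) ^ T"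
            using D0 finS G0 T1 by (intro mult_left_mono sum_power_le_power_sum) auto
          also have "\<dots> \<le> D * (3 * G A) ^ T"
          proof (intro mult_left_mono power_mono D0)
            show "(\<Sum>n\<in>S. G (P n)) \<le> 3 * G A"
              unfolding S_def G_def P_def \<kappa>_def
            proof (rule gsum_cell_superadditive[OF _ order_refl v(1) T1 v(2) _ d0])
              show "\<delta> \<le> 1 / m" using small m d0 by (simp add: field_simps)
            qed (use v(4) m in \<open>auto simp: T_def\<close>)
          qed (use G0 in \<open>auto intro: sum_nonneg\<close>)
          finally show ?thesis unfolding D_def by (simp add: power_mult_distrib mult_ac)
        qed
        have far1: "av \<mu> (\<lambda>w. norm (F (P n) w) ^ (2 * tri l) * norm (F (P n') w) ^ (2 * (T - tri l))) \<le> K * \<delta> powr (- \<beta>) * G A ^ T"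
          if "(n, n') \<in> far" for n n'
        proof -
          have nn: "2 \<le> \<bar>n - n'\<bar>" using that unfolding far_def by auto
          have sep: "\<forall>i\<in>P n. \<forall>j\<in>P n'. 1 / m \<le> \<bar>\<pi> i - \<pi> j\<bar>"
          proof (intro ballI)
            fix i j assume "i \<in> P n" "j \<in> P n'"
            then have "n = \<lfloor>m * \<pi> i\<rfloor>" "n' = \<lfloor>m * \<pi> j\<rfloor>" unfolding P_def \<kappa>_def cell_def by (auto simp: mult.commute)
            then have "1 \<le> \<bar>m * \<pi> i - m * \<pi> j\<bar>" using nn by linarith
            also have "\<dots> = m * \<bar>\<pi> i - \<pi> j\<bar>" using m by (simp add: right_diff_distrib[symmetric] abs_mult)
            finally show "1 / m \<le> \<bar>\<pi> i - \<pi> j\<bar>" using m by (simp add: field_simps)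
          qed
          show ?thesis
            using transversal_boundD[OF K' h(2) d0 Suc.prems(2) PA PA sep] unfolding moment_reweight G_def T_def .
        qed
        have "moment \<mu> T A \<le> av \<mu> (\<lambda>w. 16 ^ T * (\<Sum>n\<in>S. norm (F (P n) w) ^ (2 * T))
          + N ^ (4 * T) * (\<Sum>p\<in>far. norm (F (P (fst p)) w) ^ (2 * tri l) * norm (F (P (snd p)) w) ^ (2 * (T - tri l))))"
          unfolding moment_def
        proof (rule av_mono[OF v(2)])
          fix w
          have "F A w = (\<Sum>n\<in>S. F (P n) w)" unfolding S_def P_def by (rule F_partition[OF v(1)])
          then show "norm (F A w) ^ (2 * T) \<le> 16 ^ T * (\<Sum>n\<in>S. norm (F (P n) w) ^ (2 * T))
            + N ^ (4 * T) * (\<Sum>p\<in>far. norm (F (P (fst p)) w) ^ (2 * tri l) * norm (F (P (snd p)) w) ^ (2 * (T - tri l)))"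
            using broad_narrow[OF finS cardS N lT T1, of "\<lambda>n. F (P n) w"] unfolding far_def
            by (simp add: case_prod_unfold)
        qed
        also have "\<dots> = 16 ^ T * (\<Sum>n\<in>S. moment \<mu> T (P n))
          + N ^ (4 * T) * (\<Sum>p\<in>far. av \<mu> (\<lambda>w. norm (F (P (fst p)) w) ^ (2 * tri l) * norm (F (P (snd p)) w) ^ (2 * (T - tri l))))"
          unfolding moment_def by (simp only: av_add av_cmult av_sum[OF finS] av_sum[OF finfar])
        also have "\<dots> \<le> 16 ^ T * (C1 * (2 * m * \<delta>) powr (- \<beta>) * 40 ^ T * 3 ^ T * G A ^ T)
          + N ^ (4 * T) * (N\<^sup>2 * (K * \<delta> powr (- \<beta>) * G A ^ T))"
        proof (intro add_mono mult_left_mono near)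
          have "(\<Sum>p\<in>far. av \<mu> (\<lambda>w. norm (F (P (fst p)) w) ^ (2 * tri l) * norm (F (P (snd p)) w) ^ (2 * (T - tri l))))
            \<le> (\<Sum>p\<in>far. K * \<delta> powr (- \<beta>) * G A ^ T)" by (intro sum_mono far1) simp
          also have "\<dots> = real (card far) * (K * \<delta> powr (- \<beta>) * G A ^ T)" by simp
          also have "\<dots> \<le> N\<^sup>2 * (K * \<delta> powr (- \<beta>) * G A ^ T)"
            using cardfar K G0 by (intro mult_right_mono) auto
          finally show "(\<Sum>p\<in>far. av \<mu> (\<lambda>w. norm (F (P (fst p)) w) ^ (2 * tri l) * norm (F (P (snd p)) w) ^ (2 * (T - tri l))))
            \<le> N\<^sup>2 * (K * \<delta> powr (- \<beta>) * G A ^ T)" .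
        qed (use N in auto)
        also have "\<dots> = (C1 * (1920 ^ T * (2 * m) powr (- \<beta>)) + N ^ (4 * T) * (N\<^sup>2 * K)) * (\<delta> powr (- \<beta>) * G A ^ T)"
        proof -
          have p: "(2 * m * \<delta>) powr (- \<beta>) = (2 * m) powr (- \<beta>) * \<delta> powr (- \<beta>)" using m d0 by (simp add: powr_mult)
          have q: "(1920::real) ^ T = 16 ^ T * 40 ^ T * 3 ^ T" by (simp add: power_mult_distrib[symmetric])
          show ?thesis unfolding p q by (simp only: distrib_left distrib_right mult_ac)
        qed
        also have "\<dots> \<le> (C1 * (1 / 2) + C1 / 2) * (\<delta> powr (- \<beta>) * G A ^ T)"
          using mM NK C1 G0 by (intro mult_right_mono add_mono mult_left_mono) auto
        also have "\<dots> = C1 * \<delta> powr (- \<beta>) * G A ^ T" by (simp add: algebra_simps)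
        finally show "moment \<mu> (tri k) A \<le> C1 * \<delta> powr (- \<beta>) * gsum \<mu> (tri k) (cell 0 \<delta> \<pi>) A ^ tri k"
          unfolding G_def T_def .
      qed
    qed
  qed
  show ?thesis unfolding dec_exponent_def
  proof (intro exI[of _ C1] conjI C1 allI impI)
    fix \<delta> :: real assume d: "0 < \<delta>" "\<delta> \<le> 1"
    obtain j where "(1 / (2 * m)) ^ j < \<delta>" using real_arch_pow_inv[OF d(1), of "1 / (2 * m)"] m by auto
    then show "decoupling TYPE('i \<times> 'w) k \<delta> (C1 * \<delta> powr (- \<beta>))"
      by (rule main[OF less_imp_le d(2)])
  qed
qed

lemma dec_exponent_improve:
  assumes k: "k \<ge> 2"
    and dec: "\<And>l \<epsilon>. 1 \<le> l \<Longrightarrow> l < k \<Longrightarrow> \<epsilon> > 0 \<Longrightarrow> dec_exponent TYPE('i \<times> 'w) l \<epsilon>"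
    and \<eta>: "dec_exponent TYPE('i \<times> 'w) k \<eta>" "\<eta> \<ge> 0" and "\<epsilon> > 0" "\<beta> > 0"
    and b: "b = 1 / real k ^ (n + 1)"
    and \<beta>: "\<eta> * (1 - real n / real k * b) + \<epsilon> + b * (2 * real (tri k) + 2) \<le> \<beta>"
  shows "dec_exponent TYPE('i \<times> 'w) k \<beta>"
proof -
  obtain l where l: "1 \<le> l" "l < k" "gain k n l \<ge> real n / real k" by (rule ex_large_gain[OF k])
  have b0: "b > 0" unfolding b using k by simp
  define \<beta>' where "\<beta>' = \<beta> - b * (2 * real (tri k) + 2)"
  have le: "\<eta> * (1 - gain k n l * b) + \<epsilon> \<le> \<beta>'"
  proof -
    have "real n / real k * b \<le> gain k n l * b" using l(3) b0 by (intro mult_right_mono) auto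
    then have "\<eta> * (1 - gain k n l * b) \<le> \<eta> * (1 - real n / real k * b)" using \<eta>(2) by (intro mult_left_mono) auto
    then show ?thesis unfolding \<beta>'_def using \<beta> by linarith
  qed
  have bb: "\<beta>' + b * (2 * real (tri k) + 2) = \<beta>" unfolding \<beta>'_def by simp
  show ?thesis
  proof (rule dec_exponent_of_transversal[of k l])
    fix \<tau> :: real assume \<tau>: "0 < \<tau>" "\<tau> \<le> 1"
    have "bilinear TYPE('i \<times> 'w) k \<tau> l b b (\<eta> * (1 - gain k n l * b) + \<epsilon>)"
      by (rule bilinear_iterate[OF k dec \<eta> \<tau> l(1,2) b0 _ b0 \<open>\<epsilon> > 0\<close>]) (auto simp: b)
    then have "bilinear TYPE('i \<times> 'w) k \<tau> l b b \<beta>'" by (rule bilinear_mono[OF _ le order_refl])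
    from bilinear_global[OF this l(1,2) b0, unfolded bb]
    show "\<exists>K\<ge>1. transversal_bound TYPE('i \<times> 'w) K k \<tau> l \<beta>" .
  qed (use k l \<open>\<beta> > 0\<close> in auto)
qed

theorem dec_exponent_arbitrary:
  assumes "k \<ge> 1" "\<epsilon> > 0"
  shows "dec_exponent TYPE('i \<times> 'w) k \<epsilon>"
  using assms
proof (induction k arbitrary: \<epsilon> rule: less_induct)
  case (less k)
  show ?case
  proof (cases "k = 1")
    case True
    then show ?thesis using dec_exponent_1[of \<epsilon>, where ?'i = 'i and ?'w = 'w] less.prems by simp
  next
    case False
    then have k: "k \<ge> 2" using less.prems by simp
    have dec: "dec_exponent TYPE('i \<times> 'w) l e" if "1 \<le> l" "l < k" "e > 0" for l e
      using less.IH that by blast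
    define S where "S = {\<eta>. \<eta> > 0 \<and> dec_exponent TYPE('i \<times> 'w) k \<eta>}"
    have "2 * real (tri k) \<in> S" unfolding S_def
      using dec_exponent_trivial[of k, where ?'i = 'i and ?'w = 'w] tri_pos[of k] less.prems by auto
    then have ne: "S \<noteq> {}" by auto
    have bdd: "bdd_below S" unfolding S_def by (auto intro: bdd_belowI[of _ 0])
    define \<eta>0 where "\<eta>0 = Inf S"
    have "\<eta>0 \<le> 0"
    proof (rule ccontr)
      assume "\<not> \<eta>0 \<le> 0"
      then have pos: "\<eta>0 > 0" by simp
      define Q where "Q = 2 * real (tri k) + 2"
      \<comment> \<open>The order of choices matters: n, and with it b, depends on the infimum
        alone, so \<eta> can afterwards be taken within b / 2 of it. The improvement is at least 7 b
        / 4 and thus leads below the infimum.\<close>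
      obtain n :: nat where n: "real n \<ge> (Q + 2) * real k / \<eta>0" using real_arch_simple by blast
      define b where "b = 1 / real k ^ (n + 1)"
      have b0: "b > 0" unfolding b_def using k by simp
      obtain \<eta> where \<eta>: "\<eta> \<in> S" "\<eta> < \<eta>0 + b / 2"
        using cInf_lessD[OF ne, of "\<eta>0 + b / 2"] b0 unfolding \<eta>0_def by auto
      have \<eta>le: "\<eta>0 \<le> \<eta>" unfolding \<eta>0_def by (rule cInf_lower[OF \<eta>(1) bdd])
      \<comment> \<open>The maximum keeps \<beta> positive, as membership in \<open>S\<close>
        demands, without reaching the infimum.\<close>
      define \<beta> where "\<beta> = max (\<eta>0 / 2) (\<eta> * (1 - real n / real k * b) + b / 4 + b * Q)"
      have "Q + 2 \<le> real n / real k * \<eta>0" using n pos k by (simp add: field_simps)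
      also have "\<dots> \<le> real n / real k * \<eta>" using \<eta>le by (intro mult_left_mono) auto
      finally have "(Q + 2) * b \<le> real n / real k * \<eta> * b" using b0 by (intro mult_right_mono) auto
      then have "\<eta> * (1 - real n / real k * b) + b / 4 + b * Q \<le> \<eta> + b / 4 - 2 * b"
        by (simp add: algebra_simps)
      also have "\<dots> < \<eta>0" using \<eta>(2) b0 by simp
      finally have "\<beta> < \<eta>0" unfolding \<beta>_def using pos by simp
      moreover have \<beta>0: "\<beta> > 0" unfolding \<beta>_def using pos by simp
      have "dec_exponent TYPE('i \<times> 'w) k \<beta>"
      proof (rule dec_exponent_improve[OF k dec _ _ _ \<beta>0 b_def])
        show "\<eta> * (1 - real n / real k * b) + b / 4 + b * (2 * real (tri k) + 2) \<le> \<beta>"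
          unfolding \<beta>_def Q_def by simp
      qed (use \<eta>(1) b0 in \<open>auto simp: S_def\<close>)
      then have "\<beta> \<in> S" unfolding S_def using \<beta>0 by simp
      then have "\<eta>0 \<le> \<beta>" unfolding \<eta>0_def by (rule cInf_lower[OF _ bdd])
      ultimately show False by simp
    qed
    then obtain \<eta> where "\<eta> \<in> S" "\<eta> < \<epsilon>"
      using cInf_lessD[OF ne, of \<epsilon>] less.prems unfolding \<eta>0_def by auto
    then show ?thesis unfolding S_def by (auto intro: dec_exponent_mono)
  qed
qed

section \<open>Well-spaced sets\<close>

abbreviation same_psums :: "nat \<Rightarrow> real list \<Rightarrow> real list \<Rightarrow> bool" where
  "same_psums k xs ys \<equiv> (\<forall>j\<in>{1..k}. psum (\<lambda>a. a) j xs = psum (\<lambda>a. a) j ys)"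

text \<open>
  The sample space is the power set of the finite set \<open>V\<close> of nonzero difference vectors, and
  \<open>t v\<close> is chosen so that \<open>t v \<bullet> v = pi\<close>: averaging over the points \<open>\<Sum>v\<in>S. t v\<close> with \<open>S \<subseteq> V\<close>
  then kills the character of frequency \<open>v\<close>.
\<close>

lemma exists_exact_family:
  fixes A :: "real set"
  assumes A: "finite A"
  obtains \<Omega> :: "(nat \<Rightarrow> real) set set" and f :: "real \<Rightarrow> (nat \<Rightarrow> real) set \<Rightarrow> complex" and \<mu>
  where "finite \<Omega>" "\<And>w. 0 \<le> \<mu> w" "(\<Sum>w\<in>\<Omega>. \<mu> w) = 1" "\<And>a w. norm (f a w) = 1"
    "\<And>L xs ys. L \<le> n \<Longrightarrow> xs \<in> tup A L \<Longrightarrow> ys \<in> tup A L \<Longrightarrow>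
       family.corr \<Omega> f \<mu> xs ys = (if same_psums k xs ys then 1 else 0)"
proof -
  define d where "d xs ys = (\<lambda>j. if j \<in> {1..k} then psum (\<lambda>a::real. a) j xs - psum (\<lambda>a. a) j ys else 0)" for xs ys
  define V where "V = (\<lambda>(xs, ys). d xs ys) ` (\<Union>L\<in>{..n}. tup A L \<times> tup A L) - {\<lambda>_. 0}"
  have "finite (tup A L)" for L by (rule finite_lists_length_eq[OF A])
  then have finV: "finite V" unfolding V_def by auto
  define t where "t v j = pi * v j / (\<Sum>j\<in>{1..k}. (v j)\<^sup>2)" for v :: "nat \<Rightarrow> real" and j
  define \<theta> where "\<theta> v a = (\<Sum>j\<in>{1..k}. t v j * a ^ j)" for v and a :: real
  define \<Theta> where "\<Theta> v xs = (\<Sum>j\<in>{1..k}. t v j * psum (\<lambda>a. a) j xs)" for v xs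
  define f where "f a S = cis (\<Sum>v\<in>S. \<theta> v a)" for a and S :: "(nat \<Rightarrow> real) set"
  define \<mu> where "\<mu> S = (1 / 2 ^ card V :: real)" for S :: "(nat \<Rightarrow> real) set"
  have pi: "(\<Sum>j\<in>{1..k}. t v j * v j) = pi" if v: "v \<in> V" for v
  proof -
    have "(\<Sum>j\<in>{1..k}. (v j)\<^sup>2) \<noteq> 0"
    proof
      assume "(\<Sum>j\<in>{1..k}. (v j)\<^sup>2) = 0"
      then have 0: "v j = 0" if "j \<in> {1..k}" for j using that by (simp add: sum_nonneg_eq_0_iff)
      have "v j = 0" if "j \<notin> {1..k}" for j using v that unfolding V_def d_def by auto
      then have "v = (\<lambda>_. 0)" using 0 by blast
      then show False using v unfolding V_def by auto
    qed
    then show ?thesis unfolding t_def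
      by (simp add: sum_divide_distrib[symmetric] power2_eq_square mult.assoc sum_distrib_left[symmetric])
  qed
  have \<Theta>Cons: "\<Theta> v (a # xs) = \<theta> v a + \<Theta> v xs" for v a xs
    unfolding \<Theta>_def \<theta>_def by (simp add: distrib_left sum.distrib)
  have prod: "(\<Prod>a\<leftarrow>xs. f a S) = cis (\<Sum>v\<in>S. \<Theta> v xs)" for xs S
  proof (induction xs)
    case Nil
    show ?case by (simp add: \<Theta>_def)
  next
    case (Cons a xs)
    then show ?case by (simp add: \<Theta>Cons f_def cis_mult sum.distrib)
  qed
  have cis_sum: "cis (\<Sum>v\<in>S. g v) = (\<Prod>v\<in>S. cis (g v))" if "finite S" for g and S :: "(nat \<Rightarrow> real) set"
    using that by (induction S rule: finite_induct) (auto simp: cis_mult[symmetric])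
  have finPow: "finite (Pow V)" using finV by simp
  have sum1: "(\<Sum>w\<in>Pow V. \<mu> w) = 1" unfolding \<mu>_def using finV by (simp add: card_Pow)
  interpret family "Pow V" f by unfold_locales (rule finPow)
  have corr: "corr \<mu> xs ys = (if same_psums k xs ys then 1 else 0)" if L: "L \<le> n" "xs \<in> tup A L" "ys \<in> tup A L" for L xs ys
  proof -
    define c where "c v = cis (\<Theta> v xs - \<Theta> v ys)" for v
    have "corr \<mu> xs ys = (\<Sum>S\<in>Pow V. complex_of_real (1 / 2 ^ card V) * (\<Prod>v\<in>S. c v))"
      unfolding corr_def
    proof (rule sum.cong[OF refl])
      fix S assume "S \<in> Pow V"
      then have "S \<subseteq> V" by simp
      then have finS: "finite S" by (rule finite_subset[OF _ finV])
      have "(\<Prod>a\<leftarrow>xs. f a S) * cnj (\<Prod>a\<leftarrow>ys. f a S) = cis (\<Sum>v\<in>S. \<Theta> v xs - \<Theta> v ys)"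
        unfolding prod by (simp add: cis_cnj cis_mult sum_subtractf)
      also have "\<dots> = (\<Prod>v\<in>S. c v)" unfolding c_def by (rule cis_sum[OF finS])
      finally show "complex_of_real (\<mu> S) * (\<Prod>a\<leftarrow>xs. f a S) * cnj (\<Prod>a\<leftarrow>ys. f a S)
        = complex_of_real (1 / 2 ^ card V) * (\<Prod>v\<in>S. c v)"
        unfolding \<mu>_def by (simp only: mult.assoc)
    qed
    \<comment> \<open>A sum over all subsets of V of products over the subset factors into the
      product of the \<open>c v + 1\<close>. If the power sums differ, the factor at their
      difference vector is cis pi + 1 = 0; if they agree, every factor is 2.\<close>
    also have "\<dots> = complex_of_real (1 / 2 ^ card V) * (\<Prod>v\<in>V. c v + 1)"
      unfolding prod_add[OF finV, of c "\<lambda>_. 1"] by (simp add: sum_distrib_left)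
    finally have e: "corr \<mu> xs ys = complex_of_real (1 / 2 ^ card V) * (\<Prod>v\<in>V. c v + 1)" .
    show ?thesis
    proof (cases "same_psums k xs ys")
      case True
      then have "\<Theta> v xs = \<Theta> v ys" for v unfolding \<Theta>_def by simp
      then have "c v = 1" for v unfolding c_def by simp
      then show ?thesis unfolding e using True by simp
    next
      case False
      have "d xs ys \<noteq> (\<lambda>_. 0)"
      proof
        assume 0: "d xs ys = (\<lambda>_. 0)"
        have "psum (\<lambda>a. a) j xs = psum (\<lambda>a. a) j ys" if "j \<in> {1..k}" for j
          using fun_cong[OF 0, of j] that unfolding d_def by simp
        then show False using False by blast
      qed
      then have dV: "d xs ys \<in> V" unfolding V_def using L by (auto intro!: image_eqI[of _ _ "(xs, ys)"])
      have "\<Theta> (d xs ys) xs - \<Theta> (d xs ys) ys = (\<Sum>j\<in>{1..k}. t (d xs ys) j * d xs ys j)"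
        unfolding \<Theta>_def sum_subtractf[symmetric] right_diff_distrib[symmetric]
        by (intro sum.cong refl) (simp add: d_def)
      also have "\<dots> = pi" by (rule pi[OF dV])
      finally have "c (d xs ys) + 1 = 0" unfolding c_def by simp
      then have "(\<Prod>v\<in>V. c v + 1) = 0" using dV finV by (intro prod_zero) auto
      then show ?thesis unfolding e using False by simp
    qed
  qed
  show thesis
    by (rule that[OF finPow _ sum1 _ corr]) (auto simp: \<mu>_def f_def)
qed

lemma mean_value_le_card_tup:
  assumes "finite A"
  shows "mean_value s k A \<le> card {(xs, ys)\<in>tup A s \<times> tup A s. same_psums k xs ys}"
proof -
  define E where "E x = map x [1..<Suc s]" for x :: "nat \<Rightarrow> real"
  have psumE: "psum (\<lambda>a. a) j (E x) = (\<Sum>i=1..s. x i ^ j)" for j x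
  proof -
    have "psum (\<lambda>a. a) j (E x) = (\<Sum>i\<leftarrow>[1..<Suc s]. x i ^ j)" unfolding psum_def E_def by (simp add: comp_def)
    also have "\<dots> = (\<Sum>i\<in>{1..<Suc s}. x i ^ j)" by (simp only: sum_list_distinct_conv_sum_set distinct_upt set_upt)
    also have "{1..<Suc s} = {1..s}" by auto
    finally show ?thesis .
  qed
  have inj: "x = y" if "x \<in> {1..s} \<rightarrow>\<^sub>E A" "y \<in> {1..s} \<rightarrow>\<^sub>E A" "E x = E y" for x y
  proof (rule PiE_ext[OF that(1,2)])
    fix i assume "i \<in> {1..s}"
    then show "x i = y i" using that(3) unfolding E_def by (auto simp del: upt_Suc)
  qed
  have ran: "E x \<in> tup A s" if "x \<in> {1..s} \<rightarrow>\<^sub>E A" for x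
    using that unfolding E_def by (auto simp del: upt_Suc)
  have fin: "finite {(xs, ys)\<in>tup A s \<times> tup A s. same_psums k xs ys}"
    by (rule finite_subset[of _ "tup A s \<times> tup A s"]) (use finite_lists_length_eq[OF assms] in auto)
  show ?thesis unfolding mean_value_def
  proof (rule card_inj_on_le[OF _ _ fin])
    show "inj_on (\<lambda>(x, y). (E x, E y)) {(x, y). x \<in> {1..s} \<rightarrow>\<^sub>E A \<and> y \<in> {1..s} \<rightarrow>\<^sub>E A \<and>
      (\<forall>j\<in>{1..k}. (\<Sum>i=1..s. x i ^ j) = (\<Sum>i=1..s. y i ^ j))}"
      by (rule inj_onI) (use inj in auto)
    show "(\<lambda>(x, y). (E x, E y)) ` {(x, y). x \<in> {1..s} \<rightarrow>\<^sub>E A \<and> y \<in> {1..s} \<rightarrow>\<^sub>E A \<and>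
      (\<forall>j\<in>{1..k}. (\<Sum>i=1..s. x i ^ j) = (\<Sum>i=1..s. y i ^ j))}
      \<subseteq> {(xs, ys)\<in>tup A s \<times> tup A s. same_psums k xs ys}"
    proof (rule image_subsetI)
      fix p assume "p \<in> {(x, y). x \<in> {1..s} \<rightarrow>\<^sub>E A \<and> y \<in> {1..s} \<rightarrow>\<^sub>E A \<and>
        (\<forall>j\<in>{1..k}. (\<Sum>i=1..s. x i ^ j) = (\<Sum>i=1..s. y i ^ j))}"
      then obtain x y where p: "p = (x, y)" "x \<in> {1..s} \<rightarrow>\<^sub>E A" "y \<in> {1..s} \<rightarrow>\<^sub>E A"
        "\<forall>j\<in>{1..k}. (\<Sum>i=1..s. x i ^ j) = (\<Sum>i=1..s. y i ^ j)" by blast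
      then show "(\<lambda>(x, y). (E x, E y)) p \<in> {(xs, ys)\<in>tup A s \<times> tup A s. same_psums k xs ys}"
        using ran[OF p(2)] ran[OF p(3)] by (simp add: psumE)
    qed
  qed
qed

section \<open>Points of well-spaced sets in short intervals\<close>

lemma inj_on_ceiling_well_spaced:
  assumes "well_spaced A"
  shows "inj_on ceiling A"
proof (rule inj_onI)
  fix a b assume ab: "a \<in> A" "b \<in> A" "\<lceil>a\<rceil> = \<lceil>b\<rceil>"
  have finA: "finite A" using assms unfolding well_spaced_def by simp
  \<comment> \<open>The interval (j, j + 1] is the fibre of the ceiling function over j + 1, and for
    a point of \<open>A\<close> this j falls into the range over which well-spacedness is
    required.\<close>
  define j where "j = \<lceil>a\<rceil> - 1"
  have "Inf A \<le> a" "a \<le> Sup A" using finA ab(1) by (auto intro: cInf_lower cSup_upper)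
  moreover have "a - 1 \<le> of_int j" "of_int j \<le> a" unfolding j_def by linarith+
  ultimately have "Inf A - 1 \<le> of_int j \<and> of_int j \<le> Sup A" by linarith
  then have c: "card (A \<inter> {of_int j <.. of_int j + 1}) \<le> 1" using assms unfolding well_spaced_def by blast
  have a: "a \<in> A \<inter> {of_int j <.. of_int j + 1}" using ab(1) unfolding j_def by auto linarith+
  have b: "b \<in> A \<inter> {of_int j <.. of_int j + 1}" using ab(2) unfolding j_def ab(3) by auto linarith+
  have "finite (A \<inter> {of_int j <.. of_int j + 1})" using finA by simp
  then show "a = b" using c a b card_le_Suc0_iff_eq by (metis One_nat_def)
qed

lemma card_well_spaced_le:
  assumes "well_spaced A" "D \<subseteq> A" "\<And>a b. a \<in> D \<Longrightarrow> b \<in> D \<Longrightarrow> \<bar>a - b\<bar> \<le> t" "t \<ge> 0"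
  shows "real (card D) \<le> t + 2"
proof -
  have finD: "finite D" by (rule finite_subset[OF assms(2)]) (use assms(1) in \<open>simp add: well_spaced_def\<close>)
  \<comment> \<open>Reflection turns ceilings into floors, for which \<open>card_floor_le\<close>
    counts the values.\<close>
  have "inj_on (\<lambda>a. \<lfloor>- a\<rfloor>) D"
    by (rule inj_onI) (use inj_on_subset[OF inj_on_ceiling_well_spaced[OF assms(1)] assms(2)] in \<open>auto simp: inj_on_def ceiling_def\<close>)
  then have "card D = card ((\<lambda>a. \<lfloor>- a\<rfloor>) ` D)" by (rule card_image[symmetric])
  also have "(\<lambda>a. \<lfloor>- a\<rfloor>) ` D = floor ` uminus ` D" by (auto simp: image_image)
  finally show ?thesis using card_floor_le[of "uminus ` D" t] finD assms(3,4) by fastforce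
qed

text \<open>Dividing by the diameter X puts the positions into [-1, 1], and with \<delta> = 1 / X a
  cell corresponds to an interval of length one in \<open>A\<close>, which has at most three points.
  Each cell thus contributes at most 3^2 = 9 to \<open>gsum\<close>. An exact solution of the system
  stays exact under the affine change of variables.\<close>

lemma critical_moment_well_spaced:
  assumes k: "k \<ge> 1" and \<epsilon>: "\<epsilon> > 0"
  shows "\<exists>K\<ge>1. \<forall>(\<Omega> :: (nat \<Rightarrow> real) set set) (f :: real \<Rightarrow> (nat \<Rightarrow> real) set \<Rightarrow> complex) \<mu> A.
    finite \<Omega> \<longrightarrow> (\<forall>w. 0 \<le> \<mu> w) \<longrightarrow> (\<Sum>w\<in>\<Omega>. \<mu> w) = 1 \<longrightarrow> (\<forall>a w. norm (f a w) = 1) \<longrightarrow>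
    (\<forall>xs\<in>tup A (tri k). \<forall>ys\<in>tup A (tri k). family.corr \<Omega> f \<mu> xs ys = (if same_psums k xs ys then 1 else 0)) \<longrightarrow>
    well_spaced A \<longrightarrow> A \<noteq> {} \<longrightarrow> 1 \<le> set_diameter A \<longrightarrow>
    family.moment \<Omega> f \<mu> (tri k) A \<le> K * set_diameter A powr \<epsilon> * real (card A) ^ tri k"
proof -
  define T where "T = tri k"
  have T1: "T \<ge> 1" unfolding T_def by (rule tri_pos[OF k])
  obtain K where K: "K \<ge> 1" "\<And>\<delta>. 0 < \<delta> \<Longrightarrow> \<delta> \<le> 1 \<Longrightarrow> decoupling TYPE(real \<times> (nat \<Rightarrow> real) set) k \<delta> (K * \<delta> powr (- \<epsilon>))"
    using dec_exponent_arbitrary[OF k \<epsilon>, where ?'i = real and ?'w = "(nat \<Rightarrow> real) set"] unfolding dec_exponent_def by blast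
  have "1 * 1 \<le> K * 9 ^ T" using K(1) by (intro mult_mono one_le_power) auto
  then have K9: "K * 9 ^ T \<ge> 1" by simp
  show ?thesis
  proof (intro exI[of _ "K * 9 ^ T"] conjI K9 allI impI)
    fix \<Omega> :: "(nat \<Rightarrow> real) set set" and f :: "real \<Rightarrow> (nat \<Rightarrow> real) set \<Rightarrow> complex" and \<mu> A
    assume h: "finite \<Omega>" "\<forall>w. 0 \<le> \<mu> w" "(\<Sum>w\<in>\<Omega>. \<mu> w) = 1" "\<forall>a w. norm (f a w) = 1"
      and c: "\<forall>xs\<in>tup A (tri k). \<forall>ys\<in>tup A (tri k). family.corr \<Omega> f \<mu> xs ys = (if same_psums k xs ys then 1 else 0)"
      and A: "well_spaced A" "A \<noteq> {}" "1 \<le> set_diameter A"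
    interpret family \<Omega> f by unfold_locales (rule h(1))
    define X where "X = set_diameter A"
    have X: "X \<ge> 1" using A(3) unfolding X_def .
    have finA: "finite A" using A(1) by (simp add: well_spaced_def)
    obtain a0 where a0: "a0 \<in> A" using A(2) by auto
    have dist: "\<bar>a - b\<bar> \<le> X" if "a \<in> A" "b \<in> A" for a b
    proof -
      have "Inf A \<le> a" "a \<le> Sup A" "Inf A \<le> b" "b \<le> Sup A" using finA that by (auto intro: cInf_lower cSup_upper)
      then show ?thesis unfolding X_def set_diameter_def by linarith
    qed
    define \<pi> where "\<pi> = (\<lambda>a. (1 / X) * (a - a0))"
    define \<delta> where "\<delta> = 1 / X"
    have d: "0 < \<delta>" "\<delta> \<le> 1" unfolding \<delta>_def using X by auto
    have wt: "wt \<mu>" using h(2) unfolding wt_def by simp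
    have vin: "vin \<mu> k \<pi> (\<delta> ^ k) A"
      unfolding vin_def approx_def positive_def
    proof (intro conjI ballI impI finA wt)
      fix a assume "a \<in> A"
      then show "\<bar>\<pi> a\<bar> \<le> 1" using dist[OF _ a0] X unfolding \<pi>_def by (simp add: abs_mult)
    next
      fix xs ys assume "xs \<in> tup A (tri k)" "ys \<in> tup A (tri k)"
      then have "corr \<mu> xs ys = (if same_psums k xs ys then 1 else 0)" by (rule bspec[OF bspec[OF c]])
      then show "Im (corr \<mu> xs ys) = 0" "0 \<le> Re (corr \<mu> xs ys)" by auto
    next
      fix xs ys j assume xy: "xs \<in> tup A (tri k)" "ys \<in> tup A (tri k)" "corr \<mu> xs ys \<noteq> 0" "j \<in> {1..k}"
      have s: "same_psums k xs ys" using bspec[OF bspec[OF c xy(1)] xy(2)] xy(3) by (simp split: if_split_asm)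
      have e: "psum (\<lambda>a. a) m xs = psum (\<lambda>a. a) m ys" if "m \<le> j" for m
      proof (cases "m = 0")
        case True
        then show ?thesis using xy(1,2) by simp
      next
        case False
        then show ?thesis using s that xy(4) by auto
      qed
      have "psum (\<lambda>a. a - a0) j xs = psum (\<lambda>a. a - a0) j ys"
        unfolding psum_shift[of "\<lambda>a. a"] by (intro sum.cong refl) (simp add: e)
      then have "psum \<pi> j xs = psum \<pi> j ys" unfolding \<pi>_def psum_scale by simp
      then show "\<bar>psum \<pi> j xs - psum \<pi> j ys\<bar> \<le> \<delta> ^ k" using d by simp
    qed
    define \<kappa> where "\<kappa> = cell 0 \<delta> \<pi>"
    have cellbound: "nm \<mu> T {i\<in>A. \<kappa> i = n} \<le> 9" for n
    proof -
      define D where "D = {i\<in>A. \<kappa> i = n}"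
      have "diam_le \<pi> \<delta> D" unfolding D_def \<kappa>_def by (rule diam_le_cell[OF d(1)])
      then have "\<bar>a - b\<bar> \<le> 1" if "a \<in> D" "b \<in> D" for a b
      proof -
        have "\<bar>\<pi> a - \<pi> b\<bar> \<le> 1 / X" using \<open>diam_le \<pi> \<delta> D\<close> that unfolding diam_le_def \<delta>_def by auto
        moreover have "\<pi> a - \<pi> b = (a - b) / X" unfolding \<pi>_def by (simp add: diff_divide_distrib)
        ultimately show ?thesis using X by (simp add: abs_divide divide_le_cancel)
      qed
      then have "real (card D) \<le> 1 + 2" by (rule_tac card_well_spaced_le[OF A(1)]) (auto simp: D_def)
      then have cD: "real (card D) \<le> 3" by simp
      have "moment \<mu> T D \<le> av \<mu> (\<lambda>w. 9 ^ T * 1)" unfolding moment_def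
      proof (rule av_mono[OF wt])
        fix w
        have "norm (F D w) \<le> (\<Sum>i\<in>D. norm (f i w))" unfolding F_def by (rule norm_sum)
        also have "\<dots> \<le> 3" using cD h(4) by simp
        finally have "norm (F D w) ^ (2 * T) \<le> 3 ^ (2 * T)" by (intro power_mono) auto
        then show "norm (F D w) ^ (2 * T) \<le> 9 ^ T * 1" by (simp add: power_mult)
      qed
      also have "\<dots> = 9 ^ T" unfolding av_cmult using h(3) by (simp add: av_def)
      finally have "moment \<mu> T D \<le> 9 ^ T * 1 ^ T" by simp
      from nm_le[OF wt this T1] show ?thesis unfolding D_def using T1 by (simp add: real_root_power_cancel)
    qed
    have "gsum \<mu> T \<kappa> A \<le> (\<Sum>n\<in>\<kappa> ` A. 9)" unfolding gsum_def by (intro sum_mono cellbound)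
    also have "\<dots> = 9 * real (card (\<kappa> ` A))" by simp
    also have "\<dots> \<le> 9 * real (card A)" using card_image_le[OF finA, of \<kappa>] by simp
    finally have g: "gsum \<mu> T \<kappa> A ^ T \<le> (9 * real (card A)) ^ T" by (rule power_mono) (rule gsum_nonneg[OF wt])
    have "moment \<mu> T A \<le> K * \<delta> powr (- \<epsilon>) * gsum \<mu> T \<kappa> A ^ T"
      using decouplingD[OF K(2)[OF d] vin] unfolding T_def \<kappa>_def .
    also have "\<dots> \<le> K * \<delta> powr (- \<epsilon>) * (9 * real (card A)) ^ T" using K(1) by (intro mult_left_mono g) auto
    also have "\<delta> powr (- \<epsilon>) = X powr \<epsilon>" unfolding \<delta>_def using X by (simp add: powr_minus powr_divide)
    finally show "moment \<mu> (tri k) A \<le> K * 9 ^ T * set_diameter A powr \<epsilon> * real (card A) ^ tri k"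
      unfolding T_def X_def by (simp add: power_mult_distrib mult_ac)
  qed
qed

theorem theorem1p4:
  fixes \<epsilon> :: real and s k :: nat
  assumes "\<epsilon> > 0"
  shows "\<exists>N. \<forall>A :: real set. well_spaced A \<and> card A \<ge> N \<longrightarrow>
           real (mean_value s k A) \<le>
             set_diameter A powr \<epsilon> *
               (real (card A) ^ s + real (card A) powr (2 * real s - real k * (real k + 1) / 2))"
proof -
  define T where "T = tri k"
  have rT: "real k * (real k + 1) / 2 = real T"
  proof -
    have "real (2 * tri k) = real (k * (k + 1))" by (simp only: two_tri)
    then show ?thesis unfolding T_def by (simp add: algebra_simps)
  qed
  \<comment> \<open>Largeness is measured by cardinality, whereas constants are to be absorbed by a
    power of the diameter; this inequality connects the two.\<close>
  have diam: "real (card A) - 2 \<le> set_diameter A" if "well_spaced A" for A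
  proof -
    have finA: "finite A" using that by (simp add: well_spaced_def)
    have "real (card A) \<le> set_diameter A + 2"
    proof (rule card_well_spaced_le[OF that order_refl])
      fix a b assume "a \<in> A" "b \<in> A"
      then have "Inf A \<le> a" "a \<le> Sup A" "Inf A \<le> b" "b \<le> Sup A" using finA by (auto intro: cInf_lower cSup_upper)
      then show "\<bar>a - b\<bar> \<le> set_diameter A" unfolding set_diameter_def by linarith
    qed (simp add: set_diameter_def)
    then show ?thesis by simp
  qed
  show ?thesis
  \<comment> \<open>Decoupling begins in degree one. Without equations the trivial count card A ^ (2
    * s) is already the second term.\<close>
  proof (cases "k = 0")
    case True
    show ?thesis
    proof (intro exI[of _ 3] allI impI, elim conjE)
      fix A :: "real set" assume A: "well_spaced A" "3 \<le> card A"
      have finA: "finite A" using A by (simp add: well_spaced_def)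
      have X: "set_diameter A \<ge> 1" using diam[OF A(1)] A(2) by linarith
      have "mean_value s k A \<le> card (tup A s \<times> tup A s)"
        using mean_value_le_card_tup[OF finA] by (rule order_trans) (intro card_mono, auto intro: finite_lists_length_eq[OF finA])
      also have "\<dots> = card A ^ (2 * s)"
        by (simp add: card_cartesian_product card_lists_length_eq[OF finA] mult_2 power_add)
      finally have "real (mean_value s k A) \<le> real (card A) ^ (2 * s)" by (metis of_nat_le_iff of_nat_power)
      also have "\<dots> = real (card A) powr (2 * real s - real k * (real k + 1) / 2)"
        using True A(2) powr_realpow[of "real (card A)" "2 * s"] by simp
      also have "\<dots> \<le> 1 * (real (card A) ^ s + real (card A) powr (2 * real s - real k * (real k + 1) / 2))" by simp
      also have "\<dots> \<le> set_diameter A powr \<epsilon> * (real (card A) ^ s + real (card A) powr (2 * real s - real k * (real k + 1) / 2))"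
        using X assms by (intro mult_right_mono ge_one_powr_ge_zero) auto
      finally show "real (mean_value s k A) \<le> set_diameter A powr \<epsilon> * (real (card A) ^ s + real (card A) powr (2 * real s - real k * (real k + 1) / 2))" .
    qed
  next
    case False
    then have k: "k \<ge> 1" by simp
    have T1: "T \<ge> 1" unfolding T_def by (rule tri_pos[OF k])
    have e2: "\<epsilon> / 2 > 0" using assms by simp
    obtain K where K: "K \<ge> 1" and K': "\<And>(\<Omega> :: (nat \<Rightarrow> real) set set) (f :: real \<Rightarrow> (nat \<Rightarrow> real) set \<Rightarrow> complex) \<mu> A.
      finite \<Omega> \<Longrightarrow> (\<forall>w. 0 \<le> \<mu> w) \<Longrightarrow> (\<Sum>w\<in>\<Omega>. \<mu> w) = 1 \<Longrightarrow> (\<forall>a w. norm (f a w) = 1) \<Longrightarrow>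
      (\<forall>xs\<in>tup A (tri k). \<forall>ys\<in>tup A (tri k). family.corr \<Omega> f \<mu> xs ys = (if same_psums k xs ys then 1 else 0)) \<Longrightarrow>
      well_spaced A \<Longrightarrow> A \<noteq> {} \<Longrightarrow> 1 \<le> set_diameter A \<Longrightarrow>
      family.moment \<Omega> f \<mu> (tri k) A \<le> K * set_diameter A powr (\<epsilon>/2) * real (card A) ^ tri k"
      using critical_moment_well_spaced[OF k e2] by blast
    \<comment> \<open>Forces X \<ge> K^(2 / \<epsilon>), so that X^(\<epsilon> / 2) absorbs K. The 3
      makes up for the 2 in \<open>diam\<close> and leaves X \<ge> 1.\<close>
    obtain N :: nat where N: "real N \<ge> K powr (2 / \<epsilon>) + 3" using real_arch_simple by blast
    show ?thesis
    proof (intro exI[of _ N] allI impI, elim conjE)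
      fix A :: "real set" assume A: "well_spaced A" "N \<le> card A"
      have finA: "finite A" using A by (simp add: well_spaced_def)
      define X where "X = set_diameter A"
      have XK: "X \<ge> K powr (2 / \<epsilon>)" and c3: "card A \<ge> 3" and X1: "X \<ge> 1"
        using diam[OF A(1)] N A(2) powr_ge_zero[of K "2 / \<epsilon>"] unfolding X_def by linarith+
      have Ane: "A \<noteq> {}" using c3 by auto
      have KX: "K * X powr (\<epsilon>/2) \<le> X powr \<epsilon>"
      proof -
        have "K = (K powr (2 / \<epsilon>)) powr (\<epsilon> / 2)" using K assms by (simp add: powr_powr)
        also have "\<dots> \<le> X powr (\<epsilon> / 2)" using XK assms by (intro powr_mono2) auto
        finally have "K * X powr (\<epsilon>/2) \<le> X powr (\<epsilon>/2) * X powr (\<epsilon>/2)" by (intro mult_right_mono) auto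
        then show ?thesis by (simp add: powr_add[symmetric])
      qed
      \<comment> \<open>The order \<open>s + T\<close> makes one family exact both for the
        \<open>s\<close>-tuples to be counted and for the \<open>T\<close>-tuples of the critical
        moment.\<close>
      obtain \<Omega> :: "(nat \<Rightarrow> real) set set" and f :: "real \<Rightarrow> (nat \<Rightarrow> real) set \<Rightarrow> complex" and \<mu>
        where fam: "finite \<Omega>" "\<And>w. 0 \<le> \<mu> w" "(\<Sum>w\<in>\<Omega>. \<mu> w) = 1" "\<And>a w. norm (f a w) = 1"
          "\<And>L xs ys. L \<le> s + T \<Longrightarrow> xs \<in> tup A L \<Longrightarrow> ys \<in> tup A L \<Longrightarrow>
            family.corr \<Omega> f \<mu> xs ys = (if same_psums k xs ys then 1 else 0)"
        by (rule exists_exact_family[OF finA, of "s + T" k]) blast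
      interpret family \<Omega> f by unfold_locales (rule fam(1))
      have wt: "wt \<mu>" using fam(2) unfolding wt_def by simp
      define J where "J = moment \<mu> s A"
      have J0: "J \<ge> 0" unfolding J_def by (rule moment_nonneg[OF wt])
      have mv: "real (mean_value s k A) \<le> J"
      proof -
        have fint: "finite (tup A s)" by (rule finite_lists_length_eq[OF finA])
        have "complex_of_real J = (\<Sum>xs\<in>tup A s. \<Sum>ys\<in>tup A s. if same_psums k xs ys then 1 else 0)"
          unfolding J_def moment_eq_corr[OF finA] by (intro sum.cong refl fam(5)) auto
        also have "\<dots> = (\<Sum>p\<in>tup A s \<times> tup A s. if same_psums k (fst p) (snd p) then 1 else 0)"
          by (simp add: sum.cartesian_product case_prod_unfold)
        also have "\<dots> = of_nat (card {p\<in>tup A s \<times> tup A s. same_psums k (fst p) (snd p)})"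
          using fint by (simp add: sum.If_cases Int_def)
        also have "{p\<in>tup A s \<times> tup A s. same_psums k (fst p) (snd p)} = {(xs, ys)\<in>tup A s \<times> tup A s. same_psums k xs ys}"
          by auto
        finally have "complex_of_real J = complex_of_real (real (card {(xs, ys)\<in>tup A s \<times> tup A s. same_psums k xs ys}))"
          by (simp only: of_real_of_nat_eq)
        then have "J = real (card {(xs, ys)\<in>tup A s \<times> tup A s. same_psums k xs ys})"
          by (simp only: of_real_eq_iff)
        then show ?thesis using mean_value_le_card_tup[OF finA, of s k] by simp
      qed
      have crit: "moment \<mu> T A \<le> X powr \<epsilon> * real (card A) ^ T"
      proof -
        have "moment \<mu> T A \<le> K * X powr (\<epsilon>/2) * real (card A) ^ T"
          unfolding T_def X_def
          by (rule K'[OF fam(1)]) (use fam A Ane X1 in \<open>auto simp: X_def T_def\<close>)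
        also have "\<dots> \<le> X powr \<epsilon> * real (card A) ^ T" by (intro mult_right_mono KX) auto
        finally show ?thesis .
      qed
      have X\<epsilon>: "X powr \<epsilon> \<ge> 1" using X1 assms by (intro ge_one_powr_ge_zero) auto
      have "J \<le> X powr \<epsilon> * (real (card A) ^ s + real (card A) powr (2 * real s - real T))"
      \<comment> \<open>Below the critical exponent, Hoelder's inequality against total mass 1
        yields the first term. Above it, the surplus factors are bounded trivially by card A, which
        yields the second.\<close>
      proof (cases "s \<le> T")
        case True
        have "J ^ (s + (T - s)) \<le> moment \<mu> T A ^ s * av \<mu> (\<lambda>_. 1) ^ (T - s)"
          unfolding J_def moment_def
          by (rule av_holder[OF wt]) (use True T1 in \<open>auto simp: power_mult[symmetric] mult_ac\<close>)
        also have "av \<mu> (\<lambda>_. 1) = 1" unfolding av_def using fam(3) by simp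
        also have "moment \<mu> T A ^ s * 1 ^ (T - s) = moment \<mu> T A ^ s" by simp
        also have "\<dots> \<le> (X powr \<epsilon> * real (card A) ^ T) ^ s"
          using crit by (rule power_mono) (rule moment_nonneg[OF wt])
        also have "\<dots> = (X powr \<epsilon>) ^ s * (real (card A) ^ s) ^ T"
          by (simp add: power_mult_distrib power_mult[symmetric] mult.commute)
        also have "\<dots> \<le> (X powr \<epsilon>) ^ T * (real (card A) ^ s) ^ T"
          using X\<epsilon> True by (intro mult_right_mono power_increasing) auto
        also have "\<dots> = (X powr \<epsilon> * real (card A) ^ s) ^ T" by (simp only: power_mult_distrib)
        finally have "J ^ T \<le> (X powr \<epsilon> * real (card A) ^ s) ^ T" using True by simp
        then have "J \<le> X powr \<epsilon> * real (card A) ^ s" using T1 J0 by (subst (asm) power_mono_iff) auto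
        also have "\<dots> \<le> X powr \<epsilon> * (real (card A) ^ s + real (card A) powr (2 * real s - real T))"
          by (intro mult_left_mono) auto
        finally show ?thesis .
      next
        case False
        define n where "n = s - T"
        have n: "s = n + T" unfolding n_def using False by simp
        have "J \<le> av \<mu> (\<lambda>w. real (card A) ^ (2 * n) * norm (F A w) ^ (2 * T))"
          unfolding J_def moment_def
        proof (rule av_mono[OF wt])
          fix w
          have "norm (F A w) \<le> (\<Sum>i\<in>A. norm (f i w))" unfolding F_def by (rule norm_sum)
          also have "\<dots> = real (card A)" using fam(4) by simp
          finally have "norm (F A w) ^ (2 * n) \<le> real (card A) ^ (2 * n)" by (intro power_mono) auto
          then have "norm (F A w) ^ (2 * n) * norm (F A w) ^ (2 * T) \<le> real (card A) ^ (2 * n) * norm (F A w) ^ (2 * T)"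
            by (intro mult_right_mono) auto
          then show "norm (F A w) ^ (2 * s) \<le> real (card A) ^ (2 * n) * norm (F A w) ^ (2 * T)"
            unfolding n distrib_left power_add .
        qed
        also have "\<dots> = real (card A) ^ (2 * n) * moment \<mu> T A" unfolding av_cmult moment_def ..
        also have "\<dots> \<le> real (card A) ^ (2 * n) * (X powr \<epsilon> * real (card A) ^ T)"
          using crit by (intro mult_left_mono) auto
        also have "\<dots> = X powr \<epsilon> * real (card A) ^ (2 * n + T)" by (simp add: power_add mult_ac)
        also have "real (card A) ^ (2 * n + T) = real (card A) powr (2 * real s - real T)"
        proof -
          have "2 * real s - real T = real (2 * n + T)" unfolding n by simp
          then show ?thesis using c3 by (simp only: powr_realpow)
        qed
        also have "X powr \<epsilon> * real (card A) powr (2 * real s - real T)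
          \<le> X powr \<epsilon> * (real (card A) ^ s + real (card A) powr (2 * real s - real T))"
          by (intro mult_left_mono) auto
        finally show ?thesis .
      qed
      then show "real (mean_value s k A) \<le> set_diameter A powr \<epsilon> *
        (real (card A) ^ s + real (card A) powr (2 * real s - real k * (real k + 1) / 2))"
        unfolding rT X_def using mv by linarith
    qed
  qed
qed

end
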